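(* Let $X=(X_t)_{t\ge 0}$ be a symmetric Lévy process in $\mathbb{R}^d$ with infinite Lévy measure having a strictly positive density $\nu$ (see context), and let $V$ be an $X$-Kato decomposable potential with $V(x)\to 0$ as $|x|\to\infty$. Suppose that $\varphi\in L^2(\mathbb{R}^d)$ is a positive eigenfunction of the non-local Schrödinger operator $H$ at an eigenvalue $\lambda\in\mathbb{R}$. Assume there are a non-increasing function $g:(0,\infty)\to(0,\infty)$ and a constant $C_5\ge 1$ with $C_5^{-1}g(|x|)\le \nu(x)\le C_5\, g(|x|)$ for all $x\ne 0$. Consider the conditions: (a) there is a constant $C_6$ such that $g(|x|)\le C_6\, g(|x|+1)$ for all $|x|\ge 1$; (b) there is a constant $C_7$ such that $\int_{|x-y|>1,\,|y|>1} g(|x-y|)g(|y|)\,dy\le C_7\, g(|x|)$ for all $|x|\ge 1$. Then the following hold. (1) If (a) holds, then for every $\delta>0$ there exists $r=r(V,\delta)\ge 1$ such that $$\varphi(x)\ge K\,\nu(x),\qquad |x|>r+1,$$ where $$K:=\frac{1-e^{-(|\lambda|+\delta)}}{C_5^2\, C_6^{\lceil r\rceil+1}(|\lambda|+\delta)}\;\mathbf{P}^0(\tau_{B(0,1)}>1)\int_{B(0,r)}\varphi(z)\,dz .$$ (2) In either of the following two disjoint cases, (i) condition (a) holds and condition (b) does not hold, or (ii) condition (a) does not hold (and hence also (b) does not hold), we have $$\limsup_{|x|\to\infty}\frac{\varphi(x)}{\nu(x)}=\infty .$$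
   Context: Process. $X=(X_t)_{t\ge0}$ is a symmetric Lévy process with values in $\mathbb{R}^d$, $d\ge1$; $\mathbf{P}^x,\mathbf{E}^x$ are the law and expectation for the process started at $x$. It is determined by $\mathbf{E}^0[e^{i\xi\cdot X_t}]=e^{-t\psi(\xi)}$ with $\psi(\xi)=A\xi\cdot\xi+\int(1-\cos(\xi\cdot z))\,\nu(dz)$, where $A$ is a symmetric non-negative definite matrix and $\nu$ is a symmetric Lévy measure. Standing assumption: $\nu(\mathbb{R}^d\setminus\{0\})=\infty$ and $\nu(dx)=\nu(x)dx$ with $\nu(x)>0$ (the density is also denoted $\nu$). $B(x,r)$ is the open ball, and $\tau_D=\inf\{t\ge0:X_t\notin D\}$ is the first exit time from $D$. Potentials. A Borel function $V$ belongs to the Kato class $\mathcal{K}^X$ if $\lim_{t\downarrow0}\sup_{x}\mathbf{E}^x[\int_0^t|V(X_s)|ds]=0$; $V\in\mathcal{K}^X_{\rm loc}$ if $V\mathbf 1_B\in\mathcal{K}^X$ for all compact $B$. $V:\mathbb{R}^d\to\mathbb{R}$ is $X$-Kato decomposable if its negative part satisfies $V_-\in\mathcal{K}^X$ and its positive part satisfies $V_+\in\mathcal{K}^X_{\rm loc}$. Operator and eigenfunctions. $T_tf(x)=\mathbf{E}^x[e^{-\int_0^tV(X_s)ds}f(X_t)]$ defines a strongly continuous symmetric semigroup on $L^2(\mathbb{R}^d)$, and $H$ is the self-adjoint operator, bounded from below, with $e^{-tH}=T_t$. An eigenfunction at the eigenvalue $\lambda$ is $0\neq\varphi\in L^2(\mathbb{R}^d)$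 with $T_t\varphi=e^{-\lambda t}\varphi$ for all $t>0$. Convention: eigenfunctions are normalized by $\|\varphi\|_2=1$ and are taken in their bounded continuous version, so that $T_t\varphi(x)=e^{-\lambda t}\varphi(x)$ for every $x\in\mathbb{R}^d$, $t>0$. *)

theory Defs
  imports "HOL-Probability.Probability"
begin

definition cadlag :: "(real \<Rightarrow> 'a::topological_space) \<Rightarrow> bool" where
  "cadlag f \<longleftrightarrow>
     (\<forall>t\<ge>0. (f \<longlongrightarrow> f t) (at_right t)) \<and>
     (\<forall>t>0. \<exists>l. (f \<longlongrightarrow> l) (at_left t))"

text \<open>The process \<open>X\<close> on the probability space \<open>M\<close> is the one started at 0; its law started
  at \<open>x\<close> is the law of \<open>x + X\<close>. Accordingly, everywhere below an expectation under
  \<open>\<^bold>P\<^sup>x\<close> is the expectation over \<open>M\<close> with \<open>X s\<close> replaced by \<open>x + X s\<close>.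
  Path properties are required for every \<open>\<omega>\<close> (as on the canonical path space), so that
  functionals such as the time integrals below are measurable without completing \<open>M\<close>.\<close>

definition levy_process :: "'w measure \<Rightarrow> (real \<Rightarrow> 'w \<Rightarrow> real ^ 'n) \<Rightarrow> bool" where
  "levy_process M X \<longleftrightarrow>
     prob_space M \<and>
     (\<forall>t\<ge>0. X t \<in> borel_measurable M) \<and>
     (\<forall>\<omega>\<in>space M. X 0 \<omega> = 0 \<and> cadlag (\<lambda>t. X t \<omega>)) \<and>
     (\<forall>s\<ge>0. \<forall>t\<ge>0. distr M borel (\<lambda>\<omega>. X (s + t) \<omega> - X s \<omega>) = distr M borel (X t)) \<and>
     (\<forall>(n::nat) t. 0 \<le> t 0 \<and> (\<forall>i<n. t i \<le> t (Suc i)) \<longrightarrow>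
        prob_space.indep_vars M (\<lambda>_. borel) (\<lambda>i \<omega>. X (t (Suc i)) \<omega> - X (t i) \<omega>) {..<n})"

definition levy_measure :: "(real ^ 'n) measure \<Rightarrow> bool" where
  "levy_measure N \<longleftrightarrow>
     sets N = sets borel \<and> emeasure N {0} = 0 \<and>
     (\<integral>\<^sup>+z. ennreal (min 1 ((norm z)\<^sup>2)) \<partial>N) < \<infinity>"

definition levy_exponent :: "real ^ 'n ^ 'n \<Rightarrow> (real ^ 'n) measure \<Rightarrow> real ^ 'n \<Rightarrow> real" where
  "levy_exponent A N \<xi> = (A *v \<xi>) \<bullet> \<xi> + (\<integral>z. 1 - cos (\<xi> \<bullet> z) \<partial>N)"

definition symmetric_levy_process ::
  "'w measure \<Rightarrow> (real \<Rightarrow> 'w \<Rightarrow> real ^ 'n) \<Rightarrow> real ^ 'n ^ 'n \<Rightarrow> (real ^ 'n) measure \<Rightarrow> bool"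
where
  "symmetric_levy_process M X A N \<longleftrightarrow>
     levy_process M X \<and>
     transpose A = A \<and> (\<forall>\<xi>. 0 \<le> (A *v \<xi>) \<bullet> \<xi>) \<and>
     levy_measure N \<and> distr N borel uminus = N \<and>
     (\<forall>t\<ge>0. \<forall>\<xi>. (\<integral>\<omega>. exp (\<i> * complex_of_real (\<xi> \<bullet> X t \<omega>)) \<partial>M)
                 = exp (complex_of_real (- t * levy_exponent A N \<xi>)))"

definition exit_time :: "(real \<Rightarrow> 'w \<Rightarrow> real ^ 'n) \<Rightarrow> (real ^ 'n) set \<Rightarrow> 'w \<Rightarrow> ereal" where
  "exit_time X D \<omega> = Inf {ereal t |t. 0 \<le> t \<and> X t \<omega> \<notin> D}"

text \<open>\<open>\<^bold>P\<^sup>0(\<tau>\<^sub>D > t)\<close>. First exit times are in general measurable only with respect to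
  the completed \<open>\<sigma>\<close>-algebra, hence the completion.\<close>

definition survival_prob ::
  "'w measure \<Rightarrow> (real \<Rightarrow> 'w \<Rightarrow> real ^ 'n) \<Rightarrow> (real ^ 'n) set \<Rightarrow> real \<Rightarrow> real"
where
  "survival_prob M X D t = measure (completion M) {\<omega> \<in> space M. ereal t < exit_time X D \<omega>}"

definition kato_class ::
  "'w measure \<Rightarrow> (real \<Rightarrow> 'w \<Rightarrow> real ^ 'n) \<Rightarrow> (real ^ 'n \<Rightarrow> real) \<Rightarrow> bool"
where
  "kato_class M X V \<longleftrightarrow>
     V \<in> borel_measurable borel \<and>
     ((\<lambda>t. SUP x. \<integral>\<^sup>+\<omega>. (\<integral>\<^sup>+s\<in>{0..t}. ennreal \<bar>V (x + X s \<omega>)\<bar> \<partial>lborel) \<partial>M)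
        \<longlongrightarrow> 0) (at_right 0)"

definition kato_class_loc ::
  "'w measure \<Rightarrow> (real \<Rightarrow> 'w \<Rightarrow> real ^ 'n) \<Rightarrow> (real ^ 'n \<Rightarrow> real) \<Rightarrow> bool"
where
  "kato_class_loc M X V \<longleftrightarrow>
     V \<in> borel_measurable borel \<and>
     (\<forall>B. compact B \<longrightarrow> kato_class M X (\<lambda>x. V x * indicator B x))"

definition kato_decomposable ::
  "'w measure \<Rightarrow> (real \<Rightarrow> 'w \<Rightarrow> real ^ 'n) \<Rightarrow> (real ^ 'n \<Rightarrow> real) \<Rightarrow> bool"
where
  "kato_decomposable M X V \<longleftrightarrow>
     V \<in> borel_measurable borel \<and>
     kato_class M X (\<lambda>x. max 0 (- V x)) \<and>
     kato_class_loc M X (\<lambda>x. max 0 (V x))"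

definition feynman_kac ::
  "'w measure \<Rightarrow> (real \<Rightarrow> 'w \<Rightarrow> real ^ 'n) \<Rightarrow> (real ^ 'n \<Rightarrow> real) \<Rightarrow>
     real \<Rightarrow> (real ^ 'n \<Rightarrow> real) \<Rightarrow> real ^ 'n \<Rightarrow> real"
where
  "feynman_kac M X V t f x =
     (\<integral>\<omega>. exp (- (LINT s:{0..t}|lborel. V (x + X s \<omega>))) * f (x + X t \<omega>) \<partial>M)"

text \<open>Eigenfunctions of \<open>H\<close>, where \<open>e\<^sup>-\<^sup>t\<^sup>H = T\<^sub>t\<close> is the Feynman-Kac semigroup above. The
  eigenfunction is \<open>L\<^sup>2\<close>-normalised and taken in its bounded continuous version, for which
  the eigenvalue equation holds at every point.\<close>

definition eigenfunction ::
  "'w measure \<Rightarrow> (real \<Rightarrow> 'w \<Rightarrow> real ^ 'n) \<Rightarrow> (real ^ 'n \<Rightarrow> real) \<Rightarrow>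
     real \<Rightarrow> (real ^ 'n \<Rightarrow> real) \<Rightarrow> bool"
where
  "eigenfunction M X V lam \<phi> \<longleftrightarrow>
     continuous_on UNIV \<phi> \<and> bounded (range \<phi>) \<and>
     integrable lborel (\<lambda>x. (\<phi> x)\<^sup>2) \<and> (\<integral>x. (\<phi> x)\<^sup>2 \<partial>lborel) = 1 \<and>
     (\<forall>t>0. \<forall>x. feynman_kac M X V t \<phi> x = exp (- lam * t) * \<phi> x)"

text \<open>The two conditions on the profile \<open>g\<close>. The \<open>itself\<close> argument carries the dimension of
  the space in which \<open>x\<close> and \<open>y\<close> range. The integral in the second condition is taken in
  \<open>[0, \<infinity>]\<close>.\<close>

definition shift_cond :: "'n::finite itself \<Rightarrow> (real \<Rightarrow> real) \<Rightarrow> real \<Rightarrow> bool" where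
  "shift_cond (_ :: 'n itself) g C \<longleftrightarrow>
     (\<forall>x :: real ^ 'n. 1 \<le> norm x \<longrightarrow> g (norm x) \<le> C * g (norm x + 1))"

definition convolution_cond :: "'n::finite itself \<Rightarrow> (real \<Rightarrow> real) \<Rightarrow> real \<Rightarrow> bool" where
  "convolution_cond (_ :: 'n itself) g C \<longleftrightarrow>
     (\<forall>x :: real ^ 'n. 1 \<le> norm x \<longrightarrow>
        (\<integral>\<^sup>+y\<in>{y. 1 < norm (x - y) \<and> 1 < norm y}.
            ennreal (g (norm (x - y)) * g (norm y)) \<partial>lborel) \<le> ennreal (C * g (norm x)))"

end

theory Submission
  imports Defs
begin

text \<open>The lower bounds come from paths that stay in \<open>D = B(x,1)\<close> up to some time and then jump into a
  set \<open>U\<close>. Instead of stopping times and the Ikeda-Watanabe formula, time is discretised with mesh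
  \<open>h\<close>. From \<open>y \<in> D\<close>, one step of the eigenvalue equation gives
  \<open>\<phi> y \<ge> exp (- c h) (E[\<phi> (y + X h); y + X h \<in> D] + h b - o(h))\<close> with \<open>c = \<bar>\<lambda>\<bar> + \<delta>\<close>, where \<open>h b\<close>
  bounds the contribution of a jump into \<open>U\<close> from below, and iterating over the grid produces a
  Riemann sum for \<open>\<integral> exp (- c s) ds\<close> times the probability of staying in \<open>D\<close>.

  Two estimates, both uniform in \<open>y \<in> D\<close>, are needed. First, \<open>E[F (y + X h)] / h\<close> tends to
  \<open>\<integral> F (y + z) \<nu>(dz)\<close> for \<open>F\<close> supported away from \<open>D\<close>: the laws of \<open>X h\<close>, weighted with
  \<open>(1 - exp (- \<bar>z\<bar>\<^sup>2 / 2)) / h\<close>, have bounded mass and characteristic functions expressible through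
  Gaussian averages of \<open>(1 - exp (- h \<psi>)) / h\<close>. Second, the part of \<open>V\<close> exceeding \<open>\<delta>\<close>, which
  lives far from \<open>D\<close>, costs only \<open>o(h)\<close>: to feel it the process must leave a ball, which has
  probability \<open>O(h)\<close>, and afterwards the Kato condition contributes a factor \<open>o(1)\<close>.\<close>

section \<open>The standard Gaussian measure\<close>

text \<open>The Gaussian weight works because it is one minus a characteristic function: multiplying
  a cosine by it subtracts the Gaussian average of the cosine over frequencies. So the weighted laws
  of \<open>X h\<close> are governed by \<psi> alone, and no density or moment of \<open>X h\<close>
  enters. The matrix \<open>A\<close> leaves only an atom at 0 in the limit, and functions vanishing
  at 0 ignore it. The shape of \<open>r\<close> comes from the potential: \<open>V\<close> may be
  unbounded on compact sets, so the region where it exceeds \<delta> must keep a fixed distance from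
  \<open>ball x 1\<close>; half a unit is reserved for this. Negative values of \<open>V\<close>
  only help. For the limsup, everything rests on one jump estimate with a freely chosen target. If
  (a) fails, the target is a ball shifted towards \<open>x\<close>, which makes the jump at least
  one unit shorter than \<open>norm x\<close>. If (a) holds and (b) fails, a bound like that of part
  (1) is fed back as a minorant of \<phi> on the whole target, and the jump integral becomes the
  convolution in (b). Enlarging the constant forces the failure of (a) or (b) to occur far from the
  origin.\<close>

lemma lborel_integral_euclidean_affine:
  fixes f :: "'a::euclidean_space \<Rightarrow> real"
  assumes [measurable]: "f \<in> borel_measurable borel" and "c \<noteq> 0"
  shows "(\<integral>x. f x \<partial>lborel) = \<bar>c\<bar> ^ DIM('a) * (\<integral>x. f (t + c *\<^sub>R x) \<partial>lborel)"
proof -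
  have "(\<integral>x. f x \<partial>lborel) = (\<integral>x. f x \<partial>density (distr lborel borel (\<lambda>x. t + c *\<^sub>R x)) (\<lambda>_. ennreal (\<bar>c\<bar> ^ DIM('a))))"
    using lborel_affine[OF \<open>c \<noteq> 0\<close>, of t] by simp
  also have "\<dots> = \<bar>c\<bar> ^ DIM('a) * (\<integral>x. f (t + c *\<^sub>R x) \<partial>lborel)"
    by (subst integral_density) (auto simp: integral_distr)
  finally show ?thesis .
qed

lemma
  fixes f :: "'a::euclidean_space \<Rightarrow> real \<Rightarrow> 'b::{real_normed_field,banach,second_countable_topology}"
  assumes f: "\<And>b. b \<in> Basis \<Longrightarrow> integrable lborel (f b)"
  shows lborel_integrable_prod: "integrable lborel (\<lambda>x::'a. \<Prod>b\<in>Basis. f b (x \<bullet> b))"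
    and lborel_integral_prod: "(\<integral>x. (\<Prod>b\<in>Basis. f b (x \<bullet> b)) \<partial>lborel) = (\<Prod>b\<in>Basis. \<integral>x. f b x \<partial>lborel)"
proof -
  interpret product_sigma_finite "\<lambda>_::'a. lborel :: real measure" ..
  have [measurable]: "f b \<in> borel_measurable borel" if "b \<in> Basis" for b
    using f[OF that] by (simp add: borel_measurable_integrable)
  have m: "(\<lambda>x::'a. \<Prod>b\<in>Basis. f b (x \<bullet> b)) \<in> borel_measurable borel"
    by measurable
  have m2: "(\<lambda>f. \<Sum>b\<in>Basis. f b *\<^sub>R b) \<in> measurable (\<Pi>\<^sub>M b\<in>Basis. lborel) (borel :: 'a measure)"
    by measurable
  have eq: "(\<Prod>b\<in>Basis. f b ((\<Sum>b\<in>Basis. x b *\<^sub>R b) \<bullet> b)) = (\<Prod>b\<in>Basis. f b (x b))" for x :: "'a \<Rightarrow> real"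
    by (intro prod.cong) (auto simp: inner_sum_left_Basis)
  have int: "integrable (\<Pi>\<^sub>M b\<in>Basis. lborel) (\<lambda>x. \<Prod>b\<in>Basis. f b (x b))"
    by (intro product_integrable_prod f) auto
  show "integrable lborel (\<lambda>x::'a. \<Prod>b\<in>Basis. f b (x \<bullet> b))"
    by (subst lborel_eq, subst integrable_distr_eq[OF m2 m]) (simp add: eq int)
  show "(\<integral>x. (\<Prod>b\<in>Basis. f b (x \<bullet> b)) \<partial>lborel) = (\<Prod>b\<in>Basis. \<integral>x. f b x \<partial>lborel)"
    by (subst lborel_eq, subst integral_distr[OF m2 m])
      (simp add: eq product_integral_prod f)
qed

text \<open>The product over \<open>Basis\<close> makes integrals factor over the coordinates; the
  radial form is recovered in \<open>gauss_density_exp\<close>.\<close>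

definition gauss_density :: "'a::euclidean_space \<Rightarrow> real" where
  "gauss_density x = (\<Prod>b\<in>Basis. std_normal_density (x \<bullet> b))"

definition gauss :: "'a::euclidean_space measure" where
  "gauss = density lborel (\<lambda>x. ennreal (gauss_density x))"

lemma gauss_density_measurable [measurable]: "gauss_density \<in> borel_measurable borel"
  unfolding gauss_density_def[abs_def] by measurable

lemma gauss_density_pos: "0 < gauss_density x"
  unfolding gauss_density_def by (intro prod_pos) (auto simp: normal_density_pos)

lemma gauss_density_nonneg [simp]: "0 \<le> gauss_density x"
  using gauss_density_pos[of x] by simp

text \<open>The normalising constant stays in the form \<open>gauss_density 0\<close>, a factor that
  later formulas merely carry along.\<close>

lemma gauss_density_exp:
  fixes x :: "'a::euclidean_space"
  shows "gauss_density x = gauss_density (0::'a) * exp (- (norm x)\<^sup>2 / 2)"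
proof -
  have n: "(norm x)\<^sup>2 = (\<Sum>b\<in>Basis. (x \<bullet> b)\<^sup>2)" for x :: 'a
    unfolding norm_eq_sqrt_inner power2_eq_square euclidean_inner[of x x]
    by (simp add: sum_nonneg)
  have e: "gauss_density x = (1 / sqrt (2 * pi)) ^ DIM('a) * exp (- (norm x)\<^sup>2 / 2)" for x :: 'a
  proof -
    have "exp (- (norm x)\<^sup>2 / 2) = (\<Prod>b\<in>Basis. exp (- (x \<bullet> b)\<^sup>2 / 2))"
      by (simp add: exp_sum[symmetric] sum_negf sum_divide_distrib n)
    then show ?thesis
      unfolding gauss_density_def std_normal_density_def by (simp only: prod.distrib prod_constant)
  qed
  show ?thesis by (simp only: e) simp
qed

lemma integrable_gauss_density: "integrable lborel gauss_density"
  unfolding gauss_density_def[abs_def] by (intro lborel_integrable_prod) auto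

lemma integral_gauss_density: "(\<integral>x. gauss_density x \<partial>(lborel :: 'a::euclidean_space measure)) = 1"
  unfolding gauss_density_def[abs_def] by (subst lborel_integral_prod) auto

lemma sets_gauss [simp, measurable_cong]: "sets gauss = sets borel"
  and space_gauss [simp]: "space gauss = UNIV"
  by (simp_all add: gauss_def)

lemma prob_space_gauss: "prob_space (gauss :: 'a::euclidean_space measure)"
proof
  have "emeasure (gauss :: 'a measure) UNIV = (\<integral>\<^sup>+x. ennreal (gauss_density x) \<partial>(lborel :: 'a measure))"
    by (simp add: gauss_def emeasure_density)
  also have "\<dots> = 1"
    by (subst nn_integral_eq_integral) (auto simp: integrable_gauss_density integral_gauss_density)
  finally show "emeasure (gauss :: 'a measure) (space gauss) = 1" by simp
qed

interpretation gauss: prob_space "gauss :: 'a::euclidean_space measure"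
  by (rule prob_space_gauss)

lemma gauss_prob_UNIV [simp]: "measure gauss UNIV = 1"
  using gauss.prob_space by simp

lemma gauss_integrable_const [simp]: "integrable gauss (\<lambda>_. c :: real)"
  and gauss_const [simp]: "(\<integral>x. c \<partial>(gauss :: 'a::euclidean_space measure)) = (c :: real)"
  using gauss.prob_space by auto

lemma gauss_char:
  "(\<integral>x. exp (\<i> * complex_of_real (z \<bullet> x)) \<partial>gauss) = exp (complex_of_real (- (norm z)\<^sup>2 / 2))"
proof -
  have 1: "integrable lborel (\<lambda>x. iexp (t * x) * complex_of_real (std_normal_density x))" for t :: real
    by (rule Bochner_Integration.integrable_bound[of _ std_normal_density])
      (auto simp: norm_mult)
  have 2: "(\<integral>x. iexp (t * x) * complex_of_real (std_normal_density x) \<partial>lborel) = exp (complex_of_real (- t\<^sup>2 / 2))" for t :: real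
  proof -
    have "(\<integral>x. iexp (t * x) * complex_of_real (std_normal_density x) \<partial>lborel) = char std_normal_distribution t"
      unfolding char_def by (subst integral_density) (auto simp: mult.commute scaleR_conv_of_real)
    also have "\<dots> = exp (complex_of_real (- t\<^sup>2 / 2))"
      unfolding char_std_normal_distribution by (rule exp_of_real[symmetric])
    finally show ?thesis .
  qed
  have n: "(norm z)\<^sup>2 = (\<Sum>b\<in>Basis. (z \<bullet> b)\<^sup>2)"
    unfolding norm_eq_sqrt_inner power2_eq_square euclidean_inner[of z z]
    by (simp add: sum_nonneg)
  have "(\<integral>x. exp (\<i> * complex_of_real (z \<bullet> x)) \<partial>gauss)
     = (\<integral>x. (\<Prod>b\<in>Basis. iexp ((z \<bullet> b) * (x \<bullet> b)) * complex_of_real (std_normal_density (x \<bullet> b))) \<partial>lborel)"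
  proof -
    have "exp (\<i> * complex_of_real (z \<bullet> x)) = (\<Prod>b\<in>Basis. iexp ((z \<bullet> b) * (x \<bullet> b)))" for x
      by (subst euclidean_inner[of z x]) (simp add: exp_sum sum_distrib_left)
    then show ?thesis
      unfolding gauss_def gauss_density_def
      by (subst integral_density) (auto simp: scaleR_conv_of_real prod.distrib mult.commute prod_nonneg)
  qed
  also have "\<dots> = (\<Prod>b\<in>Basis. exp (complex_of_real (- (z \<bullet> b)\<^sup>2 / 2)))"
    using lborel_integral_prod[OF 1, of "\<lambda>b. z \<bullet> b"] by (simp only: 2)
  also have "\<dots> = exp (complex_of_real (- (norm z)\<^sup>2 / 2))"
    by (simp add: exp_sum[symmetric] n sum_negf sum_divide_distrib)
  finally show ?thesis .
qed

lemma gauss_cos: "(\<integral>x. cos (z \<bullet> x) \<partial>gauss) = exp (- (norm z)\<^sup>2 / 2)"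
  and gauss_sin: "(\<integral>x. sin (z \<bullet> x) \<partial>gauss) = 0"
proof -
  have i: "integrable gauss (\<lambda>x. exp (\<i> * complex_of_real (z \<bullet> x)))"
    by (rule gauss.integrable_const_bound[of _ 1]) auto
  have "(\<integral>x. Re (exp (\<i> * complex_of_real (z \<bullet> x))) \<partial>gauss) = Re (exp (complex_of_real (- (norm z)\<^sup>2 / 2)))"
    "(\<integral>x. Im (exp (\<i> * complex_of_real (z \<bullet> x))) \<partial>gauss) = Im (exp (complex_of_real (- (norm z)\<^sup>2 / 2)))"
    by (simp_all only: integral_Re[OF i] integral_Im[OF i] gauss_char)
  then show "(\<integral>x. cos (z \<bullet> x) \<partial>gauss) = exp (- (norm z)\<^sup>2 / 2)" "(\<integral>x. sin (z \<bullet> x) \<partial>gauss) = 0"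
    by (simp_all add: Re_exp Im_exp)
qed

lemma gauss_integrable_norm_sq: "integrable gauss (\<lambda>x::'a::euclidean_space. (norm x)\<^sup>2)"
proof -
  have *: "integrable gauss (\<lambda>x::'a. (x \<bullet> b)\<^sup>2)" if "b \<in> Basis" for b
  proof -
    have "integrable lborel (\<lambda>x::'a. \<Prod>c\<in>Basis. (\<lambda>c t. std_normal_density t * (if c = b then t\<^sup>2 else 1)) c (x \<bullet> c))"
    proof (rule lborel_integrable_prod)
      fix c :: 'a
      show "integrable lborel (\<lambda>t. std_normal_density t * (if c = b then t\<^sup>2 else 1))"
        using integrable.intros[OF std_normal_moment_even[of 1]] by (cases "c = b") simp_all
    qed
    moreover have "(\<Prod>c\<in>Basis. std_normal_density (x \<bullet> c) * (if c = b then (x \<bullet> c)\<^sup>2 else 1)) = gauss_density x * (x \<bullet> b)\<^sup>2" for x :: 'a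
      using that by (simp add: prod.distrib gauss_density_def prod.delta)
    ultimately show ?thesis
      unfolding gauss_def by (subst integrable_density) (auto )
  qed
  have "(norm x)\<^sup>2 = (\<Sum>b\<in>Basis. (x \<bullet> b)\<^sup>2)" for x :: 'a
    unfolding norm_eq_sqrt_inner power2_eq_square euclidean_inner[of x x]
    by (simp add: sum_nonneg)
  then show ?thesis using * by simp
qed

lemma gauss_integrable_inner: "integrable gauss (\<lambda>x. v \<bullet> x)"
proof (rule Bochner_Integration.integrable_bound)
  show "integrable gauss (\<lambda>x. norm v * (1 + (norm x)\<^sup>2))"
    using gauss_integrable_norm_sq by auto
  have "\<bar>v \<bullet> x\<bar> \<le> norm v * (1 + (norm x)\<^sup>2)" for x
  proof -
    have "norm x \<le> 1 + (norm x)\<^sup>2"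
      using sum_squares_bound[of 1 "norm x"] by (simp add: power2_eq_square)
        (smt (verit) norm_ge_zero)
    then have "norm v * norm x \<le> norm v * (1 + (norm x)\<^sup>2)" by (intro mult_left_mono) auto
    then show ?thesis using Cauchy_Schwarz_ineq2[of v x] by linarith
  qed
  then show "AE x in gauss. norm (v \<bullet> x) \<le> norm (norm v * (1 + (norm x)\<^sup>2))" 
    by (intro AE_I2) (smt (verit, best) real_norm_def)
qed auto

lemma gauss_integral_inner: "(\<integral>x. v \<bullet> x \<partial>gauss) = 0"
proof -
  have g: "gauss_density (- x) = gauss_density x" for x :: 'a
    by (subst (1 2) gauss_density_exp) simp
  have "(\<integral>x. v \<bullet> x \<partial>gauss) = (\<integral>x. gauss_density x * (v \<bullet> x) \<partial>lborel)"
    unfolding gauss_def by (subst integral_density) auto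
  also have "\<dots> = - (\<integral>x. gauss_density x * (v \<bullet> x) \<partial>lborel)"
    by (subst lborel_integral_euclidean_affine[of _ "-1" 0]) (auto simp: g)
  also have "(\<integral>x. gauss_density x * (v \<bullet> x) \<partial>lborel) = (\<integral>x. v \<bullet> x \<partial>gauss)"
    unfolding gauss_def by (subst integral_density) auto
  finally show ?thesis by simp
qed

section \<open>Uniform weak convergence\<close>

definition mollify :: "real \<Rightarrow> ('a::euclidean_space \<Rightarrow> real) \<Rightarrow> 'a \<Rightarrow> real" where
  "mollify \<epsilon> f z = (\<integral>b. f (z + \<epsilon> *\<^sub>R b) \<partial>gauss)"

text \<open>For measures with vanishing sine integrals this is the full characteristic function;
  using it keeps all integrals real.\<close>

definition cos_transform :: "'a::euclidean_space measure \<Rightarrow> 'a \<Rightarrow> real" where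
  "cos_transform \<mu> \<xi> = (\<integral>z. cos (\<xi> \<bullet> z) \<partial>\<mu>)"

lemma mollify_measurable [measurable]:
  assumes [measurable]: "f \<in> borel_measurable borel"
  shows "mollify \<epsilon> f \<in> borel_measurable borel"
  unfolding mollify_def[abs_def] by measurable

lemma mollify_bounded:
  assumes [measurable]: "f \<in> borel_measurable borel" and "\<And>z. \<bar>f z\<bar> \<le> K"
  shows "\<bar>mollify \<epsilon> f z\<bar> \<le> K"
proof -
  have "integrable gauss (\<lambda>b. f (z + \<epsilon> *\<^sub>R b))"
    by (rule gauss.integrable_const_bound[of _ K]) (auto simp: assms)
  then have "norm (\<integral>b. f (z + \<epsilon> *\<^sub>R b) \<partial>gauss) \<le> (\<integral>b. K \<partial>(gauss :: 'a measure))"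
    by (intro Bochner_Integration.integral_norm_bound[THEN order_trans] integral_mono) (auto simp: assms)
  then show ?thesis by (simp add: mollify_def)
qed

text \<open>Up to scaling, the Gaussian density is its own characteristic function, so the smoothing
  kernel is itself an average of cosines. This plays the role of Fourier inversion.\<close>

lemma mollify_eq:
  fixes f :: "'a::euclidean_space \<Rightarrow> real"
  assumes [measurable]: "f \<in> borel_measurable borel" and \<epsilon>: "0 < \<epsilon>"
  shows "mollify \<epsilon> f z = gauss_density (0::'a) / \<epsilon> ^ DIM('a) *
    (\<integral>a. f a * (\<integral>x. cos (((1 / \<epsilon>) *\<^sub>R (a - z)) \<bullet> x) \<partial>gauss) \<partial>lborel)"
proof -
  have 1: "mollify \<epsilon> f z = (\<integral>b. gauss_density b * f (z + \<epsilon> *\<^sub>R b) \<partial>lborel)"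
    unfolding mollify_def gauss_def by (subst integral_density) auto
  have 2: "(\<integral>a. gauss_density ((1 / \<epsilon>) *\<^sub>R (a - z)) * f a \<partial>lborel)
      = \<epsilon> ^ DIM('a) * (\<integral>b. gauss_density b * f (z + \<epsilon> *\<^sub>R b) \<partial>lborel)"
    using \<epsilon> by (subst lborel_integral_euclidean_affine[of _ \<epsilon> z]) auto
  have "gauss_density u = gauss_density (0::'a) * (\<integral>x. cos (u \<bullet> x) \<partial>gauss)" for u :: 'a
    by (subst gauss_density_exp) (simp add: gauss_cos)
  note g = this
  have "(\<integral>a. gauss_density ((1 / \<epsilon>) *\<^sub>R (a - z)) * f a \<partial>lborel)
     = (\<integral>a. gauss_density (0::'a) * (f a * (\<integral>x. cos (((1 / \<epsilon>) *\<^sub>R (a - z)) \<bullet> x) \<partial>gauss)) \<partial>lborel)"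
    by (subst g) (simp add: mult_ac)
  then have "\<epsilon> ^ DIM('a) * mollify \<epsilon> f z
     = gauss_density (0::'a) * (\<integral>a. f a * (\<integral>x. cos (((1 / \<epsilon>) *\<^sub>R (a - z)) \<bullet> x) \<partial>gauss) \<partial>lborel)"
    by (simp only: 1 2 integral_mult_right_zero)
  moreover have "m = g / p * I" if "p * m = g * I" "0 < p" for m g p I :: real
    using that by (simp add: field_simps)
  ultimately show ?thesis using \<epsilon> by simp
qed

text \<open>After \<open>mollify_eq\<close>, Fubini moves the integral over \<mu> inside, and the
  addition theorem leaves only \<open>cos_transform\<close> because the sine part vanishes by
  \<open>odd\<close>. The integral of a mollified function therefore sees \<mu> only through its
  cosine transform.\<close>

lemma integral_mollify:
  fixes f :: "'a::euclidean_space \<Rightarrow> real"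
  assumes "finite_measure \<mu>" and sets[measurable_cong]: "sets \<mu> = sets borel"
    and odd: "\<And>\<xi>. (\<integral>z. sin (\<xi> \<bullet> z) \<partial>\<mu>) = 0"
    and f: "integrable lborel f" and \<epsilon>: "0 < \<epsilon>"
  shows "(\<integral>z. mollify \<epsilon> f z \<partial>\<mu>) = gauss_density (0::'a) / \<epsilon> ^ DIM('a) *
    (\<integral>a. f a * (\<integral>x. cos (((1 / \<epsilon>) *\<^sub>R a) \<bullet> x) * cos_transform \<mu> ((1 / \<epsilon>) *\<^sub>R x) \<partial>gauss) \<partial>lborel)"
proof -
  interpret \<mu>: finite_measure \<mu> by fact
  interpret L: pair_sigma_finite \<mu> "lborel :: 'a measure" ..
  interpret G: pair_sigma_finite \<mu> "gauss :: 'a measure" ..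
  have [measurable]: "f \<in> borel_measurable borel"
    using f by (simp add: borel_measurable_integrable)
  let ?q = "\<lambda>a z. \<integral>x. cos (((1 / \<epsilon>) *\<^sub>R (a - z)) \<bullet> x) \<partial>gauss"
  have qb: "\<bar>?q a z\<bar> \<le> 1" for a z :: 'a
    by (simp only: gauss_cos) simp
  have q: "(\<integral>z. ?q a z \<partial>\<mu>) = (\<integral>x. cos (((1 / \<epsilon>) *\<^sub>R a) \<bullet> x) * cos_transform \<mu> ((1 / \<epsilon>) *\<^sub>R x) \<partial>gauss)" for a
  proof -
    have "integrable (\<mu> \<Otimes>\<^sub>M gauss) (\<lambda>(z, x). cos (((1 / \<epsilon>) *\<^sub>R (a - z)) \<bullet> x))"
    proof -
      interpret GG: finite_measure "\<mu> \<Otimes>\<^sub>M (gauss :: 'a measure)"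
        by (rule finite_measure_pair_measure) (unfold_locales)
      show ?thesis by (rule GG.integrable_const_bound[of _ 1]) auto
    qed
    then have "(\<integral>z. ?q a z \<partial>\<mu>) = (\<integral>x. (\<integral>z. cos (((1 / \<epsilon>) *\<^sub>R (a - z)) \<bullet> x) \<partial>\<mu>) \<partial>gauss)"
      by (rule G.Fubini_integral[symmetric])
    also have "\<dots> = (\<integral>x. cos (((1 / \<epsilon>) *\<^sub>R a) \<bullet> x) * cos_transform \<mu> ((1 / \<epsilon>) *\<^sub>R x) \<partial>gauss)"
    proof (intro Bochner_Integration.integral_cong refl)
      fix x :: 'a
      have i: "integrable \<mu> (\<lambda>z. cos (((1 / \<epsilon>) *\<^sub>R x) \<bullet> z))" "integrable \<mu> (\<lambda>z. sin (((1 / \<epsilon>) *\<^sub>R x) \<bullet> z))"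
        by (rule \<mu>.integrable_const_bound[of _ 1]; auto)+
      have "cos (((1 / \<epsilon>) *\<^sub>R (a - z)) \<bullet> x) = cos (((1 / \<epsilon>) *\<^sub>R a) \<bullet> x) * cos (((1 / \<epsilon>) *\<^sub>R x) \<bullet> z)
         + sin (((1 / \<epsilon>) *\<^sub>R a) \<bullet> x) * sin (((1 / \<epsilon>) *\<^sub>R x) \<bullet> z)" for z
        by (simp only: cos_diff[symmetric]) (simp add: algebra_simps inner_commute)
      then show "(\<integral>z. cos (((1 / \<epsilon>) *\<^sub>R (a - z)) \<bullet> x) \<partial>\<mu>)
          = cos (((1 / \<epsilon>) *\<^sub>R a) \<bullet> x) * cos_transform \<mu> ((1 / \<epsilon>) *\<^sub>R x)"
        using i odd[of "(1 / \<epsilon>) *\<^sub>R x"] unfolding cos_transform_def by simp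
    qed
    finally show ?thesis .
  qed
  have "integrable (\<mu> \<Otimes>\<^sub>M lborel) (\<lambda>(z, a). f a * ?q a z)"
  proof (rule Bochner_Integration.integrable_bound)
    show "integrable (\<mu> \<Otimes>\<^sub>M lborel) (\<lambda>(z, a). f a)"
      using f by (intro L.Fubini_integrable) (auto simp: integrable_mult_left)
    show "AE p in \<mu> \<Otimes>\<^sub>M lborel. norm (case p of (z, a) \<Rightarrow> f a * ?q a z) \<le> norm (case p of (z, a) \<Rightarrow> f a)"
      using qb by (intro AE_I2) (auto simp: abs_mult mult_left_le)
  qed measurable
  then have F: "(\<integral>a. (\<integral>z. f a * ?q a z \<partial>\<mu>) \<partial>lborel) = (\<integral>z. (\<integral>a. f a * ?q a z \<partial>lborel) \<partial>\<mu>)"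
    by (rule L.Fubini_integral)
  have "(\<integral>z. mollify \<epsilon> f z \<partial>\<mu>) = gauss_density (0::'a) / \<epsilon> ^ DIM('a) * (\<integral>z. (\<integral>a. f a * ?q a z \<partial>lborel) \<partial>\<mu>)"
    using \<epsilon> by (subst mollify_eq) auto
  also have "(\<integral>z. (\<integral>a. f a * ?q a z \<partial>lborel) \<partial>\<mu>) = (\<integral>a. f a * (\<integral>z. ?q a z \<partial>\<mu>) \<partial>lborel)"
    unfolding F[symmetric] by simp
  finally show ?thesis unfolding q .
qed

text \<open>Where the Gaussian displacement is shorter than \<open>d\<close>, the modulus of
  continuity gives \<open>e\<close>. Elsewhere the bound \<open>2 * K\<close> is multiplied by a
  quantity that is at least 1, as in Chebyshev's inequality, and the second moment appears.\<close>

lemma mollify_approx: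
  fixes f :: "'a::euclidean_space \<Rightarrow> real"
  assumes [measurable]: "f \<in> borel_measurable borel" and K: "\<And>z. \<bar>f z\<bar> \<le> K"
    and d: "0 < d" "\<And>z z'. norm (z - z') < d \<Longrightarrow> \<bar>f z - f z'\<bar> \<le> e" and e: "0 \<le> e"
  shows "\<bar>mollify \<epsilon> f z - f z\<bar> \<le> e + 2 * K * \<epsilon>\<^sup>2 / d\<^sup>2 * (\<integral>b. (norm b)\<^sup>2 \<partial>(gauss :: 'a measure))"
proof -
  have i: "integrable gauss (\<lambda>b. f (z + \<epsilon> *\<^sub>R b))"
    by (rule gauss.integrable_const_bound[of _ K]) (auto simp: K)
  have i2: "integrable gauss (\<lambda>b::'a. e + 2 * K * \<epsilon>\<^sup>2 / d\<^sup>2 * (norm b)\<^sup>2)"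
    using gauss_integrable_norm_sq by (intro Bochner_Integration.integrable_add integrable_mult_right) auto
  have K0: "0 \<le> K" using K[of 0] by linarith
  have "mollify \<epsilon> f z - f z = (\<integral>b. f (z + \<epsilon> *\<^sub>R b) - f z \<partial>gauss)"
    unfolding mollify_def using i by simp
  also have "\<bar>\<dots>\<bar> \<le> (\<integral>b. \<bar>f (z + \<epsilon> *\<^sub>R b) - f z\<bar> \<partial>gauss)"
    by (rule integral_abs_bound)
  also have "\<dots> \<le> (\<integral>b. e + 2 * K * \<epsilon>\<^sup>2 / d\<^sup>2 * (norm b)\<^sup>2 \<partial>(gauss :: 'a measure))"
  proof (rule integral_mono[OF _ i2])
    show "integrable gauss (\<lambda>b. \<bar>f (z + \<epsilon> *\<^sub>R b) - f z\<bar>)"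
      by (intro integrable_abs Bochner_Integration.integrable_diff i) simp
    fix b :: 'a
    show "\<bar>f (z + \<epsilon> *\<^sub>R b) - f z\<bar> \<le> e + 2 * K * \<epsilon>\<^sup>2 / d\<^sup>2 * (norm b)\<^sup>2"
    proof (cases "norm (\<epsilon> *\<^sub>R b) < d")
      case True
      then have "\<bar>f (z + \<epsilon> *\<^sub>R b) - f z\<bar> \<le> e" by (intro d(2)) simp
      moreover have "0 \<le> 2 * K * \<epsilon>\<^sup>2 / d\<^sup>2 * (norm b)\<^sup>2" using K0 by simp
      ultimately show ?thesis by linarith
    next
      case False
      then have "d\<^sup>2 \<le> (norm (\<epsilon> *\<^sub>R b))\<^sup>2" using d(1) by (intro power_mono) auto
      then have "1 \<le> \<epsilon>\<^sup>2 / d\<^sup>2 * (norm b)\<^sup>2" using d(1) by (simp add: power_mult_distrib field_simps)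
      then have "2 * K * 1 \<le> 2 * K * (\<epsilon>\<^sup>2 / d\<^sup>2 * (norm b)\<^sup>2)" using K0 by (intro mult_left_mono) auto
      moreover have "\<bar>f (z + \<epsilon> *\<^sub>R b) - f z\<bar> \<le> 2 * K" using K[of "z + \<epsilon> *\<^sub>R b"] K[of z] by linarith
      ultimately show ?thesis using e by (simp add: mult.assoc)
    qed
  qed
  also have "\<dots> = e + 2 * K * \<epsilon>\<^sup>2 / d\<^sup>2 * (\<integral>b. (norm b)\<^sup>2 \<partial>(gauss :: 'a measure))"
    by (subst Bochner_Integration.integral_add)
      (simp_all only: integrable_mult_right[OF gauss_integrable_norm_sq] integral_mult_right_zero gauss_const gauss_integrable_const)
  finally show ?thesis .
qed

text \<open>A version of the Levy continuity theorem that is uniform over an equicontinuous family of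
  test functions. The constant \<open>\<beta>\<close> allows the limit to have an additional atom at 0.\<close>

lemma uniform_weak_limit:
  fixes \<mu> :: "nat \<Rightarrow> 'a::euclidean_space measure" and f :: "'i \<Rightarrow> 'a \<Rightarrow> real"
  assumes \<mu>: "\<And>n. finite_measure (\<mu> n)" "\<And>n. sets (\<mu> n) = sets borel" "\<And>n \<xi>. (\<integral>z. sin (\<xi> \<bullet> z) \<partial>\<mu> n) = 0"
    and B: "\<And>n. measure (\<mu> n) UNIV \<le> B"
    and m: "finite_measure m" "sets m = sets borel" "\<And>\<xi>. (\<integral>z. sin (\<xi> \<bullet> z) \<partial>m) = 0"
    and lim: "\<And>\<xi>. (\<lambda>n. cos_transform (\<mu> n) \<xi>) \<longlonglongrightarrow> cos_transform m \<xi> + \<beta>"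
    and f: "\<And>y. y \<in> Y \<Longrightarrow> integrable lborel (f y)"
    and L: "\<And>y. y \<in> Y \<Longrightarrow> (\<integral>a. \<bar>f y a\<bar> \<partial>lborel) \<le> L"
    and K: "\<And>y z. y \<in> Y \<Longrightarrow> \<bar>f y z\<bar> \<le> K"
    and equi: "\<And>e. 0 < e \<Longrightarrow> \<exists>d>0. \<forall>y\<in>Y. \<forall>z z'. norm (z - z') < d \<longrightarrow> \<bar>f y z - f y z'\<bar> \<le> e"
    and e: "0 < e"
  shows "\<forall>\<^sub>F n in sequentially. \<forall>y\<in>Y. \<bar>(\<integral>z. f y z \<partial>\<mu> n) - (\<integral>z. f y z \<partial>m) - \<beta> * f y 0\<bar> \<le> e"
proof (cases "Y = {}")
  case False
  note [measurable_cong] = \<mu>(2) m(2)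
  have fm[measurable]: "f y \<in> borel_measurable borel" if "y \<in> Y" for y
    using f[OF that] by (simp add: borel_measurable_integrable)
  have sp: "space (\<mu> n) = UNIV" "space m = UNIV" for n
    using sets_eq_imp_space_eq[OF \<mu>(2)] sets_eq_imp_space_eq[OF m(2)] by auto
  obtain y0 where y0: "y0 \<in> Y" using False by blast
  have K0: "0 \<le> K" using K[OF y0, of 0] by linarith
  have L0: "0 \<le> L" by (rule order_trans[OF _ L[OF y0]]) simp
  have B0: "0 \<le> B" by (rule order_trans[OF _ B[of 0]]) simp
  \<comment> \<open>\<open>N\<close> dominates the discrepancy \<open>D\<close> below as well as the
    sum of the masses against which the mollification error is integrated; \<open>e'\<close> is
    chosen so that this error totals at most \<open>e / 2\<close>.\<close>
  define N where "N = B + measure m UNIV + \<bar>\<beta>\<bar> + 1"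
  have N: "N > 0" unfolding N_def using B0 by (simp add: add_nonneg_pos)
  define e' where "e' = e / (4 * N)"
  have e': "0 < e'" using e N by (simp add: e'_def)
  obtain d where d: "0 < d" "\<And>y z z'. y \<in> Y \<Longrightarrow> norm (z - z') < d \<Longrightarrow> \<bar>f y z - f y z'\<bar> \<le> e'"
    using equi[OF e'] by blast
  let ?m2 = "\<integral>b. (norm b)\<^sup>2 \<partial>(gauss :: 'a measure)"
  have m2: "0 \<le> ?m2" by simp
  obtain \<epsilon> where \<epsilon>: "0 < \<epsilon>" "2 * K * \<epsilon>\<^sup>2 / d\<^sup>2 * ?m2 \<le> e'"
  proof
    define \<epsilon> where "\<epsilon> = sqrt (e' * d\<^sup>2 / (2 * K * ?m2 + 1))"
    have pos: "0 < 2 * K * ?m2 + 1" using K0 m2 by (simp add: add_nonneg_pos)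
    show "0 < \<epsilon>" unfolding \<epsilon>_def using pos e' d(1) by simp
    have "\<epsilon>\<^sup>2 = e' * d\<^sup>2 / (2 * K * ?m2 + 1)" unfolding \<epsilon>_def using pos e' d(1) by simp
    then have "2 * K * \<epsilon>\<^sup>2 / d\<^sup>2 * ?m2 = e' * ((2 * K * ?m2) / (2 * K * ?m2 + 1))"
      using d(1) by (simp only: times_divide_eq_right times_divide_eq_left divide_divide_eq_left) simp
    also have "\<dots> \<le> e' * 1" using pos e' by (intro mult_left_mono) auto
    finally show "2 * K * \<epsilon>\<^sup>2 / d\<^sup>2 * ?m2 \<le> e'" by simp
  qed
  have approx: "\<bar>mollify \<epsilon> (f y) z - f y z\<bar> \<le> 2 * e'" if "y \<in> Y" for y z
  proof -
    have "\<bar>mollify \<epsilon> (f y) z - f y z\<bar> \<le> e' + 2 * K * \<epsilon>\<^sup>2 / d\<^sup>2 * ?m2"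
      using that d e' K by (intro mollify_approx) auto
    then show ?thesis using \<epsilon> by linarith
  qed
  have approx_int: "\<bar>(\<integral>z. mollify \<epsilon> (f y) z \<partial>q) - (\<integral>z. f y z \<partial>q)\<bar> \<le> 2 * e' * measure q UNIV"
    if y: "y \<in> Y" and q: "finite_measure q" "sets q = sets borel" for y q
  proof -
    interpret finite_measure q by fact
    note [measurable_cong] = q(2)
    have spq: "space q = UNIV" using sets_eq_imp_space_eq[OF q(2)] by simp
    note [measurable] = fm[OF y]
    have i1: "integrable q (mollify \<epsilon> (f y))"
      by (rule integrable_const_bound[of _ K]) (auto intro!: mollify_bounded K y)
    have i2: "integrable q (f y)"
      by (rule integrable_const_bound[of _ K]) (auto intro!: K y)
    have "\<bar>(\<integral>z. mollify \<epsilon> (f y) z \<partial>q) - (\<integral>z. f y z \<partial>q)\<bar> = \<bar>\<integral>z. mollify \<epsilon> (f y) z - f y z \<partial>q\<bar>"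
      using i1 i2 by simp
    also have "\<dots> \<le> (\<integral>z. \<bar>mollify \<epsilon> (f y) z - f y z\<bar> \<partial>q)" by (rule integral_abs_bound)
    also have "\<dots> \<le> (\<integral>z. 2 * e' \<partial>q)" using i1 i2 approx[OF y] by (intro integral_mono) auto
    also have "\<dots> = 2 * e' * measure q UNIV" by (simp add: spq)
    finally show ?thesis .
  qed
  define c where "c = gauss_density (0::'a) / \<epsilon> ^ DIM('a)"
  have c: "0 \<le> c" using \<epsilon> by (simp add: c_def)
  \<comment> \<open>This discrepancy does not involve \<open>y\<close>. The Gaussian mean of its
    modulus tends to 0 by dominated convergence, and \<open>key\<close> multiplies it by the common
    bound \<open>L\<close>: uniformity over \<open>Y\<close> comes from here.\<close>
  define D where "D n x = cos_transform (\<mu> n) ((1 / \<epsilon>) *\<^sub>R x) - cos_transform m ((1 / \<epsilon>) *\<^sub>R x) - \<beta>" for n x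
  have ctm[measurable]: "cos_transform q \<in> borel_measurable borel" if "finite_measure q" "sets q = sets borel" for q :: "'a measure"
  proof -
    interpret finite_measure q by fact
    note [measurable_cong] = that(2)
    show ?thesis unfolding cos_transform_def[abs_def] by measurable
  qed
  note [measurable] = ctm[OF \<mu>(1,2)] ctm[OF m(1,2)]
  have Dm[measurable]: "D n \<in> borel_measurable borel" for n
    unfolding D_def[abs_def] by measurable
  have ctb: "\<bar>cos_transform q \<xi>\<bar> \<le> measure q UNIV" if q: "finite_measure q" "sets q = sets borel" for q and \<xi> :: 'a
  proof -
    interpret finite_measure q by fact
    note [measurable_cong] = q(2)
    have spq: "space q = UNIV" using sets_eq_imp_space_eq[OF q(2)] by simp
    have i: "integrable q (\<lambda>z. cos (\<xi> \<bullet> z))" by (rule integrable_const_bound[of _ 1]) auto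
    have "\<bar>cos_transform q \<xi>\<bar> \<le> (\<integral>z. \<bar>cos (\<xi> \<bullet> z)\<bar> \<partial>q)"
      unfolding cos_transform_def by (rule integral_abs_bound)
    also have "\<dots> \<le> (\<integral>z. 1 \<partial>q)" using i by (intro integral_mono) auto
    finally show ?thesis by (simp add: spq)
  qed
  have Db: "\<bar>D n x\<bar> \<le> N" for n x
    using ctb[OF \<mu>(1,2), of n "(1 / \<epsilon>) *\<^sub>R x"] ctb[OF m(1,2), of "(1 / \<epsilon>) *\<^sub>R x"] B[of n]
    unfolding D_def N_def by linarith
  have key: "\<bar>(\<integral>z. mollify \<epsilon> (f y) z \<partial>\<mu> n) - (\<integral>z. mollify \<epsilon> (f y) z \<partial>m) - \<beta> * mollify \<epsilon> (f y) 0\<bar>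
      \<le> c * (L * (\<integral>x. \<bar>D n x\<bar> \<partial>gauss))" if y: "y \<in> Y" for y n
  proof -
    note [measurable] = fm[OF y]
    let ?I = "\<lambda>C a. \<integral>x. cos (((1 / \<epsilon>) *\<^sub>R a) \<bullet> x) * C x \<partial>gauss"
    have cb: "\<bar>cos t * C x\<bar> \<le> R" if "\<And>x. \<bar>C x\<bar> \<le> R" for t x R and C :: "'a \<Rightarrow> real"
      using mult_mono[of "\<bar>cos t\<bar>" 1 "\<bar>C x\<bar>" R] that[of x] by (simp add: abs_mult)
    have gint: "integrable gauss (\<lambda>x. cos (((1 / \<epsilon>) *\<^sub>R a) \<bullet> x) * C x)"
      if [measurable]: "C \<in> borel_measurable borel" and C: "\<And>x. \<bar>C x\<bar> \<le> R" for C R a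
    proof (rule gauss.integrable_const_bound)
      show "AE x in gauss. norm (cos (((1 / \<epsilon>) *\<^sub>R a) \<bullet> x) * C x) \<le> R"
        unfolding real_norm_def by (rule AE_I2, rule cb[OF C])
    qed measurable
    have int: "integrable lborel (\<lambda>a. f y a * ?I C a)" if [measurable]: "C \<in> borel_measurable borel" and C: "\<And>x. \<bar>C x\<bar> \<le> R" for C R
    proof (rule Bochner_Integration.integrable_bound)
      show "integrable lborel (\<lambda>a. R * f y a)" using f[OF y] by simp
      have "\<bar>?I C a\<bar> \<le> R" for a
      proof -
        have "\<bar>?I C a\<bar> \<le> (\<integral>x. \<bar>cos (((1 / \<epsilon>) *\<^sub>R a) \<bullet> x) * C x\<bar> \<partial>gauss)" by (rule integral_abs_bound)
        also have "\<dots> \<le> (\<integral>x. R \<partial>(gauss :: 'a measure))"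
          by (intro integral_mono integrable_abs gint[OF that] gauss_integrable_const cb[OF C])
        finally show ?thesis by simp
      qed
      then have "\<bar>?I C a\<bar> \<le> \<bar>R\<bar>" for a by (rule order_trans) simp
      then have "\<bar>f y a * ?I C a\<bar> \<le> \<bar>R * f y a\<bar>" for a
        unfolding abs_mult mult.commute[of "\<bar>R\<bar>"] by (rule mult_left_mono) simp
      then show "AE a in lborel. norm (f y a * ?I C a) \<le> norm (R * f y a)" by simp
    qed measurable
    let ?C1 = "\<lambda>x. cos_transform (\<mu> n) ((1 / \<epsilon>) *\<^sub>R x)" and ?C2 = "\<lambda>x. cos_transform m ((1 / \<epsilon>) *\<^sub>R x)"
    note b1 = ctb[OF \<mu>(1,2)] and b2 = ctb[OF m(1,2)]
    have J1: "(\<integral>z. mollify \<epsilon> (f y) z \<partial>\<mu> n) = c * (\<integral>a. f y a * ?I ?C1 a \<partial>lborel)"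
      unfolding c_def by (rule integral_mollify[OF \<mu> f[OF y] \<epsilon>(1)])
    have J2: "(\<integral>z. mollify \<epsilon> (f y) z \<partial>m) = c * (\<integral>a. f y a * ?I ?C2 a \<partial>lborel)"
      unfolding c_def by (rule integral_mollify[OF m f[OF y] \<epsilon>(1)])
    \<comment> \<open>The constant function 1 is the cosine transform of the unit mass at 0; it
      accounts for the term with \<beta>.\<close>
    have J3: "mollify \<epsilon> (f y) 0 = c * (\<integral>a. f y a * ?I (\<lambda>_. 1) a \<partial>lborel)"
      unfolding c_def using \<epsilon> by (subst mollify_eq) auto
    have split: "?I (D n) a = ?I ?C1 a - ?I ?C2 a - \<beta> * ?I (\<lambda>_. 1) a" for a
    proof -
      have "(\<lambda>x. cos (((1 / \<epsilon>) *\<^sub>R a) \<bullet> x) * D n x) = (\<lambda>x. cos (((1 / \<epsilon>) *\<^sub>R a) \<bullet> x) * ?C1 x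
          - cos (((1 / \<epsilon>) *\<^sub>R a) \<bullet> x) * ?C2 x - \<beta> * (cos (((1 / \<epsilon>) *\<^sub>R a) \<bullet> x) * 1))"
        unfolding D_def by (simp add: algebra_simps)
      then show ?thesis
        using gint[of ?C1 "measure (\<mu> n) UNIV" a, OF _ b1] gint[of ?C2 "measure m UNIV" a, OF _ b2] gint[of "\<lambda>_. 1" 1 a]
        by simp
    qed
    have "(\<integral>z. mollify \<epsilon> (f y) z \<partial>\<mu> n) - (\<integral>z. mollify \<epsilon> (f y) z \<partial>m) - \<beta> * mollify \<epsilon> (f y) 0
        = c * ((\<integral>a. f y a * ?I ?C1 a \<partial>lborel) - (\<integral>a. f y a * ?I ?C2 a \<partial>lborel) - (\<integral>a. \<beta> * (f y a * ?I (\<lambda>_. 1) a) \<partial>lborel))"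
      unfolding J1 J2 J3 by (simp add: algebra_simps)
    also have "\<dots> = c * (\<integral>a. f y a * ?I ?C1 a - f y a * ?I ?C2 a - \<beta> * (f y a * ?I (\<lambda>_. 1) a) \<partial>lborel)"
      using int[of ?C1 "measure (\<mu> n) UNIV", OF _ b1] int[of ?C2 "measure m UNIV", OF _ b2] int[of "\<lambda>_. 1" 1] by simp
    also have "(\<lambda>a. f y a * ?I ?C1 a - f y a * ?I ?C2 a - \<beta> * (f y a * ?I (\<lambda>_. 1) a)) = (\<lambda>a. f y a * ?I (D n) a)"
      unfolding split by (simp add: algebra_simps)
    finally have eq: "(\<integral>z. mollify \<epsilon> (f y) z \<partial>\<mu> n) - (\<integral>z. mollify \<epsilon> (f y) z \<partial>m) - \<beta> * mollify \<epsilon> (f y) 0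
        = c * (\<integral>a. f y a * ?I (D n) a \<partial>lborel)" .
    have "\<bar>\<integral>a. f y a * ?I (D n) a \<partial>lborel\<bar> \<le> (\<integral>a. \<bar>f y a * ?I (D n) a\<bar> \<partial>lborel)" by (rule integral_abs_bound)
    also have "\<dots> \<le> (\<integral>a. \<bar>f y a\<bar> * (\<integral>x. \<bar>D n x\<bar> \<partial>gauss) \<partial>lborel)"
    proof (rule integral_mono)
      fix a
      have "\<bar>?I (D n) a\<bar> \<le> (\<integral>x. \<bar>cos (((1 / \<epsilon>) *\<^sub>R a) \<bullet> x) * D n x\<bar> \<partial>gauss)" by (rule integral_abs_bound)
      also have "\<dots> \<le> (\<integral>x. \<bar>D n x\<bar> \<partial>gauss)"
      proof (intro integral_mono)
        show "integrable gauss (\<lambda>x. \<bar>D n x\<bar>)" by (rule gauss.integrable_const_bound[of _ N]) (auto simp: Db)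
        show "\<bar>cos (((1 / \<epsilon>) *\<^sub>R a) \<bullet> x) * D n x\<bar> \<le> \<bar>D n x\<bar>" for x by (simp add: abs_mult mult_left_le_one_le)
      qed (use gint[OF Dm Db] in auto)
      finally show "\<bar>f y a * ?I (D n) a\<bar> \<le> \<bar>f y a\<bar> * (\<integral>x. \<bar>D n x\<bar> \<partial>gauss)"
        by (simp add: abs_mult mult_left_mono)
    qed (use int[OF Dm Db] f[OF y] in auto)
    also have "\<dots> = (\<integral>a. \<bar>f y a\<bar> \<partial>lborel) * (\<integral>x. \<bar>D n x\<bar> \<partial>gauss)" by simp
    also have "\<dots> \<le> L * (\<integral>x. \<bar>D n x\<bar> \<partial>gauss)" using L[OF y] by (intro mult_right_mono) auto
    finally show ?thesis unfolding eq using c by (simp add: abs_mult mult_left_mono)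
  qed
  have "(\<lambda>n. \<integral>x. \<bar>D n x\<bar> \<partial>gauss) \<longlonglongrightarrow> (\<integral>x. 0 \<partial>(gauss :: 'a measure))"
  proof (rule integral_dominated_convergence)
    show "AE x in gauss. (\<lambda>n. \<bar>D n x\<bar>) \<longlonglongrightarrow> 0"
    proof (intro AE_I2 tendsto_rabs_zero)
      fix x
      have "(\<lambda>n. D n x) \<longlonglongrightarrow> cos_transform m ((1 / \<epsilon>) *\<^sub>R x) + \<beta> - cos_transform m ((1 / \<epsilon>) *\<^sub>R x) - \<beta>"
        unfolding D_def by (intro tendsto_intros lim)
      then show "(\<lambda>n. D n x) \<longlonglongrightarrow> 0" by simp
    qed
    show "integrable (gauss :: 'a measure) (\<lambda>x. N)" by simp
  qed (auto simp: Db)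
  then have "(\<lambda>n. c * (L * (\<integral>x. \<bar>D n x\<bar> \<partial>gauss))) \<longlonglongrightarrow> c * (L * 0)"
    by (intro tendsto_intros) simp
  then have "\<forall>\<^sub>F n in sequentially. c * (L * (\<integral>x. \<bar>D n x\<bar> \<partial>gauss)) < e / 2"
    using e by (intro order_tendstoD(2)) auto
  then show ?thesis
  proof (eventually_elim, intro ballI)
    fix n y assume n: "c * (L * (\<integral>x. \<bar>D n x\<bar> \<partial>gauss)) < e / 2" and y: "y \<in> Y"
    have "\<bar>\<beta> * mollify \<epsilon> (f y) 0 - \<beta> * f y 0\<bar> \<le> 2 * e' * \<bar>\<beta>\<bar>"
      using mult_left_mono[OF approx[OF y, of 0], of "\<bar>\<beta>\<bar>"]
      by (simp add: abs_mult[symmetric] right_diff_distrib mult.commute)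
    moreover have "2 * e' * measure (\<mu> n) UNIV \<le> 2 * e' * B" using B[of n] e' by (intro mult_left_mono) auto
    ultimately have "\<bar>(\<integral>z. f y z \<partial>\<mu> n) - (\<integral>z. f y z \<partial>m) - \<beta> * f y 0\<bar>
       \<le> e / 2 + 2 * e' * B + 2 * e' * measure m UNIV + 2 * e' * \<bar>\<beta>\<bar>"
      using key[OF y, of n] n approx_int[OF y \<mu>(1,2), of n] approx_int[OF y m(1,2)] by linarith
    also have "\<dots> \<le> e / 2 + 2 * e' * N"
      unfolding N_def using e' by (simp add: algebra_simps)
    also have "2 * e' * N = e / 2" unfolding e'_def using N by simp
    finally show "\<bar>(\<integral>z. f y z \<partial>\<mu> n) - (\<integral>z. f y z \<partial>m) - \<beta> * f y 0\<bar> \<le> e" by simp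
  qed
qed simp

section \<open>The characteristic exponent and small times\<close>

text \<open>One minus the characteristic function of the standard Gaussian at \<open>z\<close>:
  quadratic at 0 and bounded, hence integrable against a Levy measure, and compatible with cosines
  by \<open>cos_mult_gauss_weight\<close>.\<close>

definition gauss_weight :: "'a::euclidean_space \<Rightarrow> real" where
  "gauss_weight z = 1 - exp (- (norm z)\<^sup>2 / 2)"

lemma gauss_weight_measurable [measurable]: "gauss_weight \<in> borel_measurable borel"
  unfolding gauss_weight_def[abs_def] by measurable

lemma gauss_weight_nonneg [simp]: "0 \<le> gauss_weight z"
  and gauss_weight_le_1: "gauss_weight z \<le> 1"
  by (simp_all add: gauss_weight_def)

lemma gauss_weight_le_min: "gauss_weight z \<le> min 1 ((norm z)\<^sup>2)"
proof -
  have "1 - (norm z)\<^sup>2 / 2 \<le> exp (- (norm z)\<^sup>2 / 2)"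
    using exp_ge_add_one_self[of "- (norm z)\<^sup>2 / 2"] by simp
  then have "gauss_weight z \<le> (norm z)\<^sup>2 / 2" by (simp add: gauss_weight_def)
  also have "\<dots> \<le> (norm z)\<^sup>2" by simp
  finally show ?thesis using gauss_weight_le_1[of z] by simp
qed

lemma gauss_weight_ge:
  assumes "0 \<le> a" "a \<le> norm z"
  shows "1 - exp (- a\<^sup>2 / 2) \<le> gauss_weight z"
  using power_mono[OF assms(2,1), of 2] by (simp add: gauss_weight_def)

text \<open>The radial profile has derivative bounded by 1, and the norm is 1-Lipschitz. This is
  what keeps a family of test functions equicontinuous after division by the weight.\<close>

lemma gauss_weight_Lipschitz: "\<bar>gauss_weight z - gauss_weight z'\<bar> \<le> norm (z - z')"
proof -
  have d: "((\<lambda>t. exp (- t\<^sup>2 / 2)) has_real_derivative - t * exp (- t\<^sup>2 / 2)) (at t within S)" for t :: real and S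
    by (auto intro!: derivative_eq_intros simp: power2_eq_square)
  have b: "norm (- t * exp (- t\<^sup>2 / 2)) \<le> 1" for t :: real
  proof -
    have "\<bar>t\<bar> \<le> 1 + t\<^sup>2 / 2"
      using zero_le_power2[of "\<bar>t\<bar> - 1"] by (simp add: power2_diff)
    also have "\<dots> \<le> exp (t\<^sup>2 / 2)" using exp_ge_add_one_self[of "t\<^sup>2 / 2"] by simp
    finally have "\<bar>t\<bar> * exp (- t\<^sup>2 / 2) \<le> exp (t\<^sup>2 / 2) * exp (- t\<^sup>2 / 2)" by (intro mult_right_mono) auto
    then show ?thesis by (simp add: abs_mult exp_minus)
  qed
  have "norm (exp (- (norm z)\<^sup>2 / 2) - exp (- (norm z')\<^sup>2 / 2)) \<le> 1 * norm (norm z - norm z')"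
    by (rule field_differentiable_bound[of UNIV "\<lambda>t. exp (- t\<^sup>2 / 2)", OF _ d b]) auto
  then have "\<bar>gauss_weight z - gauss_weight z'\<bar> \<le> \<bar>norm z - norm z'\<bar>" by (simp add: gauss_weight_def)
  also have "\<dots> \<le> norm (z - z')" by (rule norm_triangle_ineq3)
  finally show ?thesis .
qed

text \<open>One bound serves small and large jumps; its growth in \<xi> is only quadratic, hence
  integrable against the Gaussian measure.\<close>

lemma one_minus_cos_bounds:
  fixes z \<xi> :: "'a::euclidean_space"
  shows "1 - cos (\<xi> \<bullet> z) \<le> (2 + (norm \<xi>)\<^sup>2) * min 1 ((norm z)\<^sup>2)"
proof (cases "norm z \<le> 1")
  case True
  have "1 - cos (\<xi> \<bullet> z) = 2 * (sin ((\<xi> \<bullet> z) / 2))\<^sup>2"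
    using cos_double_sin[of "(\<xi> \<bullet> z) / 2"] by simp
  also have "\<dots> \<le> 2 * ((\<xi> \<bullet> z) / 2)\<^sup>2"
    using abs_sin_le_one abs_sin_x_le_abs_x[of "(\<xi> \<bullet> z) / 2"] by (intro mult_left_mono abs_le_square_iff[THEN iffD1]) auto
  also have "\<dots> \<le> (\<xi> \<bullet> z)\<^sup>2" by (simp add: power2_eq_square)
  also have "\<dots> \<le> (norm \<xi> * norm z)\<^sup>2"
    using Cauchy_Schwarz_ineq2[of \<xi> z] by (intro abs_le_square_iff[THEN iffD1]) auto
  also have "\<dots> \<le> (2 + (norm \<xi>)\<^sup>2) * (norm z)\<^sup>2"
    by (simp add: power_mult_distrib distrib_right)
  finally show ?thesis using True by (simp add: power_le_one min_absorb2)
next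
  case False
  then have "1 \<le> (norm z)\<^sup>2" by (simp add: one_le_power)
  moreover have "1 - cos (\<xi> \<bullet> z) \<le> 2" using cos_ge_minus_one[of "\<xi> \<bullet> z"] by linarith
  moreover have "0 \<le> (norm \<xi>)\<^sup>2" by simp
  ultimately have "1 - cos (\<xi> \<bullet> z) \<le> 2 + (norm \<xi>)\<^sup>2" "min 1 ((norm z)\<^sup>2) = 1" by linarith+
  then show ?thesis by simp
qed

text \<open>Averaging a cosine over a Gaussian shift of its frequency multiplies it by
  \<open>exp (- (norm z)\<^sup>2 / 2)\<close>; the sine terms average to 0.\<close>

lemma cos_mult_gauss_weight:
  "cos (\<xi> \<bullet> z) * gauss_weight z = cos (\<xi> \<bullet> z) - (\<integral>x. cos ((\<xi> + x) \<bullet> z) \<partial>gauss)"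
proof -
  have i: "integrable gauss (\<lambda>x. cos (z \<bullet> x))" "integrable gauss (\<lambda>x. sin (z \<bullet> x))"
    by (rule gauss.integrable_const_bound[of _ 1]; auto)+
  have "cos ((\<xi> + x) \<bullet> z) = cos (\<xi> \<bullet> z) * cos (z \<bullet> x) - sin (\<xi> \<bullet> z) * sin (z \<bullet> x)" for x
    by (simp only: inner_add_left cos_add inner_commute[of x z])
  then have "(\<integral>x. cos ((\<xi> + x) \<bullet> z) \<partial>gauss) = cos (\<xi> \<bullet> z) * exp (- (norm z)\<^sup>2 / 2)"
    using i by (simp add: gauss_cos gauss_sin)
  then show ?thesis by (simp add: gauss_weight_def algebra_simps)
qed

text \<open>Sigma-finiteness of \<open>N\<close> serves the Fubini argument below; for a Levy
  measure with a real-valued density it is supplied in \<open>levy_eigenfunctionI\<close>.\<close>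

locale sym_levy = prob_space M for M :: "'w measure" +
  fixes X :: "real \<Rightarrow> 'w \<Rightarrow> real ^ 'n" and A :: "real ^ 'n ^ 'n" and N :: "(real ^ 'n) measure"
  assumes process: "symmetric_levy_process M X A N"
    and sigma_finite_N: "sigma_finite_measure N"
begin

sublocale N: sigma_finite_measure N by (rule sigma_finite_N)

abbreviation "\<psi> \<equiv> levy_exponent A N"

lemma X_measurable [measurable]: "0 \<le> t \<Longrightarrow> X t \<in> borel_measurable M"
  using process by (auto simp: symmetric_levy_process_def levy_process_def)

lemma X_0: "\<omega> \<in> space M \<Longrightarrow> X 0 \<omega> = 0"
  using process by (auto simp: symmetric_levy_process_def levy_process_def)

lemma sets_N [simp, measurable_cong]: "sets N = sets borel"
  using process by (auto simp: symmetric_levy_process_def levy_measure_def)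

lemma space_N [simp]: "space N = UNIV"
  using sets_eq_imp_space_eq[OF sets_N] by simp

lemma integrable_min: "integrable N (\<lambda>z. min 1 ((norm z)\<^sup>2))"
  using process by (intro integrableI_nonneg) (auto simp: symmetric_levy_process_def levy_measure_def)

lemma integrable_gauss_weight: "integrable N gauss_weight"
proof (rule Bochner_Integration.integrable_bound[OF integrable_min])
  show "AE z in N. norm (gauss_weight z) \<le> norm (min 1 ((norm z)\<^sup>2))"
  proof (rule AE_I2)
    fix z :: "real ^ 'n"
    show "norm (gauss_weight z) \<le> norm (min 1 ((norm z)\<^sup>2))"
      using gauss_weight_le_min[of z] gauss_weight_nonneg[of z] unfolding real_norm_def by linarith
  qed
qed measurable

lemma integrable_one_minus_cos: "integrable N (\<lambda>z. 1 - cos (\<xi> \<bullet> z))"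
proof (rule Bochner_Integration.integrable_bound)
  show "integrable N (\<lambda>z. (2 + (norm \<xi>)\<^sup>2) * min 1 ((norm z)\<^sup>2))" using integrable_min by auto
  show "AE z in N. norm (1 - cos (\<xi> \<bullet> z)) \<le> norm ((2 + (norm \<xi>)\<^sup>2) * min 1 ((norm z)\<^sup>2))"
  proof (rule AE_I2)
    fix z :: "real ^ 'n"
    have "0 \<le> 1 - cos (\<xi> \<bullet> z)" by simp
    then show "norm (1 - cos (\<xi> \<bullet> z)) \<le> norm ((2 + (norm \<xi>)\<^sup>2) * min 1 ((norm z)\<^sup>2))"
      using one_minus_cos_bounds[of \<xi> z] by simp
  qed
qed measurable

lemma levy_exponent_nonneg: "0 \<le> \<psi> \<xi>"
proof -
  have "0 \<le> (A *v \<xi>) \<bullet> \<xi>" using process by (auto simp: symmetric_levy_process_def)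
  moreover have "0 \<le> (\<integral>z. 1 - cos (\<xi> \<bullet> z) \<partial>N)" by (rule integral_nonneg_AE) simp
  ultimately show ?thesis unfolding levy_exponent_def by simp
qed

lemma matrix_vector_measurable [measurable]: "(\<lambda>x. A *v x) \<in> borel_measurable borel"
  by (intro borel_measurable_continuous_onI linear_continuous_on matrix_vector_mul_bounded_linear)

lemma levy_exponent_measurable [measurable]: "\<psi> \<in> borel_measurable borel"
  unfolding levy_exponent_def[abs_def] by measurable

lemma X_cos: "0 \<le> t \<Longrightarrow> (\<integral>\<omega>. cos (\<xi> \<bullet> X t \<omega>) \<partial>M) = exp (- t * \<psi> \<xi>)"
  and X_sin: "0 \<le> t \<Longrightarrow> (\<integral>\<omega>. sin (\<xi> \<bullet> X t \<omega>) \<partial>M) = 0"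
proof -
  assume t: "0 \<le> t"
  have i: "integrable M (\<lambda>\<omega>. exp (\<i> * complex_of_real (\<xi> \<bullet> X t \<omega>)))"
    using t by (intro integrable_const_bound[of _ 1]) auto
  have e: "(\<integral>\<omega>. exp (\<i> * complex_of_real (\<xi> \<bullet> X t \<omega>)) \<partial>M) = exp (complex_of_real (- t * \<psi> \<xi>))"
    using process t by (auto simp: symmetric_levy_process_def)
  have "(\<integral>\<omega>. Re (exp (\<i> * complex_of_real (\<xi> \<bullet> X t \<omega>))) \<partial>M) = Re (exp (complex_of_real (- t * \<psi> \<xi>)))"
    "(\<integral>\<omega>. Im (exp (\<i> * complex_of_real (\<xi> \<bullet> X t \<omega>))) \<partial>M) = Im (exp (complex_of_real (- t * \<psi> \<xi>)))"
    by (simp_all only: integral_Re[OF i] integral_Im[OF i] e)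
  then show "(\<integral>\<omega>. cos (\<xi> \<bullet> X t \<omega>) \<partial>M) = exp (- t * \<psi> \<xi>)" "(\<integral>\<omega>. sin (\<xi> \<bullet> X t \<omega>) \<partial>M) = 0"
    by (simp_all add: Re_exp Im_exp)
qed

text \<open>This is the trace of \<open>A\<close>. In the weak limit below it becomes the mass of
  the atom at 0 left by the Gaussian component of the process.\<close>

definition "gauss_drift = (\<integral>x. (A *v x) \<bullet> x \<partial>gauss)"

lemma integrable_quadratic: "integrable gauss (\<lambda>x. (A *v x) \<bullet> x)"
proof -
  obtain K where K: "\<And>x. norm (A *v x) \<le> norm x * K" "0 < K"
    using bounded_linear.pos_bounded[OF matrix_vector_mul_bounded_linear[of A]] by blast
  show ?thesis
  proof (rule Bochner_Integration.integrable_bound)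
    show "integrable gauss (\<lambda>x :: real ^ 'n. K * (norm x)\<^sup>2)" by (intro integrable_mult_right gauss_integrable_norm_sq)
    show "AE x in gauss. norm ((A *v x) \<bullet> x) \<le> norm (K * (norm x)\<^sup>2)"
    proof (rule AE_I2)
      fix x :: "real ^ 'n"
      have "\<bar>(A *v x) \<bullet> x\<bar> \<le> norm (A *v x) * norm x" by (rule Cauchy_Schwarz_ineq2)
      also have "\<dots> \<le> (norm x * K) * norm x" using K by (intro mult_right_mono) auto
      finally show "norm ((A *v x) \<bullet> x) \<le> norm (K * (norm x)\<^sup>2)"
        using K(2) by (simp add: power2_eq_square mult_ac)
    qed
  qed measurable
qed

text \<open>The linear terms of the quadratic form average to 0 and leave
  \<open>gauss_drift\<close>; the jump part is interchanged with the average, and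
  \<open>cos_mult_gauss_weight\<close> is applied under the integral. Read from right to left, the
  identity expresses the transform of the weighted Levy measure by \<psi>.\<close>

lemma integrable_levy_exponent_shift: "integrable gauss (\<lambda>x. \<psi> (\<xi> + x))"
  and integral_levy_exponent_shift:
    "(\<integral>x. \<psi> (\<xi> + x) \<partial>gauss) = \<psi> \<xi> + (\<integral>z. cos (\<xi> \<bullet> z) * gauss_weight z \<partial>N) + gauss_drift"
proof -
  interpret P: pair_sigma_finite "gauss :: (real ^ 'n) measure" N ..
  have q: "(A *v (\<xi> + x)) \<bullet> (\<xi> + x) = (A *v \<xi>) \<bullet> \<xi> + (A *v \<xi> + transpose A *v \<xi>) \<bullet> x + (A *v x) \<bullet> x" for x
    by (simp add: matrix_vector_right_distrib inner_add_left inner_add_right dot_lmul_matrix[symmetric] inner_commute)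
  have i1: "integrable gauss (\<lambda>x. (A *v (\<xi> + x)) \<bullet> (\<xi> + x))"
    unfolding q by (intro Bochner_Integration.integrable_add gauss_integrable_const gauss_integrable_inner integrable_quadratic)
  have e1: "(\<integral>x. (A *v (\<xi> + x)) \<bullet> (\<xi> + x) \<partial>gauss) = (A *v \<xi>) \<bullet> \<xi> + gauss_drift"
    unfolding q gauss_drift_def
    using gauss_integrable_const[of "(A *v \<xi>) \<bullet> \<xi>"] gauss_integrable_inner[of "A *v \<xi> + transpose A *v \<xi>"] integrable_quadratic
    by (simp add: gauss_integral_inner del: gauss_integrable_const)
  have n: "norm (1 - cos (\<eta> \<bullet> z)) = 1 - cos (\<eta> \<bullet> z)" for \<eta> z :: "real ^ 'n" by simp
  have i2: "integrable (gauss \<Otimes>\<^sub>M N) (\<lambda>(x, z). 1 - cos ((\<xi> + x) \<bullet> z))"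
  proof (rule P.Fubini_integrable)
    show "integrable gauss (\<lambda>x. \<integral>z. norm (case (x, z) of (x, z) \<Rightarrow> 1 - cos ((\<xi> + x) \<bullet> z)) \<partial>N)"
    proof (rule Bochner_Integration.integrable_bound)
      have "(norm (\<xi> + x))\<^sup>2 = (norm \<xi>)\<^sup>2 + 2 * (\<xi> \<bullet> x) + (norm x)\<^sup>2" for x
        by (simp add: power2_norm_eq_inner inner_add_left inner_add_right inner_commute)
      then have "integrable gauss (\<lambda>x. (norm (\<xi> + x))\<^sup>2)"
        by (simp only:) (intro Bochner_Integration.integrable_add gauss_integrable_const integrable_mult_right
          gauss_integrable_inner gauss_integrable_norm_sq)
      then show "integrable gauss (\<lambda>x. (2 + (norm (\<xi> + x))\<^sup>2) * (\<integral>z. min 1 ((norm z)\<^sup>2) \<partial>N))" by auto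
      show "AE x in gauss. norm (\<integral>z. norm (case (x, z) of (x, z) \<Rightarrow> 1 - cos ((\<xi> + x) \<bullet> z)) \<partial>N)
          \<le> norm ((2 + (norm (\<xi> + x))\<^sup>2) * (\<integral>z. min 1 ((norm z)\<^sup>2) \<partial>N))"
      proof (rule AE_I2)
        fix x
        have "(\<integral>z. 1 - cos ((\<xi> + x) \<bullet> z) \<partial>N) \<le> (\<integral>z. (2 + (norm (\<xi> + x))\<^sup>2) * min 1 ((norm z)\<^sup>2) \<partial>N)"
          using integrable_min by (intro integral_mono integrable_one_minus_cos one_minus_cos_bounds) auto
        also have "\<dots> = (2 + (norm (\<xi> + x))\<^sup>2) * (\<integral>z. min 1 ((norm z)\<^sup>2) \<partial>N)" by simp
        finally have le: "(\<integral>z. 1 - cos ((\<xi> + x) \<bullet> z) \<partial>N) \<le> (2 + (norm (\<xi> + x))\<^sup>2) * (\<integral>z. min 1 ((norm z)\<^sup>2) \<partial>N)" .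
        have "0 \<le> (\<integral>z. 1 - cos ((\<xi> + x) \<bullet> z) \<partial>N)" by (rule integral_nonneg_AE) simp
        with le show "norm (\<integral>z. norm (case (x, z) of (x, z) \<Rightarrow> 1 - cos ((\<xi> + x) \<bullet> z)) \<partial>N)
          \<le> norm ((2 + (norm (\<xi> + x))\<^sup>2) * (\<integral>z. min 1 ((norm z)\<^sup>2) \<partial>N))"
          unfolding prod.case n by simp
      qed
    qed measurable
    show "AE x in gauss. integrable N (\<lambda>z. case (x, z) of (x, z) \<Rightarrow> 1 - cos ((\<xi> + x) \<bullet> z))"
      by (simp add: integrable_one_minus_cos)
  qed measurable
  have i3: "integrable gauss (\<lambda>x. \<integral>z. 1 - cos ((\<xi> + x) \<bullet> z) \<partial>N)"
    using P.integrable_fst'[OF i2] by simp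
  have "(\<integral>x. (\<integral>z. 1 - cos ((\<xi> + x) \<bullet> z) \<partial>N) \<partial>gauss) = (\<integral>z. (\<integral>x. 1 - cos ((\<xi> + x) \<bullet> z) \<partial>gauss) \<partial>N)"
    using P.Fubini_integral[OF i2] by simp
  also have "\<dots> = (\<integral>z. (1 - cos (\<xi> \<bullet> z)) + cos (\<xi> \<bullet> z) * gauss_weight z \<partial>N)"
  proof (intro Bochner_Integration.integral_cong refl)
    fix z
    have "integrable gauss (\<lambda>x. cos ((\<xi> + x) \<bullet> z))"
      by (rule gauss.integrable_const_bound[of _ 1]) auto
    then have "(\<integral>x. 1 - cos ((\<xi> + x) \<bullet> z) \<partial>gauss) = 1 - (\<integral>x. cos ((\<xi> + x) \<bullet> z) \<partial>gauss)"
      by simp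
    then show "(\<integral>x. 1 - cos ((\<xi> + x) \<bullet> z) \<partial>gauss) = (1 - cos (\<xi> \<bullet> z)) + cos (\<xi> \<bullet> z) * gauss_weight z"
      by (simp only: cos_mult_gauss_weight)
  qed
  also have "\<dots> = (\<integral>z. 1 - cos (\<xi> \<bullet> z) \<partial>N) + (\<integral>z. cos (\<xi> \<bullet> z) * gauss_weight z \<partial>N)"
  proof (rule Bochner_Integration.integral_add[OF integrable_one_minus_cos])
    show "integrable N (\<lambda>z. cos (\<xi> \<bullet> z) * gauss_weight z)"
      by (rule Bochner_Integration.integrable_bound[OF integrable_gauss_weight])
        (auto simp: abs_mult mult_left_le_one_le)
  qed
  finally have e3: "(\<integral>x. (\<integral>z. 1 - cos ((\<xi> + x) \<bullet> z) \<partial>N) \<partial>gauss)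
     = (\<integral>z. 1 - cos (\<xi> \<bullet> z) \<partial>N) + (\<integral>z. cos (\<xi> \<bullet> z) * gauss_weight z \<partial>N)" .
  show "integrable gauss (\<lambda>x. \<psi> (\<xi> + x))"
    unfolding levy_exponent_def using i1 i3 by (rule Bochner_Integration.integrable_add)
  show "(\<integral>x. \<psi> (\<xi> + x) \<partial>gauss) = \<psi> \<xi> + (\<integral>z. cos (\<xi> \<bullet> z) * gauss_weight z \<partial>N) + gauss_drift"
    unfolding levy_exponent_def Bochner_Integration.integral_add[OF i1 i3] e1 e3 by simp
qed

text \<open>\<open>cos_mult_gauss_weight\<close> is applied at the value of the process; after
  Fubini only the known means of \<open>X_cos\<close> remain. Divided by \<open>t\<close>, this is
  the prelimit form of \<open>integral_levy_exponent_shift\<close>.\<close>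

lemma X_cos_gauss_weight:
  assumes t: "0 \<le> t"
  shows "(\<integral>\<omega>. cos (\<xi> \<bullet> X t \<omega>) * gauss_weight (X t \<omega>) \<partial>M)
    = (\<integral>x. 1 - exp (- t * \<psi> (\<xi> + x)) \<partial>gauss) - (1 - exp (- t * \<psi> \<xi>))"
proof -
  note [measurable] = X_measurable[OF t]
  interpret P: pair_prob_space M "gauss :: (real ^ 'n) measure" ..
  have i: "integrable (M \<Otimes>\<^sub>M gauss) (\<lambda>(\<omega>, x). cos ((\<xi> + x) \<bullet> X t \<omega>))"
    by (rule P.integrable_const_bound[of _ 1]) auto
  have i1: "integrable M (\<lambda>\<omega>. cos (\<xi> \<bullet> X t \<omega>))"
    by (rule integrable_const_bound[of _ 1]) auto
  have i2: "integrable M (\<lambda>\<omega>. \<integral>x. cos ((\<xi> + x) \<bullet> X t \<omega>) \<partial>gauss)"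
    using P.integrable_fst'[OF i] by simp
  have i3: "integrable gauss (\<lambda>x. exp (- t * \<psi> (\<xi> + x)))"
    using t by (intro gauss.integrable_const_bound[of _ 1]) (auto simp: levy_exponent_nonneg)
  have "(\<integral>\<omega>. (\<integral>x. cos ((\<xi> + x) \<bullet> X t \<omega>) \<partial>gauss) \<partial>M) = (\<integral>x. (\<integral>\<omega>. cos ((\<xi> + x) \<bullet> X t \<omega>) \<partial>M) \<partial>gauss)"
    using P.Fubini_integral[OF i] by simp
  also have "\<dots> = (\<integral>x. exp (- t * \<psi> (\<xi> + x)) \<partial>gauss)" unfolding X_cos[OF t] ..
  finally show ?thesis
    unfolding cos_mult_gauss_weight Bochner_Integration.integral_diff[OF i1 i2]
      Bochner_Integration.integral_diff[OF gauss_integrable_const i3] X_cos[OF t] by simp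
qed

text \<open>Bounds the mean of \<open>gauss_weight\<close> along the process per unit of time, and
  thereby the mass of the weighted laws as well as every tail probability.\<close>

definition "tail_rate = (\<integral>x. \<psi> x \<partial>gauss)"

lemma tail_rate_nonneg: "0 \<le> tail_rate"
  unfolding tail_rate_def by (rule integral_nonneg_AE) (simp add: levy_exponent_nonneg)

lemma X_gauss_weight_le:
  assumes t: "0 \<le> t"
  shows "(\<integral>\<omega>. gauss_weight (X t \<omega>) \<partial>M) \<le> t * tail_rate"
proof -
  have "(\<integral>\<omega>. gauss_weight (X t \<omega>) \<partial>M) = (\<integral>x. 1 - exp (- t * \<psi> (0 + x)) \<partial>gauss) - (1 - exp (- t * \<psi> 0))"
    using X_cos_gauss_weight[OF t, of 0] by simp
  also have "\<dots> \<le> (\<integral>x. 1 - exp (- t * \<psi> (0 + x)) \<partial>gauss)"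
    using t by (simp add: levy_exponent_nonneg)
  also have "\<dots> \<le> (\<integral>x. t * \<psi> (0 + x) \<partial>gauss)"
  proof (rule integral_mono)
    show "integrable gauss (\<lambda>x. 1 - exp (- t * \<psi> (0 + x)))"
      using t by (intro gauss.integrable_const_bound[of _ 1]) (auto simp: levy_exponent_nonneg)
    show "integrable gauss (\<lambda>x. t * \<psi> (0 + x))"
      using integrable_levy_exponent_shift by (rule integrable_mult_right)
    show "1 - exp (- t * \<psi> (0 + x)) \<le> t * \<psi> (0 + x)" for x
      using exp_ge_add_one_self[of "- t * \<psi> (0 + x)"] by simp
  qed
  finally show ?thesis by (simp add: tail_rate_def)
qed

text \<open>Markov's inequality for the weight instead of the norm, which need not have moments. The
  bound is linear in \<open>t\<close>, as required for errors of order o(h) per step.\<close>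

lemma X_tail:
  assumes t: "0 \<le> t" and b: "0 < b"
  shows "prob {\<omega> \<in> space M. b \<le> norm (X t \<omega>)} \<le> t * (tail_rate / (1 - exp (- b\<^sup>2 / 2)))"
proof -
  note [measurable] = X_measurable[OF t]
  have kb: "0 < 1 - exp (- b\<^sup>2 / 2)" using b by simp
  have i: "integrable M (\<lambda>\<omega>. gauss_weight (X t \<omega>))"
    by (rule integrable_const_bound[of _ 1]) (auto simp: gauss_weight_le_1)
  have "prob {\<omega> \<in> space M. b \<le> norm (X t \<omega>)} \<le> prob {\<omega> \<in> space M. 1 - exp (- b\<^sup>2 / 2) \<le> gauss_weight (X t \<omega>)}"
    using gauss_weight_ge[of b] b by (intro finite_measure_mono) auto
  also have "\<dots> \<le> (\<integral>\<omega>. gauss_weight (X t \<omega>) \<partial>M) / (1 - exp (- b\<^sup>2 / 2))"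
    by (rule integral_Markov_inequality_measure[OF i _ _ kb, where A = "{}"]) auto
  also have "\<dots> \<le> t * tail_rate / (1 - exp (- b\<^sup>2 / 2))"
    using kb X_gauss_weight_le[OF t] by (intro divide_right_mono) auto
  finally show ?thesis by simp
qed

lemma N_sin_gauss_weight: "(\<integral>z. sin (\<xi> \<bullet> z) * gauss_weight z \<partial>N) = 0"
proof -
  have d: "distr N borel uminus = N" using process by (auto simp: symmetric_levy_process_def)
  have "(\<integral>z. sin (\<xi> \<bullet> z) * gauss_weight z \<partial>N) = (\<integral>z. sin (\<xi> \<bullet> z) * gauss_weight z \<partial>distr N borel uminus)"
    by (simp add: d)
  also have "\<dots> = (\<integral>z. - (sin (\<xi> \<bullet> z) * gauss_weight z) \<partial>N)"
    by (subst integral_distr) (auto simp: gauss_weight_def)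
  finally show ?thesis by simp
qed

lemma X_sin_gauss_weight:
  assumes t: "0 \<le> t"
  shows "(\<integral>\<omega>. sin (\<xi> \<bullet> X t \<omega>) * gauss_weight (X t \<omega>) \<partial>M) = 0"
proof -
  note [measurable] = X_measurable[OF t]
  interpret P: pair_prob_space M "gauss :: (real ^ 'n) measure" ..
  have i: "integrable (M \<Otimes>\<^sub>M gauss) (\<lambda>(\<omega>, x). sin ((\<xi> + x) \<bullet> X t \<omega>))"
    by (rule P.integrable_const_bound[of _ 1]) auto
  have i1: "integrable M (\<lambda>\<omega>. sin (\<xi> \<bullet> X t \<omega>))"
    by (rule integrable_const_bound[of _ 1]) auto
  have i2: "integrable M (\<lambda>\<omega>. \<integral>x. sin ((\<xi> + x) \<bullet> X t \<omega>) \<partial>gauss)"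
    using P.integrable_fst'[OF i] by simp
  have "(\<integral>x. sin ((\<xi> + x) \<bullet> z) \<partial>gauss) = sin (\<xi> \<bullet> z) * exp (- (norm z)\<^sup>2 / 2)" for z
  proof -
    have j: "integrable gauss (\<lambda>x. cos (z \<bullet> x))" "integrable gauss (\<lambda>x. sin (z \<bullet> x))"
      by (rule gauss.integrable_const_bound[of _ 1]; auto)+
    have "sin ((\<xi> + x) \<bullet> z) = sin (\<xi> \<bullet> z) * cos (z \<bullet> x) + cos (\<xi> \<bullet> z) * sin (z \<bullet> x)" for x
      by (simp only: inner_add_left sin_add inner_commute[of x z])
    then show ?thesis using j by (simp add: gauss_cos gauss_sin)
  qed
  then have w: "sin (\<xi> \<bullet> z) * gauss_weight z = sin (\<xi> \<bullet> z) - (\<integral>x. sin ((\<xi> + x) \<bullet> z) \<partial>gauss)" for z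
    by (simp add: gauss_weight_def algebra_simps)
  have "(\<integral>\<omega>. (\<integral>x. sin ((\<xi> + x) \<bullet> X t \<omega>) \<partial>gauss) \<partial>M) = (\<integral>x. (\<integral>\<omega>. sin ((\<xi> + x) \<bullet> X t \<omega>) \<partial>M) \<partial>gauss)"
    using P.Fubini_integral[OF i] by simp
  also have "\<dots> = 0" unfolding X_sin[OF t] by simp
  finally show ?thesis
    unfolding w Bochner_Integration.integral_diff[OF i1 i2] X_sin[OF t] by simp
qed

end

section \<open>Weak limit of the weighted small-time laws\<close>

lemma one_minus_exp_quotient_tendsto:
  fixes a :: real
  assumes h: "\<And>n. 0 < h n" "h \<longlonglongrightarrow> 0"
  shows "(\<lambda>n. (1 - exp (- h n * a)) / h n) \<longlonglongrightarrow> a"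
proof -
  have "((\<lambda>t. 1 - exp (- t * a)) has_field_derivative a) (at 0)"
    by (auto intro!: derivative_eq_intros)
  then have "((\<lambda>t. (1 - exp (- t * a)) / t) \<longlongrightarrow> a) (at 0)"
    by (simp add: has_field_derivative_iff)
  moreover have "filterlim h (at 0) sequentially"
    using h by (auto simp: filterlim_at intro!: always_eventually less_imp_neq[symmetric])
  ultimately show ?thesis by (rule filterlim_compose)
qed

context sym_levy
begin

definition weighted_N :: "(real ^ 'n) measure" where
  "weighted_N = density N (\<lambda>z. ennreal (gauss_weight z))"

definition weighted_X :: "real \<Rightarrow> (real ^ 'n) measure" where
  "weighted_X h = density (distr M borel (X h)) (\<lambda>z. ennreal (gauss_weight z / h))"

lemma sets_weighted [simp, measurable_cong]: "sets weighted_N = sets borel" "sets (weighted_X h) = sets borel"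
  by (simp_all add: weighted_N_def weighted_X_def)

lemma integral_weighted_N:
  fixes f :: "real ^ 'n \<Rightarrow> real"
  assumes [measurable]: "f \<in> borel_measurable borel"
  shows "(\<integral>z. f z \<partial>weighted_N) = (\<integral>z. f z * gauss_weight z \<partial>N)"
  unfolding weighted_N_def by (subst integral_density) (auto simp: mult.commute)

lemma integral_weighted_X:
  fixes f :: "real ^ 'n \<Rightarrow> real"
  assumes [measurable]: "f \<in> borel_measurable borel" and h: "0 < h"
  shows "(\<integral>z. f z \<partial>weighted_X h) = (\<integral>\<omega>. f (X h \<omega>) * gauss_weight (X h \<omega>) \<partial>M) / h"
proof -
  have [measurable]: "X h \<in> borel_measurable M" using h by simp
  have "(\<integral>z. f z \<partial>weighted_X h) = (\<integral>z. gauss_weight z / h * f z \<partial>distr M borel (X h))"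
    unfolding weighted_X_def using h by (subst integral_density) auto
  also have "\<dots> = (\<integral>\<omega>. f (X h \<omega>) * gauss_weight (X h \<omega>) / h \<partial>M)"
    by (subst integral_distr) (auto simp: mult_ac)
  finally show ?thesis by simp
qed

lemma finite_measure_weighted_N: "finite_measure weighted_N"
proof
  have "emeasure weighted_N UNIV = (\<integral>\<^sup>+z. ennreal (gauss_weight z) \<partial>N)"
    by (simp add: weighted_N_def emeasure_density)
  also have "\<dots> = ennreal (\<integral>z. gauss_weight z \<partial>N)"
    by (intro nn_integral_eq_integral integrable_gauss_weight) auto
  finally show "emeasure weighted_N (space weighted_N) \<noteq> \<infinity>" by (simp add: weighted_N_def)
qed

lemma finite_measure_weighted_X:
  assumes h: "0 < h"
  shows "finite_measure (weighted_X h)" "measure (weighted_X h) UNIV \<le> tail_rate"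
proof -
  have [measurable]: "X h \<in> borel_measurable M" using h by simp
  have i: "integrable M (\<lambda>\<omega>. gauss_weight (X h \<omega>))"
    by (rule integrable_const_bound[of _ 1]) (auto simp: gauss_weight_le_1)
  have "emeasure (weighted_X h) UNIV = (\<integral>\<^sup>+\<omega>. ennreal (gauss_weight (X h \<omega>) / h) \<partial>M)"
    by (simp add: weighted_X_def emeasure_density nn_integral_distr)
  also have "\<dots> = ennreal (\<integral>\<omega>. gauss_weight (X h \<omega>) / h \<partial>M)"
    using i h by (intro nn_integral_eq_integral) auto
  finally have e: "emeasure (weighted_X h) UNIV = ennreal ((\<integral>\<omega>. gauss_weight (X h \<omega>) \<partial>M) / h)" by simp
  show "finite_measure (weighted_X h)"
    by (rule finite_measureI) (use e in \<open>simp add: weighted_X_def\<close>)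
  have "(\<integral>\<omega>. gauss_weight (X h \<omega>) \<partial>M) / h \<le> tail_rate"
    using h X_gauss_weight_le[of h] by (simp add: field_simps)
  then show "measure (weighted_X h) UNIV \<le> tail_rate"
    using e h tail_rate_nonneg unfolding measure_def
    by (simp add: integral_nonneg_AE)
qed

text \<open>By \<open>X_cos_gauss_weight\<close> the transform is built from quotients
  \<open>(1 - exp (- h * \<psi>)) / h\<close>; these converge to \<psi> and are dominated by it, so
  the limit passes through the Gaussian average.\<close>

lemma cos_transform_weighted_X_tendsto:
  assumes h: "\<And>n. 0 < h n" "h \<longlonglongrightarrow> 0"
  shows "(\<lambda>n. cos_transform (weighted_X (h n)) \<xi>) \<longlonglongrightarrow> cos_transform weighted_N \<xi> + gauss_drift"
proof -
  have eq: "cos_transform (weighted_X (h n)) \<xi> =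
      (\<integral>x. (1 - exp (- h n * \<psi> (\<xi> + x))) / h n \<partial>gauss) - (1 - exp (- h n * \<psi> \<xi>)) / h n" for n
    unfolding cos_transform_def using h(1)[of n]
    by (subst integral_weighted_X)
      (measurable, simp only: X_cos_gauss_weight[OF less_imp_le[OF h(1)]] integral_divide_zero diff_divide_distrib[of "integral\<^sup>L _ _"])
  have lim: "(\<lambda>n. \<integral>x. (1 - exp (- h n * \<psi> (\<xi> + x))) / h n \<partial>gauss) \<longlonglongrightarrow> (\<integral>x. \<psi> (\<xi> + x) \<partial>gauss)"
  proof (rule integral_dominated_convergence)
    show "integrable gauss (\<lambda>x. \<psi> (\<xi> + x))" by (rule integrable_levy_exponent_shift)
    show "AE x in gauss. (\<lambda>n. (1 - exp (- h n * \<psi> (\<xi> + x))) / h n) \<longlonglongrightarrow> \<psi> (\<xi> + x)"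
      by (intro AE_I2 one_minus_exp_quotient_tendsto h)
    show "AE x in gauss. norm ((1 - exp (- h n * \<psi> (\<xi> + x))) / h n) \<le> \<psi> (\<xi> + x)" for n
    proof (rule AE_I2)
      fix x
      have "0 \<le> 1 - exp (- h n * \<psi> (\<xi> + x))"
        using h(1)[of n] levy_exponent_nonneg[of "\<xi> + x"] by simp
      then show "norm ((1 - exp (- h n * \<psi> (\<xi> + x))) / h n) \<le> \<psi> (\<xi> + x)"
        using exp_ge_add_one_self[of "- h n * \<psi> (\<xi> + x)"] h(1)[of n] by (simp add: field_simps)
    qed
  qed measurable
  have "(\<integral>x. \<psi> (\<xi> + x) \<partial>gauss) - \<psi> \<xi> = cos_transform weighted_N \<xi> + gauss_drift"
    unfolding integral_levy_exponent_shift cos_transform_def by (subst integral_weighted_N) auto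
  with tendsto_diff[OF lim one_minus_exp_quotient_tendsto[OF h, of "\<psi> \<xi>"]] show ?thesis
    unfolding eq by simp
qed

text \<open>The weak limit is applied to \<open>F (y + z)\<close> divided by the weight, so that the
  weight cancels on both sides. The distance \<open>a\<close> keeps the quotient regular and makes
  it vanish at \<open>z = 0\<close>, which removes the atom. Uniformity in \<open>y\<close> holds
  because the translates of \<open>F\<close> share their modulus of continuity, their bound and
  their L1 norm.\<close>

lemma small_time_limit:
  fixes F :: "real ^ 'n \<Rightarrow> real"
  assumes h: "\<And>n. 0 < h n" "h \<longlonglongrightarrow> 0"
    and F: "uniformly_continuous_on UNIV F" "\<And>z. \<bar>F z\<bar> \<le> K" "integrable lborel F"
    and a: "0 < a" "\<And>y z. y \<in> D \<Longrightarrow> F z \<noteq> 0 \<Longrightarrow> a \<le> norm (z - y)"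
    and e: "0 < e"
  shows "\<forall>\<^sub>F n in sequentially. \<forall>y\<in>D.
    \<bar>(\<integral>\<omega>. F (y + X (h n) \<omega>) \<partial>M) / h n - (\<integral>z. F (y + z) \<partial>N)\<bar> \<le> e"
proof -
  define ka where "ka = 1 - exp (- a\<^sup>2 / 2)"
  have ka: "0 < ka" using a(1) by (simp add: ka_def)
  have K0: "0 \<le> K" using F(2)[of 0] by linarith
  have [measurable]: "F \<in> borel_measurable borel"
    using F(3) by (simp add: borel_measurable_integrable)
  \<comment> \<open>\<open>ka\<close> is the weight at distance \<open>a\<close>. Where
    \<open>F (y + z)\<close> is nonzero the maximum is just the weight, and elsewhere it keeps the
    denominator away from 0.\<close>
  define f where "f y z = F (y + z) / max ka (gauss_weight z)" for y z
  have [measurable]: "f y \<in> borel_measurable borel" for y unfolding f_def[abs_def] by measurable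
  have mx: "0 < max ka w" "ka \<le> max ka w" for w using ka by auto
  have fw: "f y z * gauss_weight z = F (y + z)" if "y \<in> D" for y z
  proof (cases "F (y + z) = 0")
    case False
    then have "ka \<le> gauss_weight z"
      unfolding ka_def using a that by (intro gauss_weight_ge) (auto dest: a(2)[of y "y + z"])
    then show ?thesis using ka by (simp add: f_def max_absorb2)
  qed (simp add: f_def)
  have f0: "f y 0 = 0" if "y \<in> D" for y
    using a(1) a(2)[OF that, of y] by (auto simp: f_def)
  have fb: "\<bar>f y z\<bar> \<le> \<bar>F (y + z)\<bar> / ka" for y z
    using mx[of "gauss_weight z"] ka by (simp add: f_def abs_divide divide_left_mono)
  have shift: "integrable lborel (\<lambda>z. F (y + z))" "(\<integral>z. \<bar>F (y + z)\<bar> \<partial>lborel) = (\<integral>z. \<bar>F z\<bar> \<partial>lborel)" for y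
  proof -
    show "(\<integral>z. \<bar>F (y + z)\<bar> \<partial>lborel) = (\<integral>z. \<bar>F z\<bar> \<partial>lborel)"
      using lborel_integral_euclidean_affine[of "\<lambda>z. \<bar>F z\<bar>" 1 y] by simp
    have "integrable (distr lborel borel ((+) y)) F" using F(3) by (simp add: lborel_distr_plus)
    then show "integrable lborel (\<lambda>z. F (y + z))" by (subst (asm) integrable_distr_eq) auto
  qed
  have "\<forall>\<^sub>F n in sequentially. \<forall>y\<in>D. \<bar>(\<integral>z. f y z \<partial>weighted_X (h n)) - (\<integral>z. f y z \<partial>weighted_N) - gauss_drift * f y 0\<bar> \<le> e"
  proof (rule uniform_weak_limit)
    show "finite_measure (weighted_X (h n))" "measure (weighted_X (h n)) UNIV \<le> tail_rate" for n
      using finite_measure_weighted_X[OF h(1)] by auto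
    show "finite_measure weighted_N" by (rule finite_measure_weighted_N)
    show "(\<integral>z. sin (\<xi> \<bullet> z) \<partial>weighted_X (h n)) = 0" for n \<xi>
      using h(1)[of n] by (subst integral_weighted_X) (auto simp: X_sin_gauss_weight)
    show "(\<integral>z. sin (\<xi> \<bullet> z) \<partial>weighted_N) = 0" for \<xi>
      by (subst integral_weighted_N) (auto simp: N_sin_gauss_weight)
    show "(\<lambda>n. cos_transform (weighted_X (h n)) \<xi>) \<longlonglongrightarrow> cos_transform weighted_N \<xi> + gauss_drift" for \<xi>
      by (rule cos_transform_weighted_X_tendsto[OF h])
    show i: "integrable lborel (f y)" for y
    proof (rule Bochner_Integration.integrable_bound)
      show "integrable lborel (\<lambda>z. \<bar>F (y + z)\<bar> / ka)" using shift(1) by simp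
      show "AE z in lborel. norm (f y z) \<le> norm (\<bar>F (y + z)\<bar> / ka)" using fb ka by auto
    qed measurable
    show "(\<integral>z. \<bar>f y z\<bar> \<partial>lborel) \<le> (\<integral>z. \<bar>F z\<bar> \<partial>lborel) / ka" for y
    proof -
      have "(\<integral>z. \<bar>f y z\<bar> \<partial>lborel) \<le> (\<integral>z. \<bar>F (y + z)\<bar> / ka \<partial>lborel)"
        using i shift(1) fb by (intro integral_mono) auto
      then show ?thesis using shift(2) by simp
    qed
    show "\<bar>f y z\<bar> \<le> K / ka" for y z
      using fb[of y z] divide_right_mono[OF F(2)[of "y + z"], of ka] ka by linarith
    fix e' :: real assume e': "0 < e'"
    obtain d where d: "0 < d" "\<And>z z'. norm (z - z') < d \<Longrightarrow> \<bar>F z - F z'\<bar> < e' * ka / 2"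
using F(1)[unfolded uniformly_continuous_on_def dist_norm, rule_format, of "e' * ka / 2"] e' ka by auto
    \<comment> \<open>The second entry controls the change of the denominator: the weight is
      1-Lipschitz and \<open>F\<close> is bounded by \<open>K\<close>, so this change costs at most
      \<open>e' / 2\<close>.\<close>
    define d' where "d' = min d (e' * ka\<^sup>2 / (2 * (K + 1)))"
    have "0 < d'" unfolding d'_def using d(1) e' ka K0 by simp
    moreover have "\<bar>f y z - f y z'\<bar> \<le> e'" if zz: "norm (z - z') < d'" for y z z'
    proof -
      let ?p = "max ka (gauss_weight z)" and ?p' = "max ka (gauss_weight z')"
      have p: "0 < ?p" "0 < ?p'" "ka \<le> ?p" "ka \<le> ?p'" using ka by auto
      have "f y z - f y z' = (F (y + z) - F (y + z')) / ?p + F (y + z') * ((?p' - ?p) / (?p * ?p'))"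
        unfolding f_def using p(1,2) by (simp add: field_simps)
      moreover have "\<bar>(F (y + z) - F (y + z')) / ?p\<bar> \<le> e' / 2"
      proof -
        have "\<bar>F (y + z) - F (y + z')\<bar> < e' * ka / 2"
          using zz by (intro d(2)) (simp add: d'_def)
        moreover have "e' * ka / 2 \<le> e' / 2 * ?p" using e' p(3) by simp
        ultimately show ?thesis using p(1) by (simp add: abs_divide divide_le_eq)
      qed
      moreover have "\<bar>F (y + z') * ((?p' - ?p) / (?p * ?p'))\<bar> \<le> e' / 2"
      proof -
        have "\<bar>?p' - ?p\<bar> \<le> \<bar>gauss_weight z - gauss_weight z'\<bar>" by linarith
        also have "\<dots> \<le> norm (z - z')" by (rule gauss_weight_Lipschitz)
        also have "\<dots> \<le> e' * ka\<^sup>2 / (2 * (K + 1))" using zz by (simp add: d'_def)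
        finally have 1: "\<bar>?p' - ?p\<bar> \<le> e' * ka\<^sup>2 / (2 * (K + 1))" .
        have 2: "ka\<^sup>2 \<le> ?p * ?p'" unfolding power2_eq_square using p ka by (intro mult_mono) auto
        have "\<bar>(?p' - ?p) / (?p * ?p')\<bar> \<le> (e' * ka\<^sup>2 / (2 * (K + 1))) / ka\<^sup>2"
          unfolding abs_divide using 1 2 p ka K0 e' by (intro frac_le) (auto simp: abs_mult)
        also have "\<dots> = e' / (2 * (K + 1))" using ka by simp
        finally have "\<bar>F (y + z') * ((?p' - ?p) / (?p * ?p'))\<bar> \<le> (K + 1) * (e' / (2 * (K + 1)))"
          unfolding abs_mult using F(2)[of "y + z'"] K0 by (intro mult_mono) auto
        also have "\<dots> = e' / 2" using K0 by (simp add: field_simps)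
        finally show ?thesis .
      qed
      moreover have "\<bar>x\<bar> \<le> e'" if "x = b + c" "\<bar>b\<bar> \<le> e' / 2" "\<bar>c\<bar> \<le> e' / 2" for x b c :: real
        using that by linarith
      ultimately show ?thesis by blast
    qed
    ultimately show "\<exists>d>0. \<forall>y\<in>D. \<forall>z z'. norm (z - z') < d \<longrightarrow> \<bar>f y z - f y z'\<bar> \<le> e'" by blast
  qed (use e in auto)
  then show ?thesis
  proof (eventually_elim, intro ballI)
    fix n y assume *: "\<forall>y\<in>D. \<bar>(\<integral>z. f y z \<partial>weighted_X (h n)) - (\<integral>z. f y z \<partial>weighted_N) - gauss_drift * f y 0\<bar> \<le> e"
      and y: "y \<in> D"
    have "(\<integral>z. f y z \<partial>weighted_X (h n)) = (\<integral>\<omega>. F (y + X (h n) \<omega>) \<partial>M) / h n"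
      using h(1)[of n] by (subst integral_weighted_X) (auto simp: fw[OF y])
    moreover have "(\<integral>z. f y z \<partial>weighted_N) = (\<integral>z. F (y + z) \<partial>N)"
      by (subst integral_weighted_N) (auto simp: fw[OF y])
    ultimately show "\<bar>(\<integral>\<omega>. F (y + X (h n) \<omega>) \<partial>M) / h n - (\<integral>z. F (y + z) \<partial>N)\<bar> \<le> e"
      using *[rule_format, OF y] f0[OF y] by simp
  qed
qed

end

section \<open>The Markov property on grids\<close>

context sym_levy
begin

lemma X_right_continuous:
  "\<omega> \<in> space M \<Longrightarrow> 0 \<le> t \<Longrightarrow> ((\<lambda>s. X s \<omega>) \<longlongrightarrow> X t \<omega>) (at_right t)"
  using process by (auto simp: symmetric_levy_process_def levy_process_def cadlag_def)

lemma X_stationary: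
  "0 \<le> s \<Longrightarrow> 0 \<le> t \<Longrightarrow> distr M borel (\<lambda>\<omega>. X (s + t) \<omega> - X s \<omega>) = distr M borel (X t)"
  using process by (auto simp: symmetric_levy_process_def levy_process_def)

text \<open>Right-continuity makes the process a pointwise limit of processes that are constant in
  time on grid intervals, each a countable gluing of measurable maps. \<open>max 0\<close> removes
  negative times, on which \<open>levy_process\<close> imposes nothing.\<close>

lemma X_joint_measurable [measurable]: "(\<lambda>(s, \<omega>). X (max 0 s) \<omega>) \<in> borel_measurable (borel \<Otimes>\<^sub>M M)"
proof -
  \<comment> \<open>\<open>c k s\<close> lies strictly to the right of \<open>max 0 s\<close>, since
    the filter \<open>at_right\<close> does not see the point itself.\<close>
  define c where "c k s = (real (nat \<lfloor>real (Suc k) * max 0 s\<rfloor>) + 1) / real (Suc k)" for k :: nat and s :: real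
  have c: "max 0 s < c k s" "c k s \<le> max 0 s + 1 / real (Suc k)" for k s
  proof -
    let ?f = "real (nat \<lfloor>real (Suc k) * max 0 s\<rfloor>)"
    have "?f \<le> real (Suc k) * max 0 s" "real (Suc k) * max 0 s < ?f + 1"
      by (simp_all add: of_nat_nat)
    moreover have "m < (q + 1) / K \<and> (q + 1) / K \<le> m + 1 / K" if "0 < K" "q \<le> K * m" "K * m < q + 1" for K q m :: real
      using that by (simp add: field_simps)
    ultimately show "max 0 s < c k s" "c k s \<le> max 0 s + 1 / real (Suc k)"
      unfolding c_def by (metis of_nat_0_less_iff zero_less_Suc)+
  qed
  have lim: "(\<lambda>k. X (c k s) \<omega>) \<longlonglongrightarrow> X (max 0 s) \<omega>" if "\<omega> \<in> space M" for s \<omega>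
  proof (rule filterlim_compose[OF X_right_continuous[OF that]])
    have "(\<lambda>k. c k s) \<longlonglongrightarrow> max 0 s"
    proof (rule real_tendsto_sandwich[of "\<lambda>_. max 0 s" _ _ "\<lambda>k. max 0 s + 1 / real (Suc k)"])
      show "(\<lambda>k. max 0 s + 1 / real (Suc k)) \<longlonglongrightarrow> max 0 s"
        using tendsto_add[OF tendsto_const LIMSEQ_Suc[OF lim_1_over_n], of "max 0 s"] by simp
    qed (use c in \<open>auto intro!: always_eventually less_imp_le\<close>)
    then show "filterlim (\<lambda>k. c k s) (at_right (max 0 s)) sequentially"
      using c(1) by (auto simp: filterlim_at intro!: always_eventually less_imp_neq[symmetric])
  qed simp
  show ?thesis
  proof (rule borel_measurable_LIMSEQ_metric)
    show "(\<lambda>(s, \<omega>). X (c k s) \<omega>) \<in> borel_measurable (borel \<Otimes>\<^sub>M M)" for k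
    proof -
      have "(\<lambda>p. X ((real (nat \<lfloor>real (Suc k) * max 0 (fst p)\<rfloor>) + 1) / real (Suc k)) (snd p)) \<in> borel_measurable (borel \<Otimes>\<^sub>M M)"
      proof (rule measurable_compose_countable[where f = "\<lambda>i p. X ((real i + 1) / real (Suc k)) (snd p)"])
        show "(\<lambda>p. X ((real i + 1) / real (Suc k)) (snd p)) \<in> borel_measurable (borel \<Otimes>\<^sub>M M)" for i
          by (rule measurable_compose[OF measurable_snd X_measurable]) simp
      qed measurable
      then show ?thesis unfolding c_def by (simp add: case_prod_beta')
    qed
    show "(\<lambda>k. case p of (s, \<omega>) \<Rightarrow> X (c k s) \<omega>) \<longlonglongrightarrow> (case p of (s, \<omega>) \<Rightarrow> X (max 0 s) \<omega>)"
      if "p \<in> space (borel \<Otimes>\<^sub>M M)" for p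
      using lim that by (auto simp: space_pair_measure)
  qed
qed

text \<open>The positions up to time \<open>t n\<close> are partial sums of earlier increments,
  hence independent of the last increment; stationarity gives that increment the law of
  \<open>X (s - t n)\<close>, and the integral over the product law separates the two.\<close>

lemma markov_property:
  fixes t :: "nat \<Rightarrow> real" and f :: "(nat \<Rightarrow> real ^ 'n) \<Rightarrow> real ^ 'n \<Rightarrow> ennreal"
  assumes t: "t 0 = 0" "\<And>i. i < n \<Longrightarrow> t i \<le> t (Suc i)" "t n \<le> s"
    and f: "(\<lambda>(w, z). f w z) \<in> borel_measurable (PiM {..n} (\<lambda>_. borel) \<Otimes>\<^sub>M borel)"
  shows "(\<integral>\<^sup>+\<omega>. f (\<lambda>i\<in>{..n}. X (t i) \<omega>) (X s \<omega> - X (t n) \<omega>) \<partial>M)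
       = (\<integral>\<^sup>+\<omega>. (\<integral>\<^sup>+\<omega>'. f (\<lambda>i\<in>{..n}. X (t i) \<omega>) (X (s - t n) \<omega>') \<partial>M) \<partial>M)"
proof -
  \<comment> \<open>Appends \<open>s\<close> to the grid, so that the increment from
    \<open>t n\<close> to \<open>s\<close> is the one with index \<open>n\<close>.\<close>
  define u where "u i = (if i \<le> n then t i else s)" for i
  have t_nonneg: "0 \<le> t i" if "i \<le> n" for i
    using that by (induct i) (auto simp: t(1) intro: order_trans[OF _ t(2)])
  have [measurable]: "X (t i) \<in> borel_measurable M" if "i \<le> n" for i
    using t_nonneg[OF that] by simp
  have [measurable]: "X s \<in> borel_measurable M" "X (s - t n) \<in> borel_measurable M"
    using t_nonneg[of n] t(3) by auto
  let ?I = "\<lambda>i \<omega>. X (u (Suc i)) \<omega> - X (u i) \<omega>"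
  let ?past = "\<lambda>\<omega>. \<lambda>i\<in>{..n}. X (t i) \<omega>" and ?Z = "\<lambda>\<omega>. X s \<omega> - X (t n) \<omega>"
  let ?S = "PiM {..n} (\<lambda>_. borel :: (real ^ 'n) measure)" and ?R = "PiM {n} (\<lambda>_. borel :: (real ^ 'n) measure)"
  have u: "0 \<le> u 0" "\<forall>i<Suc n. u i \<le> u (Suc i)"
    using t by (auto simp: u_def less_Suc_eq)
  have "indep_vars (\<lambda>_. borel) ?I {..<Suc n}"
    using process u by (auto simp: symmetric_levy_process_def levy_process_def)
  then have "indep_var (PiM {..<n} (\<lambda>_. borel)) (\<lambda>\<omega>. restrict (\<lambda>i. ?I i \<omega>) {..<n}) (PiM {n} (\<lambda>_. borel)) (\<lambda>\<omega>. restrict (\<lambda>i. ?I i \<omega>) {n})"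
    by (rule indep_var_restrict) auto
  then have "indep_var ?S ((\<lambda>w. \<lambda>i\<in>{..n}. \<Sum>j<i. w j) \<circ> (\<lambda>\<omega>. restrict (\<lambda>i. ?I i \<omega>) {..<n}))
      ?R ((\<lambda>w. w) \<circ> (\<lambda>\<omega>. restrict (\<lambda>i. ?I i \<omega>) {n}))"
  proof (rule indep_var_compose)
    show "(\<lambda>w. \<lambda>i\<in>{..n}. \<Sum>j<i. w j) \<in> measurable (PiM {..<n} (\<lambda>_. borel)) ?S"
      by (intro measurable_restrict borel_measurable_sum measurable_component_singleton) auto
  qed simp
  then have dist: "distr M ?S ((\<lambda>w. \<lambda>i\<in>{..n}. \<Sum>j<i. w j) \<circ> (\<lambda>\<omega>. restrict (\<lambda>i. ?I i \<omega>) {..<n})) \<Otimes>\<^sub>M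
      distr M ?R ((\<lambda>w. w) \<circ> (\<lambda>\<omega>. restrict (\<lambda>i. ?I i \<omega>) {n}))
    = distr M (?S \<Otimes>\<^sub>M ?R) (\<lambda>\<omega>. (((\<lambda>w. \<lambda>i\<in>{..n}. \<Sum>j<i. w j) \<circ> (\<lambda>\<omega>. restrict (\<lambda>i. ?I i \<omega>) {..<n})) \<omega>,
        ((\<lambda>w. w) \<circ> (\<lambda>\<omega>. restrict (\<lambda>i. ?I i \<omega>) {n})) \<omega>))"
    unfolding indep_var_distribution_eq by blast
  have past: "((\<lambda>w. \<lambda>i\<in>{..n}. \<Sum>j<i. w j) \<circ> (\<lambda>\<omega>. restrict (\<lambda>i. ?I i \<omega>) {..<n})) \<omega> = ?past \<omega>" if "\<omega> \<in> space M" for \<omega>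
  proof -
    have "(\<Sum>j<i. restrict (\<lambda>i. ?I i \<omega>) {..<n} j) = X (t i) \<omega>" if "i \<le> n" for i
    proof -
      have "(\<Sum>j<i. restrict (\<lambda>i. ?I i \<omega>) {..<n} j) = (\<Sum>j<i. X (u (Suc j)) \<omega> - X (u j) \<omega>)"
        using that by (intro sum.cong) auto
      also have "\<dots> = X (u i) \<omega> - X (u 0) \<omega>" by (rule sum_lessThan_telescope)
      finally show ?thesis using that X_0[OF \<open>\<omega> \<in> space M\<close>] t(1) by (simp add: u_def)
    qed
    then show ?thesis by (auto simp: restrict_def)
  qed
  have Z: "((\<lambda>w. w) \<circ> (\<lambda>\<omega>. restrict (\<lambda>i. ?I i \<omega>) {n})) \<omega> = (\<lambda>i\<in>{n}. ?Z \<omega>)" for \<omega>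
    by (auto simp: u_def restrict_def)
  have "distr M ?S ?past \<Otimes>\<^sub>M distr M ?R (\<lambda>\<omega>. \<lambda>i\<in>{n}. ?Z \<omega>) = distr M (?S \<Otimes>\<^sub>M ?R) (\<lambda>\<omega>. (?past \<omega>, \<lambda>i\<in>{n}. ?Z \<omega>))"
  proof -
    have "distr M ?S ((\<lambda>w. \<lambda>i\<in>{..n}. \<Sum>j<i. w j) \<circ> (\<lambda>\<omega>. restrict (\<lambda>i. ?I i \<omega>) {..<n})) = distr M ?S ?past"
      by (rule distr_cong[OF refl refl past])
    moreover have "distr M ?R ((\<lambda>w. w) \<circ> (\<lambda>\<omega>. restrict (\<lambda>i. ?I i \<omega>) {n})) = distr M ?R (\<lambda>\<omega>. \<lambda>i\<in>{n}. ?Z \<omega>)"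
      by (rule distr_cong[OF refl refl Z])
    moreover have "distr M (?S \<Otimes>\<^sub>M ?R) (\<lambda>\<omega>. (((\<lambda>w. \<lambda>i\<in>{..n}. \<Sum>j<i. w j) \<circ> (\<lambda>\<omega>. restrict (\<lambda>i. ?I i \<omega>) {..<n})) \<omega>,
        ((\<lambda>w. w) \<circ> (\<lambda>\<omega>. restrict (\<lambda>i. ?I i \<omega>) {n})) \<omega>)) = distr M (?S \<Otimes>\<^sub>M ?R) (\<lambda>\<omega>. (?past \<omega>, \<lambda>i\<in>{n}. ?Z \<omega>))"
      by (rule distr_cong[OF refl refl]) (simp only: past Z)
    ultimately show ?thesis using dist by (simp only:)
  qed
  moreover have "distr M ?R (\<lambda>\<omega>. \<lambda>i\<in>{n}. ?Z \<omega>) = distr M ?R (\<lambda>\<omega>. \<lambda>i\<in>{n}. X (s - t n) \<omega>)"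
  proof -
    have m: "(\<lambda>z. \<lambda>i\<in>{n}. z) \<in> measurable borel ?R" by (intro measurable_restrict) simp
    have "distr M borel (\<lambda>\<omega>. X (t n + (s - t n)) \<omega> - X (t n) \<omega>) = distr M borel (X (s - t n))"
      using t_nonneg[of n] t(3) by (intro X_stationary) auto
    then have "distr (distr M borel ?Z) ?R (\<lambda>z. \<lambda>i\<in>{n}. z) = distr (distr M borel (X (s - t n))) ?R (\<lambda>z. \<lambda>i\<in>{n}. z)"
      by simp
    then show ?thesis by (simp add: distr_distr[OF m] o_def)
  qed
  ultimately have D: "distr M (?S \<Otimes>\<^sub>M ?R) (\<lambda>\<omega>. (?past \<omega>, \<lambda>i\<in>{n}. ?Z \<omega>)) = distr M ?S ?past \<Otimes>\<^sub>M distr M ?R (\<lambda>\<omega>. \<lambda>i\<in>{n}. X (s - t n) \<omega>)"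
    by simp
  have pm[measurable]: "?past \<in> measurable M ?S"
    by (intro measurable_restrict) auto
  have zm[measurable]: "(\<lambda>\<omega>. \<lambda>i\<in>{n}. ?Z \<omega>) \<in> measurable M ?R" "(\<lambda>\<omega>. \<lambda>i\<in>{n}. X (s - t n) \<omega>) \<in> measurable M ?R"
    by (intro measurable_restrict; simp)+
  interpret P: prob_space "distr M ?R (\<lambda>\<omega>. \<lambda>i\<in>{n}. X (s - t n) \<omega>)" by (rule prob_space_distr) (rule zm)
  have f': "(\<lambda>(w, z). f w (z n)) \<in> borel_measurable (?S \<Otimes>\<^sub>M ?R)"
  proof -
    have "(\<lambda>p. (fst p, snd p n)) \<in> measurable (?S \<Otimes>\<^sub>M ?R) (?S \<Otimes>\<^sub>M borel)" by measurable
    from measurable_compose[OF this f] show ?thesis by (simp add: case_prod_beta')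
  qed
  have "(\<integral>\<^sup>+\<omega>. f (?past \<omega>) (?Z \<omega>) \<partial>M) = (\<integral>\<^sup>+p. (case p of (w, z) \<Rightarrow> f w (z n)) \<partial>distr M (?S \<Otimes>\<^sub>M ?R) (\<lambda>\<omega>. (?past \<omega>, \<lambda>i\<in>{n}. ?Z \<omega>)))"
    using f' by (subst nn_integral_distr) auto
  also have "\<dots> = (\<integral>\<^sup>+w. (\<integral>\<^sup>+z. f w (z n) \<partial>distr M ?R (\<lambda>\<omega>. \<lambda>i\<in>{n}. X (s - t n) \<omega>)) \<partial>distr M ?S ?past)"
    unfolding D by (subst P.nn_integral_fst[symmetric]) (use f' in \<open>auto cong: measurable_cong_sets\<close>)
  also have "\<dots> = (\<integral>\<^sup>+\<omega>. (\<integral>\<^sup>+z. f (?past \<omega>) (z n) \<partial>distr M ?R (\<lambda>\<omega>. \<lambda>i\<in>{n}. X (s - t n) \<omega>)) \<partial>M)"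
    using f' by (subst nn_integral_distr) (auto intro!: P.borel_measurable_nn_integral cong: measurable_cong_sets)
  also have "\<dots> = (\<integral>\<^sup>+\<omega>. (\<integral>\<^sup>+\<omega>'. f (?past \<omega>) (X (s - t n) \<omega>') \<partial>M) \<partial>M)"
  proof (intro nn_integral_cong)
    fix \<omega> assume "\<omega> \<in> space M"
    then have "?past \<omega> \<in> space ?S" using pm by (rule measurable_space[rotated])
    then have "(\<lambda>z. f (?past \<omega>) (z n)) \<in> borel_measurable ?R"
      using measurable_compose[OF measurable_Pair1' f'] by simp
    then show "(\<integral>\<^sup>+z. f (?past \<omega>) (z n) \<partial>distr M ?R (\<lambda>\<omega>. \<lambda>i\<in>{n}. X (s - t n) \<omega>)) = (\<integral>\<^sup>+\<omega>'. f (?past \<omega>) (X (s - t n) \<omega>') \<partial>M)"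
      by (subst nn_integral_distr[OF zm(2)]) auto
  qed
  finally show ?thesis .
qed


lemma markov_grid:
  fixes g :: "real ^ 'n \<Rightarrow> real ^ 'n \<Rightarrow> ennreal"
  assumes h: "0 \<le> h" "real n * h \<le> s"
    and P: "Measurable.pred (PiM {..n} (\<lambda>_. borel)) P"
    and g: "(\<lambda>(x, z). g x z) \<in> borel_measurable (borel \<Otimes>\<^sub>M borel)"
  shows "(\<integral>\<^sup>+\<omega>. indicator {\<omega>. P (\<lambda>i\<in>{..n}. X (real i * h) \<omega>)} \<omega> * g (X (real n * h) \<omega>) (X s \<omega> - X (real n * h) \<omega>) \<partial>M)
    = (\<integral>\<^sup>+\<omega>. indicator {\<omega>. P (\<lambda>i\<in>{..n}. X (real i * h) \<omega>)} \<omega> *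
        (\<integral>\<^sup>+\<omega>'. g (X (real n * h) \<omega>) (X (s - real n * h) \<omega>') \<partial>M) \<partial>M)"
proof -
  have X': "X (s - real n * h) \<in> borel_measurable M" using h by simp
  have "(\<lambda>p. (fst p n, snd p)) \<in> measurable (PiM {..n} (\<lambda>_. borel) \<Otimes>\<^sub>M borel) (borel \<Otimes>\<^sub>M borel :: ((real ^ 'n) \<times> (real ^ 'n)) measure)"
    by measurable
  from measurable_compose[OF this g]
  have [measurable]: "(\<lambda>(w, z). g (w n) z) \<in> borel_measurable (PiM {..n} (\<lambda>_. borel) \<Otimes>\<^sub>M borel)"
    by (simp add: case_prod_beta')
  have P': "Measurable.pred (PiM {..n} (\<lambda>_. borel) \<Otimes>\<^sub>M borel) (\<lambda>p :: _ \<times> (real ^ 'n). P (fst p))"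
    by (rule measurable_compose[OF measurable_fst P])
  have m: "(\<lambda>(w, z). indicator {w. P w} w * g (w n) z) \<in> borel_measurable (PiM {..n} (\<lambda>_. borel) \<Otimes>\<^sub>M borel)"
  proof -
    have "(\<lambda>p. (if P (fst p) then 1 else 0) * (case p of (w, z) \<Rightarrow> g (w n) z)) \<in> borel_measurable (PiM {..n} (\<lambda>_. borel) \<Otimes>\<^sub>M borel)"
      using P' by measurable
    then show ?thesis by (simp add: case_prod_beta' indicator_def of_bool_def)
  qed
  have "(\<integral>\<^sup>+\<omega>. indicator {w. P w} (\<lambda>i\<in>{..n}. X (real i * h) \<omega>) * g ((\<lambda>i\<in>{..n}. X (real i * h) \<omega>) n) (X s \<omega> - X (real n * h) \<omega>) \<partial>M)
    = (\<integral>\<^sup>+\<omega>. (\<integral>\<^sup>+\<omega>'. indicator {w. P w} (\<lambda>i\<in>{..n}. X (real i * h) \<omega>) * g ((\<lambda>i\<in>{..n}. X (real i * h) \<omega>) n) (X (s - real n * h) \<omega>') \<partial>M) \<partial>M)"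
    by (rule markov_property[where t = "\<lambda>i. real i * h", OF _ _ _ m]) (use h in \<open>auto intro!: mult_right_mono\<close>)
  also have "\<dots> = (\<integral>\<^sup>+\<omega>. indicator {w. P w} (\<lambda>i\<in>{..n}. X (real i * h) \<omega>) * (\<integral>\<^sup>+\<omega>'. g ((\<lambda>i\<in>{..n}. X (real i * h) \<omega>) n) (X (s - real n * h) \<omega>') \<partial>M) \<partial>M)"
    by (intro nn_integral_cong) (simp add: indicator_def)
  finally show ?thesis by (simp add: indicator_def)
qed

section \<open>First passages on a grid\<close>

definition first_passage :: "real \<Rightarrow> real \<Rightarrow> nat \<Rightarrow> 'w set" where
  "first_passage h b n = {\<omega> \<in> space M. b \<le> norm (X (real n * h) \<omega>) \<and> (\<forall>j<n. norm (X (real j * h) \<omega>) < b)}"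

lemma first_passage_sets [measurable]: "0 \<le> h \<Longrightarrow> first_passage h b n \<in> sets M"
  unfolding first_passage_def by measurable

lemma first_passage_disjoint: "disjoint_family (first_passage h b)"
proof -
  have "i = j" if "\<omega> \<in> first_passage h b i" "\<omega> \<in> first_passage h b j" for i j \<omega>
    using that unfolding first_passage_def by (metis (mono_tags, lifting) mem_Collect_eq linorder_neqE_nat not_le)
  then show ?thesis unfolding disjoint_family_on_def by blast
qed

lemma first_passage_exists:
  assumes "\<omega> \<in> space M" "b \<le> norm (X (real n * h) \<omega>)"
  obtains i where "i \<le> n" "\<omega> \<in> first_passage h b i"
proof -
  define i where "i = (LEAST i. b \<le> norm (X (real i * h) \<omega>))"
  have "i \<le> n" unfolding i_def using assms(2) by (rule Least_le)
  moreover have "b \<le> norm (X (real i * h) \<omega>)" unfolding i_def using assms(2) by (rule LeastI)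
  moreover have "norm (X (real j * h) \<omega>) < b" if "j < i" for j
    using not_less_Least[of j "\<lambda>i. b \<le> norm (X (real i * h) \<omega>)"] that unfolding i_def by auto
  ultimately show ?thesis using assms(1) that by (auto simp: first_passage_def)
qed

lemma markov_first_passage:
  fixes g :: "real ^ 'n \<Rightarrow> real ^ 'n \<Rightarrow> ennreal"
  assumes h: "0 \<le> h" "real n * h \<le> s"
    and g: "(\<lambda>(x, z). g x z) \<in> borel_measurable (borel \<Otimes>\<^sub>M borel)"
  shows "(\<integral>\<^sup>+\<omega>. indicator (first_passage h b n) \<omega> * g (X (real n * h) \<omega>) (X s \<omega> - X (real n * h) \<omega>) \<partial>M)
    = (\<integral>\<^sup>+\<omega>. indicator (first_passage h b n) \<omega> *
        (\<integral>\<^sup>+\<omega>'. g (X (real n * h) \<omega>) (X (s - real n * h) \<omega>') \<partial>M) \<partial>M)"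
proof -
  define P where "P w \<longleftrightarrow> b \<le> norm (w n) \<and> (\<forall>j\<in>{..<n}. norm (w j) < b)" for w :: "nat \<Rightarrow> real ^ 'n"
  have "Measurable.pred (PiM {..n} (\<lambda>_. borel)) P"
    unfolding P_def[abs_def] by measurable
  from markov_grid[OF h this g]
  have "(\<integral>\<^sup>+\<omega>. indicator {\<omega>. P (\<lambda>i\<in>{..n}. X (real i * h) \<omega>)} \<omega> * g (X (real n * h) \<omega>) (X s \<omega> - X (real n * h) \<omega>) \<partial>M)
    = (\<integral>\<^sup>+\<omega>. indicator {\<omega>. P (\<lambda>i\<in>{..n}. X (real i * h) \<omega>)} \<omega> *
        (\<integral>\<^sup>+\<omega>'. g (X (real n * h) \<omega>) (X (s - real n * h) \<omega>') \<partial>M) \<partial>M)" .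
  moreover have "indicator {\<omega>. P (\<lambda>i\<in>{..n}. X (real i * h) \<omega>)} \<omega> = (indicator (first_passage h b n) \<omega> :: ennreal)"
    if "\<omega> \<in> space M" for \<omega>
    using that by (auto simp: indicator_def P_def first_passage_def)
  ultimately show ?thesis by (simp cong: nn_integral_cong_simp)
qed

text \<open>Ottaviani's maximal inequality: after the first passage over \<open>2 * b\<close> the process moves back
  by less than \<open>b\<close> with probability at least one half.\<close>

lemma grid_maximal_inequality:
  assumes h: "0 \<le> h" and half: "\<And>u. 0 \<le> u \<Longrightarrow> u \<le> real n * h \<Longrightarrow> prob {\<omega> \<in> space M. b \<le> norm (X u \<omega>)} \<le> 1 / 2"
  shows "(\<Sum>i\<le>n. emeasure M (first_passage h (2 * b) i)) \<le> 2 * emeasure M {\<omega> \<in> space M. b \<le> norm (X (real n * h) \<omega>)}"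
proof -
  let ?E = "first_passage h (2 * b)" and ?G = "{\<omega> \<in> space M. b \<le> norm (X (real n * h) \<omega>)}"
  have [measurable]: "?E i \<in> sets M" for i using h by simp
  have [measurable]: "X (real i * h) \<in> borel_measurable M" for i using h by simp
  have G[measurable]: "?G \<in> sets M" by measurable
  have step: "emeasure M (?E i) \<le> 2 * (\<integral>\<^sup>+\<omega>. indicator (?E i) \<omega> * indicator ?G \<omega> \<partial>M)" if i: "i \<le> n" for i
  proof -
    have u: "0 \<le> real n * h - real i * h" "real n * h - real i * h \<le> real n * h" "real i * h \<le> real n * h"
      using i h by (auto intro: mult_right_mono)
    let ?u = "real n * h - real i * h"
    have [measurable]: "X ?u \<in> borel_measurable M" using u by simp
    \<comment> \<open>The remaining time \<open>?u\<close> is at most \<open>n * h\<close>, so by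
      \<open>half\<close> the increment after the passage stays below \<open>b\<close> with
      probability at least one half. Inserting this factor allows the Markov property to be used
      backwards.\<close>
    have p: "1 \<le> 2 * (\<integral>\<^sup>+\<omega>'. indicator {z. norm z < b} (X ?u \<omega>') \<partial>M)"
    proof -
      have "(\<integral>\<^sup>+\<omega>'. indicator {z. norm z < b} (X ?u \<omega>') \<partial>M) = (\<integral>\<^sup>+\<omega>'. indicator {\<omega> \<in> space M. norm (X ?u \<omega>) < b} \<omega>' \<partial>M)"
        by (intro nn_integral_cong) (auto simp: indicator_def)
      also have "\<dots> = emeasure M {\<omega> \<in> space M. norm (X ?u \<omega>) < b}" by (rule nn_integral_indicator) measurable
      also have "\<dots> = prob {\<omega> \<in> space M. norm (X ?u \<omega>) < b}" by (rule emeasure_eq_measure)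
      finally have e: "(\<integral>\<^sup>+\<omega>'. indicator {z. norm z < b} (X ?u \<omega>') \<partial>M) = prob {\<omega> \<in> space M. norm (X ?u \<omega>) < b}" .
      have "{\<omega> \<in> space M. norm (X ?u \<omega>) < b} = space M - {\<omega> \<in> space M. b \<le> norm (X ?u \<omega>)}" by auto
      then have "prob {\<omega> \<in> space M. norm (X ?u \<omega>) < b} = 1 - prob {\<omega> \<in> space M. b \<le> norm (X ?u \<omega>)}"
        by (simp only:) (rule prob_compl, measurable)
      then have "1 / 2 \<le> prob {\<omega> \<in> space M. norm (X ?u \<omega>) < b}" using half[OF u(1,2)] by linarith
      then have "ennreal 1 \<le> ennreal (2 * prob {\<omega> \<in> space M. norm (X ?u \<omega>) < b})" by (intro ennreal_leI) linarith
      then show ?thesis unfolding e by (simp add: ennreal_mult)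
    qed
    have "emeasure M (?E i) = (\<integral>\<^sup>+\<omega>. indicator (?E i) \<omega> * 1 \<partial>M)" by simp
    also have "\<dots> \<le> (\<integral>\<^sup>+\<omega>. indicator (?E i) \<omega> * (2 * (\<integral>\<^sup>+\<omega>'. indicator {z. norm z < b} (X ?u \<omega>') \<partial>M)) \<partial>M)"
      using p by (intro nn_integral_mono mult_left_mono) auto
    also have "\<dots> = 2 * (\<integral>\<^sup>+\<omega>. indicator (?E i) \<omega> * (\<integral>\<^sup>+\<omega>'. indicator {z. norm z < b} (X ?u \<omega>') \<partial>M) \<partial>M)"
    proof -
      have "(\<integral>\<^sup>+\<omega>. indicator (?E i) \<omega> * (2 * q) \<partial>M) = 2 * (\<integral>\<^sup>+\<omega>. indicator (?E i) \<omega> * q \<partial>M)" for q :: ennreal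
        by (subst nn_integral_cmult[symmetric]) (measurable, simp only: mult.left_commute)
      then show ?thesis .
    qed
    also have "(\<integral>\<^sup>+\<omega>. indicator (?E i) \<omega> * (\<integral>\<^sup>+\<omega>'. indicator {z. norm z < b} (X ?u \<omega>') \<partial>M) \<partial>M)
        = (\<integral>\<^sup>+\<omega>. indicator (?E i) \<omega> * indicator {z. norm z < b} (X (real n * h) \<omega> - X (real i * h) \<omega>) \<partial>M)"
      by (rule markov_first_passage[OF h u(3), of "\<lambda>x z. indicator {z. norm z < b} z", symmetric]) measurable
    also have "\<dots> \<le> (\<integral>\<^sup>+\<omega>. indicator (?E i) \<omega> * indicator ?G \<omega> \<partial>M)"
    proof (intro nn_integral_mono)
      fix \<omega> assume "\<omega> \<in> space M"
      have "b \<le> norm (X (real n * h) \<omega>)" if "2 * b \<le> norm (X (real i * h) \<omega>)" "norm (X (real n * h) \<omega> - X (real i * h) \<omega>) < b"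
        using that norm_triangle_ineq2[of "X (real i * h) \<omega>" "X (real n * h) \<omega>"] by (simp add: norm_minus_commute)
      then show "indicator (?E i) \<omega> * indicator {z. norm z < b} (X (real n * h) \<omega> - X (real i * h) \<omega>) \<le> indicator (?E i) \<omega> * (indicator ?G \<omega> :: ennreal)"
        using \<open>\<omega> \<in> space M\<close> by (auto simp: indicator_def first_passage_def)
    qed
    finally show ?thesis by (simp add: mult_left_mono)
  qed
  have "(\<Sum>i\<le>n. emeasure M (?E i)) \<le> (\<Sum>i\<le>n. 2 * (\<integral>\<^sup>+\<omega>. indicator (?E i) \<omega> * indicator ?G \<omega> \<partial>M))"
    by (intro sum_mono step) simp
  also have "\<dots> = 2 * (\<integral>\<^sup>+\<omega>. (\<Sum>i\<le>n. indicator (?E i) \<omega>) * indicator ?G \<omega> \<partial>M)"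
    by (subst sum_distrib_left[symmetric], subst nn_integral_sum[symmetric]) (measurable, simp only: sum_distrib_right)
  also have "\<dots> \<le> 2 * (\<integral>\<^sup>+\<omega>. indicator ?G \<omega> \<partial>M)"
  proof (intro mult_left_mono nn_integral_mono)
    fix \<omega>
    \<comment> \<open>First passages at different indices exclude each other, so the indicators sum
      to at most 1 and the bound does not deteriorate with the number of grid points.\<close>
    have "(\<Sum>i\<le>n. indicator (?E i) \<omega>) = (indicator (\<Union>i\<le>n. ?E i) \<omega> :: ennreal)"
      using first_passage_disjoint[of h "2 * b"]
      by (intro indicator_UN_disjoint[symmetric]) (auto simp: disjoint_family_on_def)
    then show "(\<Sum>i\<le>n. indicator (?E i) \<omega>) * indicator ?G \<omega> \<le> (indicator ?G \<omega> :: ennreal)"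
      by (auto simp: indicator_def)
  qed simp
  finally show ?thesis by simp
qed

end

section \<open>Occupation times\<close>

context sym_levy
begin

text \<open>Right-continuity keeps the norm above \<open>b\<close> for a short while after
  \<open>s1\<close>, and a fine grid has a point in that interval before \<open>s2\<close>.
  Detection at \<open>s1\<close> itself cannot be guaranteed, hence the two times.\<close>

lemma grid_passage_eventually:
  assumes \<omega>: "\<omega> \<in> space M" and s: "0 \<le> s1" "s1 < s2" "s2 \<le> t" and b: "b < norm (X s1 \<omega>)"
  shows "\<forall>\<^sub>F m in sequentially. \<exists>i\<le>Suc m. real i * (t / Suc m) \<le> s2 \<and> b \<le> norm (X (real i * (t / Suc m)) \<omega>)"
proof -
  have t: "0 < t" using s by linarith
  have "\<forall>\<^sub>F u in at_right s1. b < norm (X u \<omega>)"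
    using tendsto_norm[OF X_right_continuous[OF \<omega> s(1)]] b by (rule order_tendstoD(1))
  then obtain c where c: "s1 < c" "\<And>u. s1 < u \<Longrightarrow> u < c \<Longrightarrow> b < norm (X u \<omega>)"
    unfolding eventually_at_right_field by blast
  define d where "d = min c s2 - s1"
  have d: "0 < d" using c(1) s(2) by (simp add: d_def)
  have "(\<lambda>m. t / real (Suc m)) \<longlonglongrightarrow> 0"
    using LIMSEQ_Suc[OF lim_const_over_n[of t]] by simp
  then have "\<forall>\<^sub>F m in sequentially. t / real (Suc m) < d" using d by (rule order_tendstoD(2))
  then show ?thesis
  proof eventually_elim
    fix m assume m: "t / real (Suc m) < d"
    define h where "h = t / real (Suc m)"
    have h: "0 < h" "h < d" using t m by (simp_all add: h_def)
    \<comment> \<open>The first grid index strictly to the right of \<open>s1\<close>; its time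
      exceeds \<open>s1\<close> by at most one mesh.\<close>
    define i where "i = nat \<lfloor>s1 / h\<rfloor> + 1"
    have "real i = of_int \<lfloor>s1 / h\<rfloor> + 1" using s(1) h(1) by (simp add: i_def)
    then have "s1 / h < real i" "real i \<le> s1 / h + 1" by linarith+
    then have "s1 < real i * h" "real i * h \<le> s1 + h" using h(1) by (simp_all add: field_simps)
    then have i: "s1 < real i * h" "real i * h < c" "real i * h \<le> s2" using h(2) by (auto simp: d_def)
    have "real i * h \<le> real (Suc m) * h" using i(3) s(3) by (simp add: h_def)
    then have "i \<le> Suc m" using h(1) by (simp only: mult_le_cancel_right) simp
    with i c(2)[of "real i * h"] show "\<exists>i\<le>Suc m. real i * (t / Suc m) \<le> s2 \<and> b \<le> norm (X (real i * (t / Suc m)) \<omega>)"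
      unfolding h_def[symmetric] by (intro exI[of _ i]) auto
  qed
qed

text \<open>For fixed \<open>s\<close> the Markov property restarts the process at the passage. A
  shift of time then turns the window from \<open>n * h\<close> to \<open>t\<close> into part of the
  window from 0 to \<open>t\<close>, where \<kappa> applies uniformly in the starting point.\<close>

lemma first_passage_occupation:
  fixes W :: "real ^ 'n \<Rightarrow> ennreal"
  assumes W[measurable]: "W \<in> borel_measurable borel" and h: "0 \<le> h" and n: "real n * h \<le> t"
    and \<kappa>: "\<And>z. (\<integral>\<^sup>+\<omega>. (\<integral>\<^sup>+s\<in>{0..t}. W (z + X (max 0 s) \<omega>) \<partial>lborel) \<partial>M) \<le> \<kappa>"
  shows "(\<integral>\<^sup>+\<omega>. (\<integral>\<^sup>+s\<in>{real n * h..t}. indicator (first_passage h b n) \<omega> * W (y + X (max 0 s) \<omega>) \<partial>lborel) \<partial>M)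
     \<le> \<kappa> * emeasure M (first_passage h b n)"
proof -
  interpret L: pair_sigma_finite "lborel :: real measure" M ..
  let ?E = "first_passage h b n" and ?\<tau> = "real n * h"
  have \<tau>: "0 \<le> ?\<tau>" using h by simp
  have [measurable]: "?E \<in> sets M" using h by simp
  have [measurable]: "X ?\<tau> \<in> borel_measurable M" using \<tau> by simp
  have [measurable]: "(\<lambda>(s, \<omega>). X (max 0 (s - c)) \<omega>) \<in> borel_measurable (borel \<Otimes>\<^sub>M M)" for c
  proof -
    have "(\<lambda>p. (fst p - c, snd p)) \<in> measurable (borel \<Otimes>\<^sub>M M) (borel \<Otimes>\<^sub>M M)" by measurable
    from measurable_compose[OF this X_joint_measurable] show ?thesis by (simp add: case_prod_beta')
  qed
  have "(\<integral>\<^sup>+\<omega>. (\<integral>\<^sup>+s\<in>{?\<tau>..t}. indicator ?E \<omega> * W (y + X (max 0 s) \<omega>) \<partial>lborel) \<partial>M)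
     = (\<integral>\<^sup>+s. (\<integral>\<^sup>+\<omega>. indicator ?E \<omega> * W (y + X (max 0 s) \<omega>) * indicator {?\<tau>..t} s \<partial>M) \<partial>lborel)"
    by (rule L.Fubini') measurable
  also have "\<dots> = (\<integral>\<^sup>+s. (\<integral>\<^sup>+\<omega>. indicator ?E \<omega> * (\<integral>\<^sup>+\<omega>'. W (y + X ?\<tau> \<omega> + X (max 0 (s - ?\<tau>)) \<omega>') * indicator {?\<tau>..t} s \<partial>M) \<partial>M) \<partial>lborel)"
  proof (rule nn_integral_cong)
    fix s :: real
    show "(\<integral>\<^sup>+\<omega>. indicator ?E \<omega> * W (y + X (max 0 s) \<omega>) * indicator {?\<tau>..t} s \<partial>M)
      = (\<integral>\<^sup>+\<omega>. indicator ?E \<omega> * (\<integral>\<^sup>+\<omega>'. W (y + X ?\<tau> \<omega> + X (max 0 (s - ?\<tau>)) \<omega>') * indicator {?\<tau>..t} s \<partial>M) \<partial>M)"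
    proof (cases "s \<in> {?\<tau>..t}")
      case True
      then have s: "?\<tau> \<le> s" by simp
      have "(\<integral>\<^sup>+\<omega>. indicator ?E \<omega> * W (y + X ?\<tau> \<omega> + (X s \<omega> - X ?\<tau> \<omega>)) \<partial>M)
        = (\<integral>\<^sup>+\<omega>. indicator ?E \<omega> * (\<integral>\<^sup>+\<omega>'. W (y + X ?\<tau> \<omega> + X (s - ?\<tau>) \<omega>') \<partial>M) \<partial>M)"
        by (rule markov_first_passage[OF h s, of "\<lambda>x z. W (y + x + z)"]) measurable
      then show ?thesis using True \<tau> by (simp add: max_absorb2)
    qed simp
  qed
  also have "\<dots> = (\<integral>\<^sup>+\<omega>. (\<integral>\<^sup>+s. indicator ?E \<omega> * (\<integral>\<^sup>+\<omega>'. W (y + X ?\<tau> \<omega> + X (max 0 (s - ?\<tau>)) \<omega>') * indicator {?\<tau>..t} s \<partial>M) \<partial>lborel) \<partial>M)"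
    by (rule L.Fubini'[symmetric]) measurable
  also have "\<dots> \<le> (\<integral>\<^sup>+\<omega>. \<kappa> * indicator ?E \<omega> \<partial>M)"
  proof (rule nn_integral_mono)
    fix \<omega> assume \<omega>[measurable]: "\<omega> \<in> space M"
    define z where "z = y + X ?\<tau> \<omega>"
    have "(\<integral>\<^sup>+s. (\<integral>\<^sup>+\<omega>'. W (z + X (max 0 (s - ?\<tau>)) \<omega>') * indicator {?\<tau>..t} s \<partial>M) \<partial>lborel)
      = (\<integral>\<^sup>+\<omega>'. (\<integral>\<^sup>+s. W (z + X (max 0 (s - ?\<tau>)) \<omega>') * indicator {?\<tau>..t} s \<partial>lborel) \<partial>M)"
      by (rule L.Fubini'[symmetric]) measurable
    also have "\<dots> \<le> (\<integral>\<^sup>+\<omega>'. (\<integral>\<^sup>+s. W (z + X (max 0 s) \<omega>') * indicator {0..t} s \<partial>lborel) \<partial>M)"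
    proof (rule nn_integral_mono)
      fix \<omega>' assume [measurable]: "\<omega>' \<in> space M"
      have [measurable]: "(\<lambda>s. X (max 0 s) \<omega>') \<in> borel_measurable borel"
        using measurable_compose[OF measurable_Pair2'[OF \<open>\<omega>' \<in> space M\<close>] X_joint_measurable] by simp
      have "(\<integral>\<^sup>+s. W (z + X (max 0 (s - ?\<tau>)) \<omega>') * indicator {?\<tau>..t} s \<partial>lborel)
        = (\<integral>\<^sup>+s. W (z + X (max 0 s) \<omega>') * indicator {?\<tau>..t} (?\<tau> + s) \<partial>lborel)"
        by (subst nn_integral_real_affine[where c = 1 and t = ?\<tau>]) auto
      also have "\<dots> \<le> (\<integral>\<^sup>+s. W (z + X (max 0 s) \<omega>') * indicator {0..t} s \<partial>lborel)"
        using \<tau> by (intro nn_integral_mono mult_left_mono) (auto simp: indicator_def)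
      finally show "(\<integral>\<^sup>+s. W (z + X (max 0 (s - ?\<tau>)) \<omega>') * indicator {?\<tau>..t} s \<partial>lborel) \<le> \<dots>" .
    qed
    also have "\<dots> \<le> \<kappa>" by (rule \<kappa>)
    finally have "(\<integral>\<^sup>+s. (\<integral>\<^sup>+\<omega>'. W (z + X (max 0 (s - ?\<tau>)) \<omega>') * indicator {?\<tau>..t} s \<partial>M) \<partial>lborel) \<le> \<kappa>" .
    then show "(\<integral>\<^sup>+s. indicator ?E \<omega> * (\<integral>\<^sup>+\<omega>'. W (y + X ?\<tau> \<omega> + X (max 0 (s - ?\<tau>)) \<omega>') * indicator {?\<tau>..t} s \<partial>M) \<partial>lborel)
       \<le> \<kappa> * indicator ?E \<omega>"
      by (cases "\<omega> \<in> ?E") (simp_all add: z_def)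
  qed
  also have "\<dots> = \<kappa> * emeasure M ?E" by (rule nn_integral_cmult_indicator) measurable
  finally show ?thesis .
qed

text \<open>Starting at distance \<open>a\<close> from the support of \<open>W\<close>, the process has to leave a ball before it
  collects any mass of \<open>W\<close>; on a grid of mesh going to 0 the exit is detected in time, except on
  a null set of times.\<close>

lemma occupation_estimate:
  fixes W :: "real ^ 'n \<Rightarrow> ennreal"
  assumes W[measurable]: "W \<in> borel_measurable borel" and t: "0 < t" and a: "0 < a"
    and far: "\<And>z. W (y + z) \<noteq> 0 \<Longrightarrow> a \<le> norm z"
    and half: "\<And>u. 0 \<le> u \<Longrightarrow> u \<le> t \<Longrightarrow> prob {\<omega> \<in> space M. a / 4 \<le> norm (X u \<omega>)} \<le> 1 / 2"
    and \<kappa>: "\<And>z. (\<integral>\<^sup>+\<omega>. (\<integral>\<^sup>+s\<in>{0..t}. W (z + X (max 0 s) \<omega>) \<partial>lborel) \<partial>M) \<le> \<kappa>"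
  shows "(\<integral>\<^sup>+\<omega>. (\<integral>\<^sup>+s\<in>{0..t}. W (y + X (max 0 s) \<omega>) \<partial>lborel) \<partial>M)
    \<le> \<kappa> * (2 * emeasure M {\<omega> \<in> space M. a / 4 \<le> norm (X t \<omega>)})"
proof -
  define h where "h m = t / real (Suc m)" for m
  have h: "0 < h m" "real (Suc m) * h m = t" for m using t by (simp_all add: h_def)
  \<comment> \<open>The threshold \<open>a / 2\<close> lies strictly below \<open>a\<close>, which
    leaves room for right-continuity, and is twice the level \<open>a / 4\<close> at which the
    maximal inequality is used.\<close>
  define B where "B m \<omega> s \<longleftrightarrow> (\<exists>i\<in>{..Suc m}. real i * h m \<le> s \<and> a / 2 \<le> norm (X (real i * h m) \<omega>))" for m \<omega> s
  have [measurable]: "X (real i * h m) \<in> borel_measurable M" for i m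
    using h(1)[of m] by simp
  define J where "J m \<omega> s = W (y + X (max 0 s) \<omega>) * indicator {0..t} s * (if B m \<omega> s then 1 else 0)" for m \<omega> s
  have J[measurable]: "(\<lambda>(\<omega>, s). J m \<omega> s) \<in> borel_measurable (M \<Otimes>\<^sub>M lborel)" for m
    unfolding J_def B_def by measurable
  have J1: "J m \<omega> \<in> borel_measurable lborel" if "\<omega> \<in> space M" for m \<omega>
    using measurable_compose[OF measurable_Pair1'[OF that] J] by simp
  have AE: "AE s in lborel. W (y + X (max 0 s) \<omega>) * indicator {0..t} s \<le> liminf (\<lambda>m. J m \<omega> s)" if \<omega>: "\<omega> \<in> space M" for \<omega>
  proof -
    \<comment> \<open>The bad times. If there were two, the exit visible at the earlier one would be
      detected on all fine grids before the later one; so there is at most one.\<close>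
    define Z where "Z = {s\<in>{0..t}. W (y + X s \<omega>) \<noteq> 0 \<and> \<not> (\<forall>\<^sub>F m in sequentially. B m \<omega> s)}"
    have no: False if "s1 \<in> Z" "s2 \<in> Z" "s1 < s2" for s1 s2
    proof -
      have "a / 2 < norm (X s1 \<omega>)" using that far[of "X s1 \<omega>"] a by (auto simp: Z_def)
      then have "\<forall>\<^sub>F m in sequentially. B m \<omega> s2"
        using grid_passage_eventually[OF \<omega>, of s1 s2 t "a / 2"] that unfolding B_def h_def Z_def Bex_def atMost_iff
        by simp
      with that show False by (simp add: Z_def)
    qed
    obtain s0 where s0: "Z \<subseteq> {s0}"
    proof (cases "Z = {}")
      case False
      then obtain s0 where "s0 \<in> Z" by blast
      with no have "Z \<subseteq> {s0}" by (metis linorder_neqE_linordered_idom singletonI subsetI)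
      then show ?thesis by (rule that)
    qed (use that in blast)
    from AE_lborel_singleton[of s0] show ?thesis
    proof eventually_elim
      fix s :: real assume "s \<noteq> s0"
      then have "s \<notin> Z" using s0 by blast
      show "W (y + X (max 0 s) \<omega>) * indicator {0..t} s \<le> liminf (\<lambda>m. J m \<omega> s)"
      proof (cases "s \<in> {0..t} \<and> W (y + X s \<omega>) \<noteq> 0")
        case True
        then have "\<forall>\<^sub>F m in sequentially. B m \<omega> s" using \<open>s \<notin> Z\<close> by (auto simp: Z_def)
        then have "\<forall>\<^sub>F m in sequentially. W (y + X (max 0 s) \<omega>) * indicator {0..t} s \<le> J m \<omega> s"
          by eventually_elim (simp add: J_def)
        then show ?thesis by (rule Liminf_bounded)
      next
        case False
        then have "W (y + X (max 0 s) \<omega>) * indicator {0..t} s = 0" by (auto simp: indicator_def)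
        then show ?thesis by (simp only: zero_le)
      qed
    qed
  qed
  have bound: "(\<integral>\<^sup>+\<omega>. (\<integral>\<^sup>+s. J m \<omega> s \<partial>lborel) \<partial>M) \<le> \<kappa> * (2 * emeasure M {\<omega> \<in> space M. a / 4 \<le> norm (X t \<omega>)})" for m
  proof -
    let ?E = "first_passage (h m) (2 * (a / 4))"
    have [measurable]: "?E i \<in> sets M" for i using h(1)[of m] by simp
    let ?K = "\<lambda>i \<omega> s. indicator (?E i) \<omega> * W (y + X (max 0 s) \<omega>) * indicator {real i * h m..t} s"
    have le: "J m \<omega> s \<le> (\<Sum>i\<le>Suc m. ?K i \<omega> s)" if \<omega>: "\<omega> \<in> space M" for \<omega> s
    proof (cases "s \<in> {0..t} \<and> B m \<omega> s")
      case True
      \<comment> \<open>Some grid time up to \<open>s\<close> is over the threshold, hence there is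
        a first passage with an index \<open>i \<le> j\<close>; this single summand already equals
        the left side.\<close>
      then obtain j where j: "j \<le> Suc m" "real j * h m \<le> s" "2 * (a / 4) \<le> norm (X (real j * h m) \<omega>)"
        by (auto simp: B_def)
      obtain i where i: "i \<le> j" "\<omega> \<in> ?E i" using first_passage_exists[OF \<omega> j(3)] by blast
      have "real i * h m \<le> s" using i(1) j(2) h(1)[of m] by (meson less_imp_le mult_right_mono of_nat_mono order_trans)
      then have "J m \<omega> s = ?K i \<omega> s" using True i(2) by (simp add: J_def)
      also have "\<dots> \<le> (\<Sum>i\<le>Suc m. ?K i \<omega> s)" using i(1) j(1) by (intro member_le_sum) auto
      finally show ?thesis .
    qed (auto simp: J_def)
    have mK: "(\<lambda>(\<omega>, s). ?K i \<omega> s) \<in> borel_measurable (M \<Otimes>\<^sub>M lborel)" for i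
      by measurable
    have mK1: "?K i \<omega> \<in> borel_measurable lborel" if "\<omega> \<in> space M" for i \<omega>
      using measurable_compose[OF measurable_Pair1'[OF that] mK] by simp
    have mK2: "(\<lambda>\<omega>. \<integral>\<^sup>+s. ?K i \<omega> s \<partial>lborel) \<in> borel_measurable M" for i
      using lborel.borel_measurable_nn_integral_fst[OF mK] by simp
    have "(\<integral>\<^sup>+\<omega>. (\<integral>\<^sup>+s. J m \<omega> s \<partial>lborel) \<partial>M) \<le> (\<integral>\<^sup>+\<omega>. (\<integral>\<^sup>+s. (\<Sum>i\<le>Suc m. ?K i \<omega> s) \<partial>lborel) \<partial>M)"
      by (intro nn_integral_mono le)
    also have "\<dots> = (\<integral>\<^sup>+\<omega>. (\<Sum>i\<le>Suc m. \<integral>\<^sup>+s. ?K i \<omega> s \<partial>lborel) \<partial>M)"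
      by (intro nn_integral_cong nn_integral_sum mK1)
    also have "\<dots> = (\<Sum>i\<le>Suc m. \<integral>\<^sup>+\<omega>. (\<integral>\<^sup>+s. ?K i \<omega> s \<partial>lborel) \<partial>M)"
      by (intro nn_integral_sum mK2)
    also have "\<dots> \<le> (\<Sum>i\<le>Suc m. \<kappa> * emeasure M (?E i))"
    proof (rule sum_mono)
      fix i assume "i \<in> {..Suc m}"
      then have "real i * h m \<le> real (Suc m) * h m" using h(1)[of m] by (intro mult_right_mono) auto
      then have "real i * h m \<le> t" using h(2) by simp
      then show "(\<integral>\<^sup>+\<omega>. (\<integral>\<^sup>+s. ?K i \<omega> s \<partial>lborel) \<partial>M) \<le> \<kappa> * emeasure M (?E i)"
        using h(1)[of m] by (intro first_passage_occupation[OF W _ _ \<kappa>]) auto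
    qed
    also have "\<dots> = \<kappa> * (\<Sum>i\<le>Suc m. emeasure M (?E i))" by (rule sum_distrib_left[symmetric])
    also have "\<dots> \<le> \<kappa> * (2 * emeasure M {\<omega> \<in> space M. a / 4 \<le> norm (X (real (Suc m) * h m) \<omega>)})"
      using h(1)[of m] half unfolding h(2) by (intro mult_left_mono grid_maximal_inequality[where n = "Suc m" and h = "h m", unfolded h(2)]) auto
    finally show ?thesis by (simp only: h(2))
  qed
  \<comment> \<open>The grids detect the exit only as \<open>m\<close> grows, so Fatou's lemma is
    applied first in the time variable and then in \<omega>.\<close>
  have "(\<integral>\<^sup>+\<omega>. (\<integral>\<^sup>+s\<in>{0..t}. W (y + X (max 0 s) \<omega>) \<partial>lborel) \<partial>M) \<le> (\<integral>\<^sup>+\<omega>. (\<integral>\<^sup>+s. liminf (\<lambda>m. J m \<omega> s) \<partial>lborel) \<partial>M)"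
    by (intro nn_integral_mono nn_integral_mono_AE AE)
  also have "\<dots> \<le> (\<integral>\<^sup>+\<omega>. liminf (\<lambda>m. \<integral>\<^sup>+s. J m \<omega> s \<partial>lborel) \<partial>M)"
    by (intro nn_integral_mono nn_integral_liminf J1)
  also have "\<dots> \<le> liminf (\<lambda>m. \<integral>\<^sup>+\<omega>. (\<integral>\<^sup>+s. J m \<omega> s \<partial>lborel) \<partial>M)"
    using lborel.borel_measurable_nn_integral_fst[OF J] by (intro nn_integral_liminf) simp
  also have "\<dots> \<le> liminf (\<lambda>m. \<kappa> * (2 * emeasure M {\<omega> \<in> space M. a / 4 \<le> norm (X t \<omega>)}))"
    by (intro Liminf_mono always_eventually allI bound)
  also have "\<dots> = \<kappa> * (2 * emeasure M {\<omega> \<in> space M. a / 4 \<le> norm (X t \<omega>)})"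
    by (simp add: Liminf_const)
  finally show ?thesis .
qed

end

section \<open>One step of the Feynman-Kac semigroup\<close>

context sym_levy
begin

lemma X_path_measurable: "\<omega> \<in> space M \<Longrightarrow> (\<lambda>s. X (max 0 s) \<omega>) \<in> borel_measurable borel"
  using measurable_compose[OF measurable_Pair2' X_joint_measurable] by simp

text \<open>The inequality \<open>exp (- j) \<ge> 1 - j\<close> avoids any integrability assumption on the potential along
  paths: if \<open>V\<close> is not integrable along a path, the Lebesgue integral in the exponent is 0.\<close>

lemma feynman_kac_weight_ge:
  fixes V :: "real ^ 'n \<Rightarrow> real" and C :: "(real ^ 'n) set"
  defines "W \<equiv> \<lambda>z. max 0 (V z) * indicator C z"
  assumes \<omega>: "\<omega> \<in> space M" and [measurable]: "V \<in> borel_measurable borel" "C \<in> sets borel"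
    and V: "\<And>z. V z \<le> \<delta> + W z" and \<delta>: "0 \<le> \<delta>" and t: "0 \<le> t" and p: "0 \<le> p" "p \<le> m"
  shows "ennreal p \<le> ennreal (exp (\<delta> * t) * (exp (- (LINT s:{0..t}|lborel. V (y + X s \<omega>))) * p))
    + ennreal m * (\<integral>\<^sup>+s\<in>{0..t}. ennreal (W (y + X (max 0 s) \<omega>)) \<partial>lborel)"
proof (cases "set_integrable lborel {0..t} (\<lambda>s. V (y + X s \<omega>))")
  case True
  note [measurable] = X_path_measurable[OF \<omega>]
  let ?w = "\<lambda>s. W (y + X (max 0 s) \<omega>)"
  have W0: "0 \<le> W z" and WV: "W z \<le> \<bar>V z\<bar>" for z by (auto simp: W_def indicator_def)
  have [measurable]: "W \<in> borel_measurable borel" unfolding W_def by measurable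
  have i: "set_integrable lborel {0..t} ?w"
    unfolding set_integrable_def
  proof (rule Bochner_Integration.integrable_bound)
    show "integrable lborel (\<lambda>s. indicator {0..t} s *\<^sub>R V (y + X s \<omega>))"
      using True by (simp add: set_integrable_def)
    show "AE s in lborel. norm (indicator {0..t} s *\<^sub>R ?w s) \<le> norm (indicator {0..t} s *\<^sub>R V (y + X s \<omega>))"
      using W0 WV by (intro AE_I2) (auto simp: indicator_def max_absorb2)
  qed measurable
  define j where "j = (LINT s:{0..t}|lborel. ?w s)"
  have j0: "0 \<le> j" unfolding j_def set_lebesgue_integral_def
    using W0 by (intro integral_nonneg_AE) (auto simp: indicator_def)
  have "(\<integral>\<^sup>+s\<in>{0..t}. ennreal (?w s) \<partial>lborel) = (\<integral>\<^sup>+s. ennreal (indicator {0..t} s *\<^sub>R ?w s) \<partial>lborel)"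
    by (intro nn_integral_cong) (auto simp: indicator_def)
  also have "\<dots> = ennreal j"
    unfolding j_def set_lebesgue_integral_def using i W0
    by (intro nn_integral_eq_integral) (auto simp: set_integrable_def indicator_def)
  finally have J: "(\<integral>\<^sup>+s\<in>{0..t}. ennreal (?w s) \<partial>lborel) = ennreal j" .
  have c: "set_integrable lborel {0..t} (\<lambda>s. \<delta>)"
    unfolding set_integrable_def by (intro integrable_scaleR_left integrable_real_indicator) (use t in auto)
  have "(LINT s:{0..t}|lborel. V (y + X s \<omega>)) \<le> (LINT s:{0..t}|lborel. \<delta> + ?w s)"
    using V by (intro set_integral_mono True set_integral_add(1)[OF c i]) (auto simp: max_absorb2)
  also have "\<dots> = \<delta> * t + j"
    using set_integral_add(2)[OF c i] t by (simp add: j_def set_lebesgue_integral_def)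
  finally have le: "(LINT s:{0..t}|lborel. V (y + X s \<omega>)) \<le> \<delta> * t + j" .
  define v where "v = (LINT s:{0..t}|lborel. V (y + X s \<omega>))"
  have "p * (1 - j) \<le> p * exp (- j)"
    using exp_ge_add_one_self[of "- j"] p by (intro mult_left_mono) auto
  then have "p - p * j \<le> p * exp (- j)" by (simp add: right_diff_distrib)
  \<comment> \<open>Replaces \<open>p\<close>, later the value of \<phi> at the end of the path, by
    its bound, so that the error is a constant times the occupation integral.\<close>
  moreover have "p * j \<le> m * j" using p j0 by (intro mult_right_mono) auto
  moreover have "p * exp (- j) \<le> p * exp (\<delta> * t - v)"
    using le p by (intro mult_left_mono) (auto simp: v_def)
  moreover have "p * exp (\<delta> * t - v) = exp (\<delta> * t) * (exp (- v) * p)"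
    by (simp add: exp_diff exp_minus divide_inverse mult_ac)
  ultimately have "p \<le> exp (\<delta> * t) * (exp (- v) * p) + m * j"
    by linarith
  then have "ennreal p \<le> ennreal (exp (\<delta> * t) * (exp (- v) * p) + m * j)" by (rule ennreal_leI)
  also have "\<dots> = ennreal (exp (\<delta> * t) * (exp (- v) * p)) + ennreal m * ennreal j"
    using p j0 by (simp add: ennreal_plus ennreal_mult)
  finally show ?thesis unfolding J v_def .
next
  case False
  then have "(LINT s:{0..t}|lborel. V (y + X s \<omega>)) = 0"
    unfolding set_lebesgue_integral_def set_integrable_def by (rule not_integrable_integral_eq)
  moreover have "p \<le> exp (\<delta> * t) * p"
    using mult_right_mono[of 1 "exp (\<delta> * t)" p] \<delta> t p by simp
  ultimately have "ennreal p \<le> ennreal (exp (\<delta> * t) * (exp (- (LINT s:{0..t}|lborel. V (y + X s \<omega>))) * p))"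
    by (intro ennreal_leI) simp
  then show ?thesis by (rule order_trans) simp
qed

text \<open>The Feynman-Kac weight is removed by \<open>feynman_kac_weight_ge\<close>, and the
  eigenvalue equation evaluates the weighted mean. What remains of the potential is the occupation
  term, to be made o(t) by \<open>occupation_estimate\<close>.\<close>

lemma eigenfunction_one_step:
  fixes V \<phi> :: "real ^ 'n \<Rightarrow> real" and C :: "(real ^ 'n) set"
  defines "W \<equiv> \<lambda>z. max 0 (V z) * indicator C z"
  assumes V[measurable]: "V \<in> borel_measurable borel" "C \<in> sets borel"
    and V\<delta>: "\<And>z. V z \<le> \<delta> + W z" and \<delta>: "0 \<le> \<delta>" and t: "0 < t"
    and \<phi>[measurable]: "\<phi> \<in> borel_measurable borel" and pos: "\<And>z. 0 < \<phi> z" and m: "\<And>z. \<phi> z \<le> m"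
    and eig: "feynman_kac M X V t \<phi> y = exp (- lam * t) * \<phi> y"
  shows "(\<integral>\<^sup>+\<omega>. ennreal (\<phi> (y + X t \<omega>)) \<partial>M) \<le> ennreal (exp ((\<bar>lam\<bar> + \<delta>) * t) * \<phi> y)
    + ennreal m * (\<integral>\<^sup>+\<omega>. (\<integral>\<^sup>+s\<in>{0..t}. ennreal (W (y + X (max 0 s) \<omega>)) \<partial>lborel) \<partial>M)"
proof -
  let ?e = "\<lambda>\<omega>. exp (- (LINT s:{0..t}|lborel. V (y + X s \<omega>))) * \<phi> (y + X t \<omega>)"
  let ?I = "\<lambda>\<omega>. \<integral>\<^sup>+s\<in>{0..t}. ennreal (W (y + X (max 0 s) \<omega>)) \<partial>lborel"
  have [measurable]: "W \<in> borel_measurable borel" unfolding W_def by measurable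
  \<comment> \<open>A non-integrable function has integral 0 by convention, which would contradict
    the positive right-hand side of the eigenvalue equation.\<close>
  have int: "integrable M ?e"
  proof (rule ccontr)
    assume "\<not> integrable M ?e"
    then have "feynman_kac M X V t \<phi> y = 0"
      unfolding feynman_kac_def by (rule not_integrable_integral_eq)
    then show False using eig pos[of y] by simp
  qed
  have I: "?I \<in> borel_measurable M"
  proof -
    have "(\<lambda>(\<omega>, s). ennreal (W (y + X (max 0 s) \<omega>)) * indicator {0..t} s) \<in> borel_measurable (M \<Otimes>\<^sub>M lborel)"
      by measurable
    then show ?thesis using lborel.borel_measurable_nn_integral_fst[of _ M] by fastforce
  qed
  have "(\<integral>\<^sup>+\<omega>. ennreal (\<phi> (y + X t \<omega>)) \<partial>M) \<le> (\<integral>\<^sup>+\<omega>. ennreal (exp (\<delta> * t) * ?e \<omega>) + ennreal m * ?I \<omega> \<partial>M)"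
    using V\<delta> \<delta> t pos m unfolding W_def
    by (intro nn_integral_mono feynman_kac_weight_ge) (auto intro: less_imp_le)
  also have "\<dots> = (\<integral>\<^sup>+\<omega>. ennreal (exp (\<delta> * t) * ?e \<omega>) \<partial>M) + ennreal m * (\<integral>\<^sup>+\<omega>. ?I \<omega> \<partial>M)"
    using I int by (subst nn_integral_add) (auto simp: nn_integral_cmult borel_measurable_integrable)
  also have "(\<integral>\<^sup>+\<omega>. ennreal (exp (\<delta> * t) * ?e \<omega>) \<partial>M) = ennreal (\<integral>\<omega>. exp (\<delta> * t) * ?e \<omega> \<partial>M)"
    using int pos by (intro nn_integral_eq_integral AE_I2 mult_nonneg_nonneg) (auto intro: less_imp_le)
  also have "(\<integral>\<omega>. exp (\<delta> * t) * ?e \<omega> \<partial>M) = exp (\<delta> * t) * (exp (- lam * t) * \<phi> y)"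
    using eig by (simp add: feynman_kac_def)
  also have "\<dots> = exp ((\<delta> - lam) * t) * \<phi> y"
    by (simp add: exp_add[symmetric] algebra_simps flip: mult.assoc)
  \<comment> \<open>The modulus makes the rate positive for either sign of the eigenvalue, as the
    geometric sum over the grid requires.\<close>
  also have "ennreal \<dots> \<le> ennreal (exp ((\<bar>lam\<bar> + \<delta>) * t) * \<phi> y)"
    using t pos[of y] by (intro ennreal_leI mult_right_mono) (auto intro: mult_right_mono)
  finally show ?thesis by (simp add: add_right_mono)
qed

text \<open>The starting point is not tested: only the positions after 1 to \<open>j\<close> steps
  must lie in \<open>D\<close>, which is why \<open>grid_stay_emeasure\<close> assumes
  \<open>x\<close> in \<open>D\<close>. The recursion matches the one-step inequality that is
  iterated in \<open>grid_iteration\<close>.\<close>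

fun grid_stay :: "(real ^ 'n) set \<Rightarrow> real \<Rightarrow> nat \<Rightarrow> real ^ 'n \<Rightarrow> ennreal" where
  "grid_stay D h 0 y = 1"
| "grid_stay D h (Suc j) y = (\<integral>\<^sup>+\<omega>. indicator D (y + X h \<omega>) * grid_stay D h j (y + X h \<omega>) \<partial>M)"

lemma grid_stay_measurable [measurable]:
  assumes [measurable]: "D \<in> sets borel" and h: "0 \<le> h"
  shows "grid_stay D h j \<in> borel_measurable borel"
proof (induct j)
  case (Suc j)
  note [measurable] = Suc X_measurable[OF h]
  show ?case by simp
qed simp

text \<open>Stated with \<open>l\<close> steps already elapsed, so that the induction can move one
  step at a time from the recursion into the event on the path, each by one use of the Markov
  property.\<close>

lemma grid_stay_eq:
  assumes D[measurable]: "D \<in> sets borel" and h: "0 \<le> h"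
  shows "(\<integral>\<^sup>+\<omega>. indicator {\<omega>. \<forall>k\<le>l. y + X (real k * h) \<omega> \<in> D} \<omega> * grid_stay D h j (y + X (real l * h) \<omega>) \<partial>M)
     = emeasure M {\<omega> \<in> space M. \<forall>k\<le>l + j. y + X (real k * h) \<omega> \<in> D}"
proof (induct j arbitrary: l)
  case 0
  have [measurable]: "X (real i * h) \<in> borel_measurable M" for i using h by simp
  have "{\<omega> \<in> space M. \<forall>k\<in>{..l}. y + X (real k * h) \<omega> \<in> D} \<in> sets M" by measurable
  then have "emeasure M {\<omega> \<in> space M. \<forall>k\<le>l. y + X (real k * h) \<omega> \<in> D}
     = (\<integral>\<^sup>+\<omega>. indicator {\<omega> \<in> space M. \<forall>k\<le>l. y + X (real k * h) \<omega> \<in> D} \<omega> \<partial>M)"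
    by (intro nn_integral_indicator[symmetric]) (simp add: Ball_def)
  also have "\<dots> = (\<integral>\<^sup>+\<omega>. indicator {\<omega>. \<forall>k\<le>l. y + X (real k * h) \<omega> \<in> D} \<omega> \<partial>M)"
    by (intro nn_integral_cong) (auto simp: indicator_def)
  finally show ?case by simp
next
  case (Suc j)
  define P where "P w \<longleftrightarrow> (\<forall>k\<in>{..l}. y + w k \<in> D)" for w :: "nat \<Rightarrow> real ^ 'n"
  have Pm: "Measurable.pred (PiM {..l} (\<lambda>_. borel)) P" unfolding P_def[abs_def] by measurable
  have P: "{\<omega>. P (\<lambda>i\<in>{..l}. X (real i * h) \<omega>)} = {\<omega>. \<forall>k\<le>l. y + X (real k * h) \<omega> \<in> D}"
    by (auto simp: P_def)
  have s: "real l * h \<le> real (Suc l) * h" "real (Suc l) * h - real l * h = h"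
    using h by (auto simp: algebra_simps)
  have gm: "(\<lambda>(x, z). indicator D (y + x + z) * grid_stay D h j (y + x + z)) \<in> borel_measurable (borel \<Otimes>\<^sub>M borel)"
  proof -
    note [measurable] = grid_stay_measurable[OF D h, of j]
    have [measurable]: "(\<lambda>z. indicator D z * grid_stay D h j z) \<in> borel_measurable borel" by measurable
    have "(\<lambda>p. (\<lambda>z. indicator D z * grid_stay D h j z) (y + fst p + snd p)) \<in> borel_measurable (borel \<Otimes>\<^sub>M borel)"
      by measurable
    then show ?thesis by (simp add: case_prod_beta')
  qed
  have "(\<integral>\<^sup>+\<omega>. indicator {\<omega>. \<forall>k\<le>l. y + X (real k * h) \<omega> \<in> D} \<omega> * grid_stay D h (Suc j) (y + X (real l * h) \<omega>) \<partial>M)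
     = (\<integral>\<^sup>+\<omega>. indicator {\<omega>. \<forall>k\<le>l. y + X (real k * h) \<omega> \<in> D} \<omega> *
          (indicator D (y + X (real l * h) \<omega> + (X (real (Suc l) * h) \<omega> - X (real l * h) \<omega>)) *
           grid_stay D h j (y + X (real l * h) \<omega> + (X (real (Suc l) * h) \<omega> - X (real l * h) \<omega>))) \<partial>M)"
    using markov_grid[OF h s(1) Pm gm] unfolding P s(2) by (simp only: grid_stay.simps)
  also have "\<dots> = (\<integral>\<^sup>+\<omega>. indicator {\<omega>. \<forall>k\<le>Suc l. y + X (real k * h) \<omega> \<in> D} \<omega> * grid_stay D h j (y + X (real (Suc l) * h) \<omega>) \<partial>M)"
    by (intro nn_integral_cong) (auto simp: indicator_def le_Suc_eq)
  also have "\<dots> = emeasure M {\<omega> \<in> space M. \<forall>k\<le>Suc l + j. y + X (real k * h) \<omega> \<in> D}" by (rule Suc)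
  finally show ?case by simp
qed

lemma grid_stay_emeasure:
  assumes D: "D \<in> sets borel" and h: "0 \<le> h" and x: "x \<in> D"
  shows "grid_stay D h j x = emeasure M {\<omega> \<in> space M. \<forall>k\<le>j. x + X (real k * h) \<omega> \<in> D}"
proof -
  have "emeasure M {\<omega> \<in> space M. \<forall>k\<le>0 + j. x + X (real k * h) \<omega> \<in> D}
     = (\<integral>\<^sup>+\<omega>. indicator {\<omega>. \<forall>k\<le>0. x + X (real k * h) \<omega> \<in> D} \<omega> * grid_stay D h j (x + X (real 0 * h) \<omega>) \<partial>M)"
    by (rule grid_stay_eq[OF D h, symmetric])
  also have "\<dots> = (\<integral>\<^sup>+\<omega>. grid_stay D h j x \<partial>M)"
    using x by (intro nn_integral_cong) (simp add: X_0)
  finally show ?thesis by (simp add: emeasure_space_1)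
qed

text \<open>Unrolling \<open>step\<close>: each further step from inside \<open>D\<close>
  contributes \<open>b\<close> once more, discounted by a factor \<open>q\<close> per step and
  weighted by the probability of having stayed in \<open>D\<close> so far.\<close>

lemma grid_iteration:
  fixes \<phi> :: "real ^ 'n \<Rightarrow> real"
  assumes D[measurable]: "D \<in> sets borel" and h: "0 \<le> h" and [measurable]: "\<phi> \<in> borel_measurable borel"
    and q: "0 \<le> q" and b: "0 \<le> b"
    and step: "\<And>y. y \<in> D \<Longrightarrow> ennreal q * ((\<integral>\<^sup>+\<omega>. indicator D (y + X h \<omega>) * ennreal (\<phi> (y + X h \<omega>)) \<partial>M) + ennreal b) \<le> ennreal (\<phi> y)"
    and y: "y \<in> D"
  shows "(\<Sum>i<j. ennreal (q ^ Suc i * b) * grid_stay D h i y) \<le> ennreal (\<phi> y)"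
  using y
proof (induct j arbitrary: y)
  case (Suc j)
  note [measurable] = grid_stay_measurable[OF D h] X_measurable[OF h]
  have "(\<Sum>i<Suc j. ennreal (q ^ Suc i * b) * grid_stay D h i y)
     = ennreal (q * b) + (\<Sum>i<j. ennreal q * (ennreal (q ^ Suc i * b) * grid_stay D h (Suc i) y))"
    unfolding sum.lessThan_Suc_shift using q b by (simp add: ennreal_mult mult_ac del: grid_stay.simps(2))
  also have "\<dots> = ennreal q * ((\<Sum>i<j. ennreal (q ^ Suc i * b) * grid_stay D h (Suc i) y) + ennreal b)"
    using q b by (simp add: ennreal_mult sum_distrib_left distrib_left add.commute del: grid_stay.simps(2))
  also have "(\<Sum>i<j. ennreal (q ^ Suc i * b) * grid_stay D h (Suc i) y)
     = (\<integral>\<^sup>+\<omega>. indicator D (y + X h \<omega>) * (\<Sum>i<j. ennreal (q ^ Suc i * b) * grid_stay D h i (y + X h \<omega>)) \<partial>M)"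
  proof -
    have "ennreal c * grid_stay D h (Suc i) y = (\<integral>\<^sup>+\<omega>. indicator D (y + X h \<omega>) * (ennreal c * grid_stay D h i (y + X h \<omega>)) \<partial>M)" for c i
      by (simp add: nn_integral_cmult[symmetric] mult.left_commute)
    moreover have "(\<lambda>\<omega>. indicator D (y + X h \<omega>) * (ennreal c * grid_stay D h i (y + X h \<omega>))) \<in> borel_measurable M" for c i
      by simp
    ultimately show ?thesis
      unfolding sum_distrib_left by (subst nn_integral_sum) simp_all
  qed
  also have "\<dots> \<le> (\<integral>\<^sup>+\<omega>. indicator D (y + X h \<omega>) * ennreal (\<phi> (y + X h \<omega>)) \<partial>M)"
    by (intro nn_integral_mono) (auto simp: indicator_def intro: Suc(1) simp del: power_Suc)
  finally have "(\<Sum>i<Suc j. ennreal (q ^ Suc i * b) * grid_stay D h i y)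
     \<le> ennreal q * ((\<integral>\<^sup>+\<omega>. indicator D (y + X h \<omega>) * ennreal (\<phi> (y + X h \<omega>)) \<partial>M) + ennreal b)"
    by (simp add: add_right_mono mult_left_mono)
  also have "\<dots> \<le> ennreal (\<phi> y)" by (rule step[OF Suc(2)])
  finally show ?case .
qed simp

end

section \<open>Lower bounds for eigenfunctions\<close>

context sym_levy
begin

text \<open>Here \<open>F\<close> is a minorant of \<phi> at distance \<open>a\<close> from
  \<open>D\<close>, regular enough for \<open>small_time_limit\<close>. One step of mesh
  \<open>h\<close> verifies the hypothesis of \<open>grid_iteration\<close> with
  \<open>q = exp (- c * h)\<close> and gain \<open>h * (\<beta> - e)\<close>; then \<open>h\<close>
  and finally \<open>e\<close> tend to 0.\<close>

lemma eigenfunction_lower_bound_test: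
  fixes V \<phi> F :: "real ^ 'n \<Rightarrow> real" and C D :: "(real ^ 'n) set"
  assumes V[measurable]: "V \<in> borel_measurable borel" and C[measurable]: "C \<in> sets borel" and D[measurable]: "D \<in> sets borel"
    and kato: "kato_class M X (\<lambda>z. max 0 (V z) * indicator C z)"
    and V\<delta>: "\<And>z. V z \<le> \<delta> + max 0 (V z) * indicator C z" and \<delta>: "0 < \<delta>"
    and \<phi>[measurable]: "\<phi> \<in> borel_measurable borel" and pos: "\<And>z. 0 < \<phi> z" and m: "\<And>z. \<phi> z \<le> m"
    and eig: "\<And>t y. 0 < t \<Longrightarrow> feynman_kac M X V t \<phi> y = exp (- lam * t) * \<phi> y"
    and a: "0 < a" "\<And>y z. y \<in> D \<Longrightarrow> z \<in> C \<Longrightarrow> a \<le> norm (z - y)"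
    and F: "uniformly_continuous_on UNIV F" "integrable lborel F" "\<And>z. 0 \<le> F z" "\<And>z. F z \<le> \<phi> z"
      "\<And>y z. y \<in> D \<Longrightarrow> F z \<noteq> 0 \<Longrightarrow> a \<le> norm (z - y)"
    and \<beta>: "\<And>y. y \<in> D \<Longrightarrow> \<beta> \<le> (\<integral>z. F (y + z) \<partial>N)"
    and T: "0 < T" and x: "x \<in> D" and P0: "0 \<le> P0"
      "\<And>n. P0 \<le> prob {\<omega> \<in> space M. \<forall>k\<le>n. x + X (real k * (T / Suc n)) \<omega> \<in> D}"
  shows "P0 * ((1 - exp (- (\<bar>lam\<bar> + \<delta>) * T)) / (\<bar>lam\<bar> + \<delta>)) * \<beta> \<le> \<phi> x"
proof -
  define c where "c = \<bar>lam\<bar> + \<delta>"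
  have c: "0 < c" using \<delta> by (simp add: c_def)
  define K where "K = P0 * ((1 - exp (- c * T)) / c)"
  have K: "0 \<le> K" using P0(1) c T by (simp add: K_def)
  have m0: "0 < m" using pos[of 0] m[of 0] by linarith
  define R where "R = tail_rate / (1 - exp (- (a / 4)\<^sup>2 / 2))"
  have R: "0 \<le> R" using tail_rate_nonneg a(1) by (simp add: R_def)
  have tail: "prob {\<omega> \<in> space M. a / 4 \<le> norm (X u \<omega>)} \<le> u * R" if "0 \<le> u" for u
    using X_tail[OF that, of "a / 4"] a(1) by (simp add: R_def)
  define h where "h n = T / real (Suc n)" for n
  have h: "0 < h n" "real (Suc n) * h n = T" for n using T by (simp_all add: h_def)
  have h0: "h \<longlonglongrightarrow> 0"
    unfolding h_def using LIMSEQ_Suc[OF lim_const_over_n[of T]] by simp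
  have hr: "filterlim h (at_right 0) sequentially"
    using h(1) h0 by (auto simp: filterlim_at intro!: always_eventually less_imp_neq[symmetric])
  let ?W = "\<lambda>z. max 0 (V z) * indicator C z"
  have [measurable]: "F \<in> borel_measurable borel" using F(2) by (simp add: borel_measurable_integrable)
  have FD: "F z = 0" if "z \<in> D" for z using F(5)[OF that, of z] a(1) by auto
  have claim: "K * (\<beta> - e) \<le> \<phi> x" if e: "0 < e" for e
  proof (cases "\<beta> - e \<le> 0")
    case True
    then have "K * (\<beta> - e) \<le> 0" using K by (rule mult_nonneg_nonpos[rotated])
    then show ?thesis using pos[of x] by linarith
  next
    case False
    define b where "b = \<beta> - e"
    have b: "0 < b" using False by (simp add: b_def)
    \<comment> \<open>Chosen so that the occupation error, at most \<open>m * r * 2 * h * R\<close>,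
      stays below \<open>h * e / 2\<close>; the other half of \<open>e\<close> is spent on the
      small-time limit. \<open>R + 1\<close> avoids division by 0.\<close>
    define r where "r = e / (4 * m * (R + 1))"
    have r: "0 < r" using e m0 R by (simp add: r_def)
    have "\<forall>\<^sub>F n in sequentially. \<forall>y\<in>D. \<bar>(\<integral>\<omega>. F (y + X (h n) \<omega>) \<partial>M) / h n - (\<integral>z. F (y + z) \<partial>N)\<bar> \<le> e / 2"
      by (rule small_time_limit[OF h(1) h0 F(1) _ F(2) a(1) F(5), of m]) (use F(3,4) m e in \<open>auto intro: order_trans\<close>)
    \<comment> \<open>Brings the tail probability at level \<open>a / 4\<close> below one half
      throughout a step, the hypothesis \<open>half\<close> of
      \<open>occupation_estimate\<close>.\<close>
    moreover have "\<forall>\<^sub>F n in sequentially. h n * R < 1 / 2"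
      using tendsto_mult_right[OF h0, of R] by (intro order_tendstoD(2)) auto
    moreover have "\<forall>\<^sub>F n in sequentially.
        (SUP z. \<integral>\<^sup>+\<omega>. (\<integral>\<^sup>+s\<in>{0..h n}. ennreal \<bar>?W (z + X s \<omega>)\<bar> \<partial>lborel) \<partial>M) < ennreal r"
    proof -
      have "((\<lambda>t. SUP z. \<integral>\<^sup>+\<omega>. (\<integral>\<^sup>+s\<in>{0..t}. ennreal \<bar>?W (z + X s \<omega>)\<bar> \<partial>lborel) \<partial>M) \<longlongrightarrow> 0) (at_right 0)"
        using kato by (simp add: kato_class_def)
      from filterlim_compose[OF this hr] show ?thesis
        by (rule order_tendstoD(2)) (use r in simp)
    qed
    ultimately have ev: "\<forall>\<^sub>F n in sequentially. exp (- c * h n) * (K * b) \<le> \<phi> x"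
    proof eventually_elim
      fix n
      assume 1: "\<forall>y\<in>D. \<bar>(\<integral>\<omega>. F (y + X (h n) \<omega>) \<partial>M) / h n - (\<integral>z. F (y + z) \<partial>N)\<bar> \<le> e / 2"
        and 2: "h n * R < 1 / 2"
        and 3: "(SUP z. \<integral>\<^sup>+\<omega>. (\<integral>\<^sup>+s\<in>{0..h n}. ennreal \<bar>?W (z + X s \<omega>)\<bar> \<partial>lborel) \<partial>M) < ennreal r"
      note [measurable] = X_measurable[OF less_imp_le[OF h(1)[of n]]]
      define q where "q = exp (- c * h n)"
      have q: "0 < q" by (simp add: q_def)
      have \<kappa>: "(\<integral>\<^sup>+\<omega>. (\<integral>\<^sup>+s\<in>{0..h n}. ennreal (?W (z + X (max 0 s) \<omega>)) \<partial>lborel) \<partial>M) \<le> ennreal r" for z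
      proof -
        have "(\<integral>\<^sup>+\<omega>. (\<integral>\<^sup>+s\<in>{0..h n}. ennreal (?W (z + X (max 0 s) \<omega>)) \<partial>lborel) \<partial>M)
           = (\<integral>\<^sup>+\<omega>. (\<integral>\<^sup>+s\<in>{0..h n}. ennreal \<bar>?W (z + X s \<omega>)\<bar> \<partial>lborel) \<partial>M)"
          by (intro nn_integral_cong) (auto simp: indicator_def max_absorb2)
        also have "\<dots> \<le> (SUP z. \<integral>\<^sup>+\<omega>. (\<integral>\<^sup>+s\<in>{0..h n}. ennreal \<bar>?W (z + X s \<omega>)\<bar> \<partial>lborel) \<partial>M)"
          by (rule SUP_upper) simp
        finally show ?thesis using 3 by simp
      qed
      have step: "ennreal q * ((\<integral>\<^sup>+\<omega>. indicator D (y + X (h n) \<omega>) * ennreal (\<phi> (y + X (h n) \<omega>)) \<partial>M) + ennreal (h n * b)) \<le> ennreal (\<phi> y)"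
        if y: "y \<in> D" for y
      proof -
        let ?S = "\<integral>\<^sup>+\<omega>. indicator D (y + X (h n) \<omega>) * ennreal (\<phi> (y + X (h n) \<omega>)) \<partial>M"
        let ?O = "\<integral>\<^sup>+\<omega>. (\<integral>\<^sup>+s\<in>{0..h n}. ennreal (?W (y + X (max 0 s) \<omega>)) \<partial>lborel) \<partial>M"
        have "?O \<le> ennreal r * (2 * emeasure M {\<omega> \<in> space M. a / 4 \<le> norm (X (h n) \<omega>)})"
        proof (rule occupation_estimate[OF _ h(1) a(1) _ _ \<kappa>])
          show "a \<le> norm z" if "ennreal (?W (y + z)) \<noteq> 0" for z
            using a(2)[OF y, of "y + z"] that by (auto simp: indicator_def split: if_splits)
          show "prob {\<omega> \<in> space M. a / 4 \<le> norm (X u \<omega>)} \<le> 1 / 2" if "0 \<le> u" "u \<le> h n" for u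
            using tail[OF that(1)] mult_right_mono[OF that(2) R] 2 by linarith
        qed measurable
        also have "\<dots> \<le> ennreal r * (2 * ennreal (h n * R))"
          using tail[of "h n"] h(1)[of n] by (intro mult_left_mono) (auto simp: emeasure_eq_measure intro!: ennreal_leI)
        finally have "ennreal m * ?O \<le> ennreal m * (ennreal r * (2 * ennreal (h n * R)))"
          by (rule mult_left_mono) simp
        also have "\<dots> = ennreal (m * (r * (2 * (h n * R))))"
          using m0 r R h(1)[of n] by (simp add: ennreal_mult)
        also have "\<dots> \<le> ennreal (h n * (e / 2))"
        proof (rule ennreal_leI)
          have "m * (r * (2 * (h n * R))) = h n * (e / 2) * (R / (R + 1))"
          proof -
            have "m * (e / (4 * m * S) * (2 * (h n * R))) = h n * (e / 2) * (R / S)" if "S \<noteq> 0" for S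
              using m0 that by (simp add: field_simps)
            then show ?thesis using R by (simp add: r_def)
          qed
          also have "\<dots> \<le> h n * (e / 2) * 1" using R h(1)[of n] e by (intro mult_left_mono) auto
          finally show "m * (r * (2 * (h n * R))) \<le> h n * (e / 2)" by simp
        qed
        finally have O: "ennreal m * ?O \<le> ennreal (h n * (e / 2))" .
        have "h n * (\<beta> - e / 2) \<le> (\<integral>\<omega>. F (y + X (h n) \<omega>) \<partial>M)"
        proof -
          have "\<beta> - e / 2 \<le> (\<integral>\<omega>. F (y + X (h n) \<omega>) \<partial>M) / h n"
            using 1[rule_format, OF y] \<beta>[OF y] by linarith
          then show ?thesis using h(1)[of n] by (simp add: field_simps)
        qed
        then have "ennreal (h n * (\<beta> - e / 2)) \<le> ennreal (\<integral>\<omega>. F (y + X (h n) \<omega>) \<partial>M)" by (rule ennreal_leI)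
        also have "\<dots> = (\<integral>\<^sup>+\<omega>. ennreal (F (y + X (h n) \<omega>)) \<partial>M)"
        proof (rule nn_integral_eq_integral[symmetric])
          have "norm (F z) \<le> m" for z using F(3,4)[of z] m[of z] by simp
          then show "integrable M (\<lambda>\<omega>. F (y + X (h n) \<omega>))"
            by (intro integrable_const_bound[of _ m]) auto
        qed (simp add: F)
        \<comment> \<open>\<open>F\<close> vanishes on \<open>D\<close> and lies below \<phi>, so
          staying in \<open>D\<close> and jumping into the support of \<open>F\<close> are disjoint
          contributions to the mean of \<phi>.\<close>
        finally have "?S + ennreal (h n * (\<beta> - e / 2)) \<le> ?S + (\<integral>\<^sup>+\<omega>. ennreal (F (y + X (h n) \<omega>)) \<partial>M)"
          by (rule add_left_mono)
        also have "\<dots> = (\<integral>\<^sup>+\<omega>. indicator D (y + X (h n) \<omega>) * ennreal (\<phi> (y + X (h n) \<omega>)) + ennreal (F (y + X (h n) \<omega>)) \<partial>M)"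
          by (rule nn_integral_add[symmetric]) measurable
        also have "\<dots> \<le> (\<integral>\<^sup>+\<omega>. ennreal (\<phi> (y + X (h n) \<omega>)) \<partial>M)"
          using FD F(4) by (intro nn_integral_mono) (auto simp: indicator_def intro: ennreal_leI)
        also have "\<dots> \<le> ennreal (exp ((\<bar>lam\<bar> + \<delta>) * h n) * \<phi> y) + ennreal m * ?O"
          using V\<delta> \<delta> pos m h(1)[of n] eig by (intro eigenfunction_one_step V C \<phi>) auto
        also have "\<dots> \<le> ennreal (exp (c * h n) * \<phi> y) + ennreal (h n * (e / 2))"
          unfolding c_def[symmetric] by (rule add_left_mono[OF O])
        also have "h n * (\<beta> - e / 2) = h n * b + h n * (e / 2)"
          by (simp add: b_def algebra_simps)
        also have "ennreal (h n * b + h n * (e / 2)) = ennreal (h n * b) + ennreal (h n * (e / 2))"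
          using h(1)[of n] b e by (intro ennreal_plus) auto
        finally have "ennreal (h n * (e / 2)) + (?S + ennreal (h n * b)) \<le> ennreal (h n * (e / 2)) + ennreal (exp (c * h n) * \<phi> y)"
          by (simp add: ac_simps)
        then have "?S + ennreal (h n * b) \<le> ennreal (exp (c * h n) * \<phi> y)"
          by (simp add: ennreal_add_left_cancel_le)
        then have "ennreal q * (?S + ennreal (h n * b)) \<le> ennreal q * ennreal (exp (c * h n) * \<phi> y)"
          by (rule mult_left_mono) simp
        also have "\<dots> = ennreal (\<phi> y)"
          using pos[of y] by (simp add: q_def ennreal_mult[symmetric] exp_minus)
        finally show ?thesis .
      qed
      have "(\<Sum>i<Suc n. ennreal (q ^ Suc i * (h n * b) * P0)) \<le> (\<Sum>i<Suc n. ennreal (q ^ Suc i * (h n * b)) * grid_stay D (h n) i x)"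
      proof (rule sum_mono)
        fix i assume i: "i \<in> {..<Suc n}"
        \<comment> \<open>The sum runs over \<open>i \<le> n\<close>, so staying in \<open>D\<close>
          matters only at grid times up to \<open>T - h\<close>; the event for \<open>n\<close> is
          contained in the one for \<open>i\<close>.\<close>
        have "P0 \<le> prob {\<omega> \<in> space M. \<forall>k\<le>n. x + X (real k * h n) \<omega> \<in> D}" using P0(2)[of n] by (simp add: h_def)
        also have "\<dots> \<le> prob {\<omega> \<in> space M. \<forall>k\<le>i. x + X (real k * h n) \<omega> \<in> D}"
        proof (rule finite_measure_mono)
          have [measurable]: "X (real k * h n) \<in> borel_measurable M" for k using h(1)[of n] by simp
          have "{\<omega> \<in> space M. \<forall>k\<in>{..i}. x + X (real k * h n) \<omega> \<in> D} \<in> sets M" by measurable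
          then show "{\<omega> \<in> space M. \<forall>k\<le>i. x + X (real k * h n) \<omega> \<in> D} \<in> sets M" by (simp add: Ball_def)
        qed (use i in auto)
        finally have "ennreal P0 \<le> grid_stay D (h n) i x"
          using h(1)[of n] by (simp add: grid_stay_emeasure[OF D _ x] emeasure_eq_measure ennreal_leI)
        then have "ennreal (q ^ Suc i * (h n * b)) * ennreal P0 \<le> ennreal (q ^ Suc i * (h n * b)) * grid_stay D (h n) i x"
          by (rule mult_left_mono) simp
        then show "ennreal (q ^ Suc i * (h n * b) * P0) \<le> ennreal (q ^ Suc i * (h n * b)) * grid_stay D (h n) i x"
          using q h(1)[of n] b P0(1) by (subst ennreal_mult) auto
      qed
      also have "\<dots> \<le> ennreal (\<phi> x)"
        using h(1)[of n] q b by (intro grid_iteration[OF D _ \<phi> _ _ step x]) auto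
      also have "(\<Sum>i<Suc n. ennreal (q ^ Suc i * (h n * b) * P0)) = ennreal (\<Sum>i<Suc n. q ^ Suc i * (h n * b) * P0)"
        using q h(1)[of n] b P0(1) by (intro sum_ennreal) auto
      finally have le: "(\<Sum>i<Suc n. q ^ Suc i * (h n * b) * P0) \<le> \<phi> x"
        using pos[of x] by (simp add: ennreal_le_iff del: sum.lessThan_Suc power_Suc)
      have q1: "q < 1" "1 - q \<le> c * h n"
        using c h(1)[of n] exp_ge_add_one_self[of "- c * h n"] by (auto simp: q_def)
      have qn: "q ^ Suc n = exp (- c * T)"
        unfolding q_def exp_of_nat_mult[symmetric] using h(2)[of n] by (simp add: mult.left_commute[of _ c] del: of_nat_Suc)
      have g: "(\<Sum>i<Suc n. q ^ i) = (1 - exp (- c * T)) / (1 - q)"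
        using q1(1) unfolding qn[symmetric] by (subst sum_gp_strict) auto
      have E: "0 \<le> 1 - exp (- c * T)" using c T by simp
      \<comment> \<open>The denominator \<open>1 - q\<close> of the geometric sum is at most
        \<open>c * h\<close>. The factor \<open>h\<close> cancels, and the integral of
        \<open>exp (- c * s)\<close> up to \<open>T\<close> is left, reduced only by the factor
        \<open>q\<close>, which tends to 1.\<close>
      have "exp (- c * h n) * (K * b) = q * (h n * b) * P0 * ((1 - exp (- c * T)) / (c * h n))"
        using h(1)[of n] c by (simp add: K_def q_def field_simps)
      also have "\<dots> \<le> q * (h n * b) * P0 * ((1 - exp (- c * T)) / (1 - q))"
        using q h(1)[of n] b P0(1) q1 E by (intro mult_left_mono divide_left_mono) auto
      also have "\<dots> = (\<Sum>i<Suc n. q ^ Suc i * (h n * b) * P0)"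
        unfolding g[symmetric] sum_distrib_left by (intro sum.cong) auto
      finally show "exp (- c * h n) * (K * b) \<le> \<phi> x" using le by linarith
    qed
    have "(\<lambda>n. exp (- c * h n) * (K * b)) \<longlonglongrightarrow> exp (- c * 0) * (K * b)"
      by (intro tendsto_intros h0)
    then have "exp (- c * 0) * (K * b) \<le> \<phi> x"
      by (rule tendsto_upperbound[OF _ ev]) simp
    then show ?thesis by (simp add: b_def)
  qed
  have "(\<lambda>n. K * (\<beta> - 1 / real (Suc n))) \<longlonglongrightarrow> K * (\<beta> - 0)"
    by (intro tendsto_intros LIMSEQ_Suc[OF lim_1_over_n])
  then have "K * (\<beta> - 0) \<le> \<phi> x"
    by (rule tendsto_upperbound) (auto intro!: always_eventually claim)
  then show ?thesis by (simp add: K_def c_def)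
qed

end

lemma uniformly_continuous_on_vanishing:
  fixes f :: "'a::euclidean_space \<Rightarrow> real"
  assumes f: "continuous_on UNIV f" and r: "\<And>z. r \<le> norm z \<Longrightarrow> f z = 0"
  shows "uniformly_continuous_on UNIV f"
  unfolding uniformly_continuous_on_def
proof (intro allI impI)
  fix e :: real assume e: "0 < e"
  have "uniformly_continuous_on (cball 0 (r + 1)) f"
    by (rule compact_uniformly_continuous[OF continuous_on_subset[OF f]]) auto
  then obtain d where d: "0 < d" "\<And>z z'. z \<in> cball 0 (r + 1) \<Longrightarrow> z' \<in> cball 0 (r + 1) \<Longrightarrow> dist z' z < d \<Longrightarrow> dist (f z') (f z) < e"
    unfolding uniformly_continuous_on_def using e by meson
  have "dist (f z') (f z) < e" if "dist z' z < min d 1" for z z'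
  proof (cases "norm z \<le> r + 1 \<and> norm z' \<le> r + 1")
    case True
    then show ?thesis using d(2)[of z z'] that by simp
  next
    case False
    then have "r \<le> norm z" "r \<le> norm z'"
      using that norm_triangle_ineq3[of z' z] by (auto simp: dist_norm)
    then show ?thesis using r e by simp
  qed
  then show "\<exists>d>0. \<forall>x\<in>UNIV. \<forall>x'\<in>UNIV. dist x' x < d \<longrightarrow> dist (f x') (f x) < e"
    using d(1) by (intro exI[of _ "min d 1"]) auto
qed

text \<open>The supports are bounded and stay away from the complement of \<open>U\<close>, as the
  test-function bound requires; being eventually 1 at each point of \<open>U\<close>, the cutoffs
  recover the integral over all of \<open>U\<close> by Fatou's lemma.\<close>

lemma cutoff_functions:
  fixes U :: "'a::euclidean_space set"
  assumes U: "open U" "U \<noteq> UNIV"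
  obtains \<eta> :: "nat \<Rightarrow> 'a \<Rightarrow> real" where
    "\<And>n. continuous_on UNIV (\<eta> n)" "\<And>n z. 0 \<le> \<eta> n z" "\<And>n z. \<eta> n z \<le> 1"
    "\<And>n z y. \<eta> n z \<noteq> 0 \<Longrightarrow> y \<notin> U \<Longrightarrow> 1 / real (Suc n) \<le> norm (z - y)"
    "\<And>n z. real (Suc n) \<le> norm z \<Longrightarrow> \<eta> n z = 0"
    "\<And>z. z \<in> U \<Longrightarrow> \<forall>\<^sub>F n in sequentially. \<eta> n z = 1"
proof
  define \<eta> where "\<eta> n z = min 1 (max 0 (real (Suc n) * infdist z (- U) - 1)) * min 1 (max 0 (real (Suc n) - norm z))" for n z
  show "continuous_on UNIV (\<eta> n)" for n
    unfolding \<eta>_def by (intro continuous_intros)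
  show "0 \<le> \<eta> n z" for n z by (simp add: \<eta>_def)
  show "\<eta> n z \<le> 1" for n z unfolding \<eta>_def by (intro mult_le_one) auto
  show "1 / real (Suc n) \<le> norm (z - y)" if "\<eta> n z \<noteq> 0" "y \<notin> U" for n z y
  proof -
    have "1 < real (Suc n) * infdist z (- U)" using that(1) by (auto simp: \<eta>_def)
    also have "\<dots> \<le> real (Suc n) * norm (z - y)"
      using infdist_le[of y "- U" z] that(2) by (intro mult_left_mono) (auto simp: dist_norm)
    finally show ?thesis by (simp add: field_simps)
  qed
  show "\<eta> n z = 0" if "real (Suc n) \<le> norm z" for n z using that by (simp add: \<eta>_def)
  show "\<forall>\<^sub>F n in sequentially. \<eta> n z = 1" if z: "z \<in> U" for z
  proof -
    have d: "0 < infdist z (- U)"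
      using U z in_closed_iff_infdist_zero[of "- U" z] infdist_nonneg[of z "- U"] by (auto simp: less_le closed_Compl)
    have "\<forall>\<^sub>F n in sequentially. max (2 / infdist z (- U)) (norm z + 1) \<le> real (Suc n)"
      using filterlim_compose[OF filterlim_real_sequentially filterlim_Suc] unfolding filterlim_at_top by blast
    then show ?thesis
    proof eventually_elim
      fix n assume "max (2 / infdist z (- U)) (norm z + 1) \<le> real (Suc n)"
      then have "2 \<le> real (Suc n) * infdist z (- U)" "1 \<le> real (Suc n) - norm z"
        using d by (simp_all add: pos_divide_le_eq)
      then show "\<eta> n z = 1" by (simp add: \<eta>_def)
    qed
  qed
qed

context sym_levy
begin

text \<open>Passes from test functions to an open set \<open>U\<close>, which only has to be
  disjoint from \<open>D\<close>. The function \<open>w\<close> bounds the jump density from below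
  for all starting points in \<open>D\<close> at once; it turns the \<beta> of the previous lemma
  into an integral of \<open>w * \<phi>\<close>.\<close>

lemma eigenfunction_lower_bound:
  fixes V \<phi> \<nu> w :: "real ^ 'n \<Rightarrow> real" and C D U :: "(real ^ 'n) set"
  assumes N_eq: "N = density lborel (\<lambda>x. ennreal (\<nu> x))" and \<nu>[measurable]: "\<nu> \<in> borel_measurable borel"
    and V[measurable]: "V \<in> borel_measurable borel" and C[measurable]: "C \<in> sets borel" and D[measurable]: "D \<in> sets borel"
    and kato: "kato_class M X (\<lambda>z. max 0 (V z) * indicator C z)"
    and V\<delta>: "\<And>z. V z \<le> \<delta> + max 0 (V z) * indicator C z" and \<delta>: "0 < \<delta>"
    and eig: "eigenfunction M X V lam \<phi>" and pos: "\<And>z. 0 < \<phi> z"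
    and a: "0 < a" "\<And>y z. y \<in> D \<Longrightarrow> z \<in> C \<Longrightarrow> a \<le> norm (z - y)"
    and U: "open U" "D \<inter> U = {}"
    and w[measurable]: "w \<in> borel_measurable borel" and w0: "\<And>z. 0 \<le> w z" and w\<nu>: "\<And>y z. y \<in> D \<Longrightarrow> z \<in> U \<Longrightarrow> w z \<le> \<nu> (z - y)"
    and T: "0 < T" and x: "x \<in> D" and P0: "0 \<le> P0"
      "\<And>n. P0 \<le> prob {\<omega> \<in> space M. \<forall>k\<le>n. x + X (real k * (T / Suc n)) \<omega> \<in> D}"
  shows "ennreal (P0 * ((1 - exp (- (\<bar>lam\<bar> + \<delta>) * T)) / (\<bar>lam\<bar> + \<delta>))) * (\<integral>\<^sup>+z\<in>U. ennreal (w z * \<phi> z) \<partial>lborel) \<le> ennreal (\<phi> x)"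
proof -
  define K where "K = P0 * ((1 - exp (- (\<bar>lam\<bar> + \<delta>) * T)) / (\<bar>lam\<bar> + \<delta>))"
  have K: "0 \<le> K"
  proof -
    have "0 \<le> 1 - exp (- c * T)" if "0 < c" for c using that T by simp
    from this[of "\<bar>lam\<bar> + \<delta>"] show ?thesis using P0(1) \<delta> unfolding K_def
      by (intro mult_nonneg_nonneg divide_nonneg_nonneg) auto
  qed
  have cont: "continuous_on UNIV \<phi>" and eig': "\<And>t y. 0 < t \<Longrightarrow> feynman_kac M X V t \<phi> y = exp (- lam * t) * \<phi> y"
    using eig by (auto simp: eigenfunction_def)
  have [measurable]: "\<phi> \<in> borel_measurable borel" using cont by (rule borel_measurable_continuous_onI)
  have [measurable]: "U \<in> sets borel" using U(1) by simp
  obtain m where m: "\<And>z. \<phi> z \<le> m"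
    using eig by (auto simp: eigenfunction_def bounded_iff) (metis abs_le_D1)
  have m0: "0 < m" using pos[of 0] m[of 0] by linarith
  have UU: "U \<noteq> UNIV" using U(2) x by auto
  obtain \<eta> :: "nat \<Rightarrow> real ^ 'n \<Rightarrow> real" where
    \<eta>: "\<And>n. continuous_on UNIV (\<eta> n)" "\<And>n z. 0 \<le> \<eta> n z" "\<And>n z. \<eta> n z \<le> 1"
      "\<And>n z y. \<eta> n z \<noteq> 0 \<Longrightarrow> y \<notin> U \<Longrightarrow> 1 / real (Suc n) \<le> norm (z - y)"
      "\<And>n z. real (Suc n) \<le> norm z \<Longrightarrow> \<eta> n z = 0"
      "\<And>z. z \<in> U \<Longrightarrow> \<forall>\<^sub>F n in sequentially. \<eta> n z = 1"
    by (rule cutoff_functions[OF U(1) UU], rule that)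
  define F where "F n z = \<phi> z * \<eta> n z" for n z
  have F0: "0 \<le> F n z" and F\<phi>: "F n z \<le> \<phi> z" for n z
    using \<eta>(2,3)[of n z] pos[of z] by (auto simp: F_def mult_left_le)
  have FU: "F n z = 0" if "z \<notin> U" for n z
    using \<eta>(4)[of n z z] that by (auto simp: F_def)
  have Fcont: "continuous_on UNIV (F n)" for n
    unfolding F_def by (intro continuous_intros cont \<eta>)
  have [measurable]: "F n \<in> borel_measurable borel" for n using Fcont by (rule borel_measurable_continuous_onI)
  have Fint: "integrable lborel (F n)" for n
  proof (rule Bochner_Integration.integrable_bound)
    show "integrable lborel (\<lambda>z :: real ^ 'n. m * indicator (cball 0 (real (Suc n))) z)"
      by (intro integrable_mult_right integrable_real_indicator) (use emeasure_lborel_cball_finite in auto)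
    have "F n z \<le> m * indicator (cball 0 (real (Suc n))) z" for z
      using F\<phi>[of n z] m[of z] \<eta>(5)[of n z] by (auto simp: indicator_def F_def)
    then show "AE z in lborel. norm (F n z) \<le> norm (m * indicator (cball 0 (real (Suc n))) z)"
      using F0 m0 by (intro AE_I2) (simp add: abs_mult)
  qed measurable
  have each: "ennreal K * (\<integral>\<^sup>+z. ennreal (w z * F n z) \<partial>lborel) \<le> ennreal (\<phi> x)" for n
  proof -
    define b where "b = min a (1 / real (Suc n))"
    have b: "0 < b" "\<And>y z. y \<in> D \<Longrightarrow> z \<in> C \<Longrightarrow> b \<le> norm (z - y)" "\<And>y z. y \<in> D \<Longrightarrow> F n z \<noteq> 0 \<Longrightarrow> b \<le> norm (z - y)"
    proof -
      show "0 < b" using a(1) by (simp add: b_def)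
      show "b \<le> norm (z - y)" if "y \<in> D" "z \<in> C" for y z using a(2)[OF that] by (simp add: b_def)
      show "b \<le> norm (z - y)" if "y \<in> D" "F n z \<noteq> 0" for y z
      proof -
        have "y \<notin> U" "\<eta> n z \<noteq> 0" using that U(2) by (auto simp: F_def)
        then show ?thesis using \<eta>(4) by (fastforce simp: b_def)
      qed
    qed
    \<comment> \<open>The support of \<open>F n\<close> keeps distance \<open>b\<close> from
      \<open>D\<close>, where a multiple of \<open>gauss_weight\<close> dominates it; hence the
      integral over \<open>N\<close> is finite, and a real number \<beta> can be extracted
      below.\<close>
    have conv: "(\<integral>\<^sup>+z. ennreal (w z * F n z) \<partial>lborel) \<le> ennreal (\<integral>z. F n (y + z) \<partial>N)" if y: "y \<in> D" for y
    proof -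
      let ?ka = "1 - exp (- b\<^sup>2 / 2)"
      have ka: "0 < ?ka" using b(1) by simp
      have i: "integrable N (\<lambda>z. F n (y + z))"
      proof (rule Bochner_Integration.integrable_bound)
        show "integrable N (\<lambda>z. m / ?ka * gauss_weight z)" using integrable_gauss_weight by (rule integrable_mult_right)
        have "F n (y + z) \<le> m / ?ka * gauss_weight z" for z
        proof (cases "F n (y + z) = 0")
          case True
          then show ?thesis using m0 ka by simp
        next
          case False
          then have "?ka \<le> gauss_weight z" using b(1) b(3)[OF y, of "y + z"] by (intro gauss_weight_ge) auto
          then have "m / ?ka * ?ka \<le> m / ?ka * gauss_weight z" using m0 ka by (intro mult_left_mono) auto
          then show ?thesis using F\<phi>[of n "y + z"] m[of "y + z"] ka by simp
        qed
        then show "AE z in N. norm (F n (y + z)) \<le> norm (m / ?ka * gauss_weight z)"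
          using F0 by (intro AE_I2) (smt (verit) real_norm_def)
      qed measurable
      have "(\<integral>\<^sup>+z. ennreal (w z * F n z) \<partial>lborel) \<le> (\<integral>\<^sup>+z. ennreal (\<nu> (z - y)) * ennreal (F n z) \<partial>lborel)"
      proof (rule nn_integral_mono)
        fix z
        show "ennreal (w z * F n z) \<le> ennreal (\<nu> (z - y)) * ennreal (F n z)"
        proof (cases "z \<in> U")
          case True
          then show ?thesis using w\<nu>[OF y True] w0[of z] F0[of n z]
            by (subst ennreal_mult'[symmetric]) (auto intro!: ennreal_leI mult_right_mono)
        qed (simp add: FU)
      qed
      also have "\<dots> = (\<integral>\<^sup>+z. ennreal (\<nu> (z - y)) * ennreal (F n z) \<partial>distr lborel borel ((+) y))"
        by (simp add: lborel_distr_plus)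
      also have "\<dots> = (\<integral>\<^sup>+z. ennreal (\<nu> z) * ennreal (F n (y + z)) \<partial>lborel)"
        by (subst nn_integral_distr) auto
      also have "\<dots> = (\<integral>\<^sup>+z. ennreal (F n (y + z)) \<partial>N)"
        unfolding N_eq by (subst nn_integral_density) auto
      also have "\<dots> = ennreal (\<integral>z. F n (y + z) \<partial>N)"
        using i F0 by (intro nn_integral_eq_integral) auto
      finally show ?thesis .
    qed
    define \<beta> where "\<beta> = enn2real (\<integral>\<^sup>+z. ennreal (w z * F n z) \<partial>lborel)"
    have fin: "(\<integral>\<^sup>+z. ennreal (w z * F n z) \<partial>lborel) < \<top>"
      using conv[OF x] by (rule order.strict_trans1) simp
    then have e\<beta>: "ennreal \<beta> = (\<integral>\<^sup>+z. ennreal (w z * F n z) \<partial>lborel)"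
      unfolding \<beta>_def by simp
    have "\<beta> \<le> (\<integral>z. F n (y + z) \<partial>N)" if "y \<in> D" for y
    proof -
      have "ennreal \<beta> \<le> ennreal (\<integral>z. F n (y + z) \<partial>N)" using conv[OF that] e\<beta> by simp
      then show ?thesis using F0 by (subst (asm) ennreal_le_iff) (auto intro: integral_nonneg_AE)
    qed
    then have "K * \<beta> \<le> \<phi> x"
      unfolding K_def
      by (intro eigenfunction_lower_bound_test[where F = "F n" and C = C and D = D and m = m and a = b and V = V]
          V C D kato V\<delta> \<delta> pos m eig' b uniformly_continuous_on_vanishing[OF Fcont, of "real (Suc n)"] Fint F0 F\<phi> T x P0)
        (auto simp: F_def \<eta>(5))
    then have "ennreal (K * \<beta>) \<le> ennreal (\<phi> x)" by (rule ennreal_leI)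
    then show ?thesis using K by (simp add: ennreal_mult' e\<beta>)
  qed
  have "(\<integral>\<^sup>+z\<in>U. ennreal (w z * \<phi> z) \<partial>lborel) \<le> (\<integral>\<^sup>+z. liminf (\<lambda>n. ennreal (w z * F n z)) \<partial>lborel)"
  proof (rule nn_integral_mono)
    fix z
    show "ennreal (w z * \<phi> z) * indicator U z \<le> liminf (\<lambda>n. ennreal (w z * F n z))"
    proof (cases "z \<in> U")
      case True
      have "\<forall>\<^sub>F n in sequentially. ennreal (w z * \<phi> z) \<le> ennreal (w z * F n z)"
        using \<eta>(6)[OF True] by eventually_elim (simp add: F_def)
      then show ?thesis using True by (simp add: Liminf_bounded)
    qed simp
  qed
  also have "\<dots> \<le> liminf (\<lambda>n. \<integral>\<^sup>+z. ennreal (w z * F n z) \<partial>lborel)"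
    by (rule nn_integral_liminf) measurable
  finally have le: "(\<integral>\<^sup>+z\<in>U. ennreal (w z * \<phi> z) \<partial>lborel) \<le> liminf (\<lambda>n. \<integral>\<^sup>+z. ennreal (w z * F n z) \<partial>lborel)" .
  \<comment> \<open>For \<open>K = 0\<close> the claim is trivial; otherwise dividing by
    \<open>K\<close> lets the bound, which is uniform in \<open>n\<close>, pass through the
    \<open>liminf\<close>.\<close>
  show ?thesis
    unfolding K_def[symmetric]
  proof (cases "K = 0")
    case False
    with K have K': "0 < K" by simp
    have "(\<integral>\<^sup>+z. ennreal (w z * F n z) \<partial>lborel) \<le> ennreal (\<phi> x / K)" for n
    proof -
      have "ennreal (1 / K) * (ennreal K * (\<integral>\<^sup>+z. ennreal (w z * F n z) \<partial>lborel)) \<le> ennreal (1 / K) * ennreal (\<phi> x)"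
        using each by (rule mult_left_mono) simp
      then show ?thesis using K' by (simp add: mult.assoc[symmetric] ennreal_mult'[symmetric])
    qed
    then have "liminf (\<lambda>n. \<integral>\<^sup>+z. ennreal (w z * F n z) \<partial>lborel) \<le> liminf (\<lambda>n. ennreal (\<phi> x / K))"
      by (intro Liminf_mono always_eventually) auto
    then have "(\<integral>\<^sup>+z\<in>U. ennreal (w z * \<phi> z) \<partial>lborel) \<le> ennreal (\<phi> x / K)"
      using le by (simp add: Liminf_const)
    then have "ennreal K * (\<integral>\<^sup>+z\<in>U. ennreal (w z * \<phi> z) \<partial>lborel) \<le> ennreal K * ennreal (\<phi> x / K)"
      by (rule mult_left_mono) simp
    also have "\<dots> = ennreal (\<phi> x)" using K' by (simp add: ennreal_mult'[symmetric])
    finally show "ennreal K * (\<integral>\<^sup>+z\<in>U. ennreal (w z * \<phi> z) \<partial>lborel) \<le> ennreal (\<phi> x)" .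
  qed simp
qed

lemma grid_event_sets:
  assumes [measurable]: "D \<in> sets borel" and "0 \<le> h"
  shows "{\<omega> \<in> space M. \<forall>k\<le>n. x + X (real k * h) \<omega> \<in> D} \<in> sets M"
proof -
  have [measurable]: "X (real k * h) \<in> borel_measurable M" for k using assms(2) by simp
  have "{\<omega> \<in> space M. \<forall>k\<in>{..n}. x + X (real k * h) \<omega> \<in> D} \<in> sets M" by measurable
  then show ?thesis by (simp add: Ball_def)
qed

text \<open>The limsup statements ask for a positive staying probability on some time interval.
  \<open>T\<close> is short enough that the tail probability at level 1/2 is at most 1/4; the factor
  2 of the maximal inequality then leaves an exit probability of at most 1/2.\<close>

lemma grid_stay_small_time:
  obtains T where "0 < T" "\<And>n x. 1 / 2 \<le> prob {\<omega> \<in> space M. \<forall>k\<le>n. x + X (real k * (T / Suc n)) \<omega> \<in> ball x 1}"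
proof
  define R where "R = tail_rate / (1 - exp (- (1 / 2)\<^sup>2 / 2))"
  have R: "0 \<le> R" using tail_rate_nonneg by (simp add: R_def)
  define T where "T = 1 / (4 * (R + 1))"
  show T: "0 < T" using R by (simp add: T_def)
  have TR: "T * R \<le> 1 / 4" using R by (simp add: T_def field_simps)
  fix n and x :: "real ^ 'n"
  define h where "h = T / real (Suc n)"
  have h: "0 \<le> h" "real n * h \<le> T" using T by (simp_all add: h_def field_simps)
  have [measurable]: "X (real k * h) \<in> borel_measurable M" for k using h by simp
  let ?E = "first_passage h (2 * (1 / 2))"
  let ?S = "{\<omega> \<in> space M. \<forall>k\<le>n. x + X (real k * h) \<omega> \<in> ball x 1}"
  have tail: "prob {\<omega> \<in> space M. 1 / 2 \<le> norm (X u \<omega>)} \<le> 1 / 4" if "0 \<le> u" "u \<le> real n * h" for u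
  proof -
    have "prob {\<omega> \<in> space M. 1 / 2 \<le> norm (X u \<omega>)} \<le> u * R"
      using X_tail[OF that(1), of "1 / 2"] by (simp add: R_def)
    also have "\<dots> \<le> T * R" using that h R by (intro mult_right_mono) auto
    finally show ?thesis using TR by simp
  qed
  have "space M - ?S \<subseteq> (\<Union>i\<le>n. ?E i)"
  proof
    fix \<omega> assume "\<omega> \<in> space M - ?S"
    then obtain k where k: "k \<le> n" "\<omega> \<in> space M" "\<not> x + X (real k * h) \<omega> \<in> ball x 1"
      by blast
    have "2 * (1 / 2) \<le> norm (X (real k * h) \<omega>)" using k(3) by (simp add: dist_norm)
    from first_passage_exists[OF k(2) this] obtain i where "i \<le> k" "\<omega> \<in> ?E i" .
    with k(1) show "\<omega> \<in> (\<Union>i\<le>n. ?E i)" by (intro UN_I[of i]) auto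
  qed
  then have "emeasure M (space M - ?S) \<le> emeasure M (\<Union>i\<le>n. ?E i)"
    using h by (intro emeasure_mono) auto
  also have "\<dots> \<le> (\<Sum>i\<le>n. emeasure M (?E i))"
    using h by (intro emeasure_subadditive_finite) auto
  also have "\<dots> \<le> 2 * emeasure M {\<omega> \<in> space M. 1 / 2 \<le> norm (X (real n * h) \<omega>)}"
    using tail by (intro grid_maximal_inequality h) (fastforce intro: order_trans)
  also have "\<dots> \<le> 2 * ennreal (1 / 4)"
    using tail[of "real n * h"] h by (intro mult_left_mono) (auto simp: emeasure_eq_measure ennreal_leI)
  also have "\<dots> = ennreal (1 / 2)"
    using ennreal_mult[of 2 "1 / 4"] by simp
  finally have "prob (space M - ?S) \<le> 1 / 2"
    unfolding emeasure_eq_measure by (subst (asm) ennreal_le_iff) auto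
  moreover have "?S \<in> sets M" using h by (intro grid_event_sets) auto
  ultimately show "1 / 2 \<le> prob {\<omega> \<in> space M. \<forall>k\<le>n. x + X (real k * (T / Suc n)) \<omega> \<in> ball x 1}"
    unfolding h_def[symmetric] by (simp add: prob_compl)
qed

text \<open>The grid times \<open>k / Suc n\<close> with \<open>k \<le> n\<close> lie before time 1,
  and being outside the ball at one of them forces the exit time to be at most 1.\<close>

lemma survival_prob_le_grid:
  "survival_prob M X (ball 0 1) 1 \<le> prob {\<omega> \<in> space M. \<forall>k\<le>n. x + X (real k * (1 / Suc n)) \<omega> \<in> ball x 1}"
proof -
  define h where "h = 1 / real (Suc n)"
  have h: "0 \<le> h" "real k * h \<le> 1" if "k \<le> n" for k using that by (simp_all add: h_def field_simps)
  let ?S = "{\<omega> \<in> space M. ereal 1 < exit_time X (ball 0 1) \<omega>}"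
  let ?G = "{\<omega> \<in> space M. \<forall>k\<le>n. x + X (real k * h) \<omega> \<in> ball x 1}"
  have G: "?G \<in> sets M" using h(1)[of 0] by (intro grid_event_sets) auto
  have sub: "?S \<subseteq> ?G"
  proof
    fix \<omega> assume \<omega>: "\<omega> \<in> ?S"
    have "x + X (real k * h) \<omega> \<in> ball x 1" if "k \<le> n" for k
    proof (rule ccontr)
      let ?t = "real k * h"
      assume "x + X ?t \<omega> \<notin> ball x 1"
      then have "X ?t \<omega> \<notin> ball 0 1" by (simp add: dist_norm)
      then have "exit_time X (ball 0 1) \<omega> \<le> ereal ?t"
        unfolding exit_time_def using h(1)[OF that] by (intro Inf_lower) auto
      also have "ereal ?t \<le> ereal 1" using h(2)[OF that] by simp
      finally have "\<not> ereal 1 < exit_time X (ball 0 1) \<omega>" by (rule leD)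
      then show False using \<omega> by blast
    qed
    then show "\<omega> \<in> ?G" using \<omega> by simp
  qed
  show ?thesis
    unfolding h_def[symmetric]
  proof (cases "?S \<in> sets (completion M)")
    case True
    have "finite_measure (completion M)"
      using prob_space_completion by (rule prob_space.finite_measure)
    then have "measure (completion M) ?S \<le> measure (completion M) ?G"
      by (rule finite_measure.finite_measure_mono[OF _ sub sets_completionI_sets[OF G]])
    also have "measure (completion M) ?G = prob ?G" by (rule measure_completion[OF G])
    finally show "survival_prob M X (ball 0 1) 1 \<le> prob ?G" unfolding survival_prob_def .
  next
    case False
    \<comment> \<open>A set outside the completed sigma-algebra has \<open>measure\<close> 0 by
      convention, so the bound holds in this case as well.\<close>
    then have "survival_prob M X (ball 0 1) 1 = 0"
      unfolding survival_prob_def by (rule measure_notin_sets)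
    then show "survival_prob M X (ball 0 1) 1 \<le> prob ?G" by (simp only: measure_nonneg)
  qed
qed

end

section \<open>Profiles and the final estimates\<close>

lemma antimono_on_positiveD:
  fixes g :: "real \<Rightarrow> real"
  shows "antimono_on {0<..} g \<Longrightarrow> 0 < s \<Longrightarrow> s \<le> t \<Longrightarrow> g t \<le> g s"
  by (auto simp: monotone_on_def)

text \<open>Only the values of \<open>g\<close> on the positive half-line are controlled; composing
  with \<open>max 1\<close> gives a function monotone on the whole line, hence Borel, that agrees
  with \<open>g\<close> from 1 on.\<close>

lemma antimono_profile_measurable:
  fixes g :: "real \<Rightarrow> real"
  assumes "antimono_on {0<..} g"
  shows "(\<lambda>s. g (max 1 s)) \<in> borel_measurable borel"
proof -
  have "mono (\<lambda>s. - g (max 1 s))"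
    using assms by (intro monoI) (auto intro: antimono_on_positiveD)
  then have "(\<lambda>s. - (- g (max 1 s))) \<in> borel_measurable borel"
    by (intro borel_measurable_uminus borel_measurable_mono)
  then show ?thesis by simp
qed

lemma shift_cond_ge_1:
  fixes g :: "real \<Rightarrow> real"
  assumes a: "shift_cond TYPE('n::finite) g C" and pos: "\<And>s. 0 < s \<Longrightarrow> 0 < g s" and anti: "antimono_on {0<..} g"
  shows "1 \<le> C"
proof -
  obtain x :: "real ^ 'n" where x: "norm x = 1" using vector_choose_size[of 1] by auto
  then have "g 1 \<le> C * g 2" using a by (auto simp: shift_cond_def dest: spec[of _ x])
  moreover have "g 2 \<le> g 1" using anti by (rule antimono_on_positiveD) auto
  ultimately have "1 * g 2 \<le> C * g 2" by simp
  then show ?thesis using pos[of 2] by (simp only: mult_le_cancel_right)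
qed

lemma shift_cond_iterate:
  fixes g :: "real \<Rightarrow> real"
  assumes a: "shift_cond TYPE('n::finite) g C" and C: "1 \<le> C" and s: "1 \<le> s"
  shows "g s \<le> C ^ k * g (s + real k)"
proof (induct k)
  case (Suc k)
  obtain x :: "real ^ 'n" where x: "norm x = s + real k" using vector_choose_size[of "s + real k"] s by auto
  have "g (s + real k) \<le> C * g (s + real k + 1)"
    using a s x by (auto simp: shift_cond_def dest: spec[of _ x])
  then have "C ^ k * g (s + real k) \<le> C ^ k * (C * g (s + real k + 1))"
    using C by (intro mult_left_mono) auto
  with Suc show ?case by (simp add: mult_ac add_ac)
qed simp

lemma not_shift_condD:
  fixes g :: "real \<Rightarrow> real"
  assumes "\<not> shift_cond TYPE('n::finite) g C"
  obtains s where "1 \<le> s" "C * g (s + 1) < g s"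
  using assms by (auto simp: shift_cond_def not_le)

text \<open>For \<open>norm x = s + 1\<close> the convolution is at least the contribution of
  \<open>y\<close> in a small ball around a point of the segment from 0 to \<open>x\<close>, where
  \<open>norm (x - y) \<le> s\<close> and \<open>norm y \<le> 2\<close>. Hence \<open>g s\<close> is
  at most a multiple of \<open>g (s + 1)\<close>.\<close>

lemma convolution_cond_imp_shift_cond:
  fixes g :: "real \<Rightarrow> real"
  assumes b: "convolution_cond TYPE('n::finite) g C" and pos: "\<And>s. 0 < s \<Longrightarrow> 0 < g s" and anti: "antimono_on {0<..} g"
  shows "\<exists>C6. shift_cond TYPE('n) g C6"
proof -
  obtain e :: "real ^ 'n" where e: "norm e = 1" using vector_choose_size[of 1] by auto
  \<comment> \<open>With centre at distance 3/2 and radius 1/4, \<open>norm y\<close> stays between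
    1 and 2, and \<open>norm (x - y)\<close> between 1 and \<open>s\<close> once
    \<open>s \<ge> 2\<close>.\<close>
  define p where "p = (3 / 2) *\<^sub>R e"
  define L where "L = measure lborel (ball p (1 / 4))"
  have fin: "emeasure lborel (ball p (1 / 4)) = ennreal L"
    using emeasure_lborel_ball_finite[of p "1 / 4"] by (simp add: L_def emeasure_eq_ennreal_measure)
  have L: "0 < L" unfolding L_def by (rule content_ball_pos) simp
  have big: "g s * g 2 * L \<le> C * g (s + 1)" if s: "2 \<le> s" for s
  proof -
    define x where "x = (s + 1) *\<^sub>R e"
    have x: "norm x = s + 1" using e s by (simp add: x_def)
    have xp: "norm (x - p) = s - 1 / 2"
    proof -
      have "x - p = ((s + 1) - 3 / 2) *\<^sub>R e" unfolding x_def p_def by (rule scaleR_diff_left[symmetric])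
      then show ?thesis using e s by simp
    qed
    have "ennreal (g s * g 2) * emeasure lborel (ball p (1 / 4)) = (\<integral>\<^sup>+y. ennreal (g s * g 2) * indicator (ball p (1 / 4)) y \<partial>lborel)"
      by (rule nn_integral_cmult_indicator[symmetric]) simp
    also have "\<dots> \<le> (\<integral>\<^sup>+y\<in>{y. 1 < norm (x - y) \<and> 1 < norm y}. ennreal (g (norm (x - y)) * g (norm y)) \<partial>lborel)"
    proof (rule nn_integral_mono)
      fix y
      show "ennreal (g s * g 2) * indicator (ball p (1 / 4)) y
        \<le> ennreal (g (norm (x - y)) * g (norm y)) * indicator {y. 1 < norm (x - y) \<and> 1 < norm y} y"
      proof (cases "y \<in> ball p (1 / 4)")
        case True
        have np: "norm p = 3 / 2" using e by (simp add: p_def)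
        have d: "norm (y - p) < 1 / 4" using True by (simp add: dist_norm norm_minus_commute)
        have xy: "x - y = (x - p) - (y - p)" and yp: "y = p + (y - p)" by simp_all
        have 1: "norm (x - y) \<le> s" "1 < norm (x - y)"
          using norm_triangle_ineq4[of "x - p" "y - p"] norm_triangle_ineq2[of "x - p" "y - p"] d xp s
          unfolding xy[symmetric] by linarith+
        have 2: "norm y \<le> 2" "1 < norm y"
          using norm_triangle_ineq[of p "y - p"] norm_triangle_ineq2[of p "p - y"] d np
          unfolding yp[symmetric] by (simp_all add: norm_minus_commute)
        have "g s * g 2 \<le> g (norm (x - y)) * g (norm y)"
          using 1 2 pos[of s] pos[of 2] less_imp_le[OF pos[OF order.strict_trans[OF zero_less_one 1(2)]]] s
          by (intro mult_mono antimono_on_positiveD[OF anti]) auto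
        then show ?thesis using True 1 2 by (simp add: ennreal_leI)
      qed simp
    qed
    also have "\<dots> \<le> ennreal (C * g (norm x))"
      by (rule b[unfolded convolution_cond_def, rule_format]) (use x s in simp)
    finally have "ennreal (g s * g 2 * L) \<le> ennreal (C * g (s + 1))"
      unfolding fin x using L by (simp add: ennreal_mult'')
    moreover have "0 < g s * g 2 * L" using pos[of s] pos[of 2] L s by simp
    ultimately show ?thesis using ennreal_le_iff2 by (metis order.strict_trans2 not_le)
  qed
  \<comment> \<open>The second entry covers \<open>1 \<le> s < 2\<close>, where monotonicity bounds
    the quotient by \<open>g 1 / g 3\<close>.\<close>
  define C6 where "C6 = max (C / (g 2 * L)) (g 1 / g 3)"
  have "g s \<le> C6 * g (s + 1)" if s: "1 \<le> s" for s
  proof (cases "2 \<le> s")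
    case True
    have "g s \<le> C / (g 2 * L) * g (s + 1)"
      using big[OF True] L pos[of 2] by (simp add: field_simps)
    also have "\<dots> \<le> C6 * g (s + 1)" using pos[of "s + 1"] s by (intro mult_right_mono) (auto simp: C6_def)
    finally show ?thesis .
  next
    case False
    have "g s \<le> g 1" using s by (intro antimono_on_positiveD[OF anti]) auto
    also have "g 1 = g 1 / g 3 * g 3" using pos[of 3] by simp
    also have "\<dots> \<le> C6 * g (s + 1)"
      using False s pos[of 1] pos[of 3] by (intro mult_mono antimono_on_positiveD[OF anti]) (auto simp: C6_def le_max_iff_disj)
    finally show ?thesis .
  qed
  then show ?thesis by (auto simp: shift_cond_def)
qed

lemma Limsup_at_infinity_eq_PInfty:
  fixes f :: "'a::real_normed_vector \<Rightarrow> real"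
  assumes "\<And>B \<rho>. \<exists>x. \<rho> \<le> norm x \<and> B < f x"
  shows "Limsup at_infinity (\<lambda>x. ereal (f x)) = \<infinity>"
proof -
  have "ereal B \<le> Limsup at_infinity (\<lambda>x. ereal (f x))" for B :: real
  proof (rule ccontr)
    assume "\<not> ereal B \<le> Limsup at_infinity (\<lambda>x. ereal (f x))"
    then have "Limsup at_infinity (\<lambda>x. ereal (f x)) < ereal B" by (simp only: not_le)
    then have "\<forall>\<^sub>F x in at_infinity. ereal (f x) < ereal B" by (rule Limsup_lessD)
    then obtain \<rho> where \<rho>: "\<And>x. \<rho> \<le> norm x \<Longrightarrow> f x < B"
      unfolding eventually_at_infinity by auto
    then show False using assms[of \<rho> B] by (meson less_asym)
  qed
  then show ?thesis by (rule ereal_top)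
qed

section \<open>Jump estimates in the setting of the theorem\<close>

locale levy_eigenfunction = sym_levy M X A N
  for M :: "'w measure" and X :: "real \<Rightarrow> 'w \<Rightarrow> real ^ 'n" and A N +
  fixes V \<phi> \<nu> :: "real ^ 'n \<Rightarrow> real" and g :: "real \<Rightarrow> real" and lam C5 :: real
  assumes N_density: "N = density lborel (\<lambda>x. ennreal (\<nu> x))"
    and \<nu>_measurable [measurable]: "\<nu> \<in> borel_measurable borel"
    and kato: "kato_decomposable M X V"
    and eigen: "eigenfunction M X V lam \<phi>"
    and \<phi>_pos: "\<And>x. 0 < \<phi> x"
    and g_pos: "\<And>s. 0 < s \<Longrightarrow> 0 < g s"
    and g_antimono: "antimono_on {0<..} g"
    and C5: "1 \<le> C5"
    and \<nu>_lower: "\<And>x. x \<noteq> 0 \<Longrightarrow> inverse C5 * g (norm x) \<le> \<nu> x"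
    and \<nu>_upper: "\<And>x. x \<noteq> 0 \<Longrightarrow> \<nu> x \<le> C5 * g (norm x)"
begin

lemmas g_le = antimono_on_positiveD[OF g_antimono]

lemma g_nonneg: "1 \<le> s \<Longrightarrow> 0 \<le> g s"
  by (intro less_imp_le g_pos) linarith

lemma \<phi>_continuous: "continuous_on UNIV \<phi>"
  using eigen by (simp add: eigenfunction_def)

lemma \<phi>_measurable [measurable]: "\<phi> \<in> borel_measurable borel"
  using \<phi>_continuous by (rule borel_measurable_continuous_onI)

lemma profile_measurable [measurable]: "(\<lambda>s. g (max 1 s)) \<in> borel_measurable borel"
  using g_antimono by (rule antimono_profile_measurable)

lemma \<phi>_integrable_on_ball:
  "integrable lborel (\<lambda>z. indicator (ball c r) z *\<^sub>R \<phi> z)"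
proof -
  have "set_integrable lborel (cball c r) \<phi>"
    unfolding set_integrable_def
    by (intro borel_integrable_compact compact_cball continuous_on_subset[OF \<phi>_continuous]) simp
  then have "set_integrable lborel (ball c r) \<phi>" by (rule set_integrable_subset) auto
  then show ?thesis by (simp add: set_integrable_def)
qed

lemma nn_integral_ball:
  assumes k: "0 \<le> k"
  shows "(\<integral>\<^sup>+z\<in>ball c r. ennreal (k * \<phi> z) \<partial>lborel) = ennreal (k * (LINT z:ball c r|lborel. \<phi> z))"
proof -
  have "(\<integral>\<^sup>+z\<in>ball c r. ennreal (k * \<phi> z) \<partial>lborel) = (\<integral>\<^sup>+z. ennreal (k * (indicator (ball c r) z *\<^sub>R \<phi> z)) \<partial>lborel)"
    by (intro nn_integral_cong) (auto simp: indicator_def)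
  also have "\<dots> = ennreal (\<integral>z. k * (indicator (ball c r) z *\<^sub>R \<phi> z) \<partial>lborel)"
    using k \<phi>_pos
    by (intro nn_integral_eq_integral integrable_mult_right \<phi>_integrable_on_ball AE_I2 mult_nonneg_nonneg)
      (auto simp: indicator_def intro: less_imp_le)
  finally show ?thesis by (simp add: set_lebesgue_integral_def)
qed

lemma integral_ball_pos:
  assumes "0 < r"
  shows "0 < (LINT z:ball c r|lborel. \<phi> z)"
proof -
  obtain b where b: "0 < b" "\<And>z. z \<in> cball c r \<Longrightarrow> b \<le> \<phi> z"
  proof -
    obtain z0 where "z0 \<in> cball c r" "\<And>z. z \<in> cball c r \<Longrightarrow> \<phi> z0 \<le> \<phi> z"
      using continuous_attains_inf[OF compact_cball _ continuous_on_subset[OF \<phi>_continuous], of c r] assms by auto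
    then show ?thesis using that[of "\<phi> z0"] \<phi>_pos by auto
  qed
  have "0 < b * measure lborel (ball c r)"
    using b(1) content_ball_pos[OF assms, of c] by simp
  also have "\<dots> = (\<integral>z. b * indicator (ball c r) z \<partial>lborel)" by simp
  also have "\<dots> \<le> (LINT z:ball c r|lborel. \<phi> z)"
    unfolding set_lebesgue_integral_def
  proof (rule integral_mono[OF _ \<phi>_integrable_on_ball])
    show "integrable lborel (\<lambda>z. b * indicator (ball c r) z)"
      by (intro integrable_mult_right integrable_real_indicator) (use emeasure_lborel_ball_finite in auto)
    show "b * indicator (ball c r) z \<le> indicator (ball c r) z *\<^sub>R \<phi> z" for z
      using b(2)[of z] by (auto simp: indicator_def)
  qed
  finally show ?thesis .
qed

text \<open>\<open>V\<close> exceeds \<delta> only within radius \<open>r - 1 / 2\<close>, whereas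
  \<open>ball x 1\<close> lies outside radius \<open>r\<close>: the gap of 1/2 between them is the
  distance \<open>a\<close> of the general estimate.\<close>

lemma lower_bound:
  assumes V: "\<And>z. r - 1 / 2 < norm z \<Longrightarrow> V z \<le> \<delta>" and \<delta>: "0 < \<delta>" and x: "r + 1 < norm x"
    and U: "open U" "ball x 1 \<inter> U = {}"
    and w: "w \<in> borel_measurable borel" "\<And>z. 0 \<le> w z"
      "\<And>y z. y \<in> ball x 1 \<Longrightarrow> z \<in> U \<Longrightarrow> w z \<le> inverse C5 * g (norm (z - y))"
    and T: "0 < T" and P0: "0 \<le> P0"
      "\<And>n. P0 \<le> prob {\<omega> \<in> space M. \<forall>k\<le>n. x + X (real k * (T / Suc n)) \<omega> \<in> ball x 1}"
  shows "ennreal (P0 * ((1 - exp (- (\<bar>lam\<bar> + \<delta>) * T)) / (\<bar>lam\<bar> + \<delta>))) * (\<integral>\<^sup>+z\<in>U. ennreal (w z * \<phi> z) \<partial>lborel) \<le> ennreal (\<phi> x)"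
proof (rule eigenfunction_lower_bound[where a = "1 / 2" and C = "cball 0 (r - 1 / 2)" and V = V and \<nu> = \<nu> and D = "ball x 1"])
  show "V \<in> borel_measurable borel" using kato by (simp add: kato_decomposable_def)
  show "kato_class M X (\<lambda>z. max 0 (V z) * indicator (cball 0 (r - 1 / 2)) z)"
    using kato by (auto simp: kato_decomposable_def kato_class_loc_def)
  show "V z \<le> \<delta> + max 0 (V z) * indicator (cball 0 (r - 1 / 2)) z" for z
    using V[of z] \<delta> by (cases "norm z \<le> r - 1 / 2") auto
  show "1 / 2 \<le> norm (z - y)" if "y \<in> ball x 1" "z \<in> cball 0 (r - 1 / 2)" for y z
  proof -
    have "norm (x - y) < 1" "norm z \<le> r - 1 / 2" using that by (auto simp: dist_norm)
    then show ?thesis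
      using x norm_triangle_ineq2[of x "x - y"] norm_triangle_ineq3[of y z] by (simp add: norm_minus_commute)
  qed
  show "w z \<le> \<nu> (z - y)" if "y \<in> ball x 1" "z \<in> U" for y z
  proof -
    have "z - y \<noteq> 0" using that U(2) by auto
    then show ?thesis using w(3)[OF that] \<nu>_lower[of "z - y"] by linarith
  qed
qed (use assms N_density \<nu>_measurable eigen \<phi>_pos in auto)

lemma lower_bound_ball:
  assumes V: "\<And>z. r - 1 / 2 < norm z \<Longrightarrow> V z \<le> \<delta>" and \<delta>: "0 < \<delta>" and x: "r + 1 < norm x"
    and disj: "ball x 1 \<inter> ball c \<rho> = {}" and s: "\<And>y z. y \<in> ball x 1 \<Longrightarrow> z \<in> ball c \<rho> \<Longrightarrow> norm (z - y) \<le> s" "0 < s"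
    and T: "0 < T" and P0: "0 \<le> P0"
      "\<And>n. P0 \<le> prob {\<omega> \<in> space M. \<forall>k\<le>n. x + X (real k * (T / Suc n)) \<omega> \<in> ball x 1}"
  shows "P0 * ((1 - exp (- (\<bar>lam\<bar> + \<delta>) * T)) / (\<bar>lam\<bar> + \<delta>)) * (inverse C5 * g s * (LINT z:ball c \<rho>|lborel. \<phi> z)) \<le> \<phi> x"
proof -
  define K where "K = P0 * ((1 - exp (- (\<bar>lam\<bar> + \<delta>) * T)) / (\<bar>lam\<bar> + \<delta>))"
  have k: "0 \<le> inverse C5 * g s" using C5 g_pos[OF s(2)] by simp
  have "ennreal K * (\<integral>\<^sup>+z\<in>ball c \<rho>. ennreal (inverse C5 * g s * \<phi> z) \<partial>lborel) \<le> ennreal (\<phi> x)"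
    unfolding K_def
  proof (rule lower_bound[OF V \<delta> x _ disj _ k _ T P0])
    show "inverse C5 * g s \<le> inverse C5 * g (norm (z - y))" if "y \<in> ball x 1" "z \<in> ball c \<rho>" for y z
    proof -
      have "z \<noteq> y" using that disj by auto
      then show ?thesis using C5 s(1)[OF that] by (intro mult_left_mono g_le) auto
    qed
  qed auto
  then have "ennreal K * ennreal (inverse C5 * g s * (LINT z:ball c \<rho>|lborel. \<phi> z)) \<le> ennreal (\<phi> x)"
    unfolding nn_integral_ball[OF k] .
  moreover have "0 \<le> (LINT z:ball c \<rho>|lborel. \<phi> z)"
    unfolding set_lebesgue_integral_def using \<phi>_pos by (intro integral_nonneg_AE) (auto simp: indicator_def intro: less_imp_le)
  then have "0 \<le> inverse C5 * g s * (LINT z:ball c \<rho>|lborel. \<phi> z)" using k by simp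
  ultimately have "ennreal (K * (inverse C5 * g s * (LINT z:ball c \<rho>|lborel. \<phi> z))) \<le> ennreal (\<phi> x)"
    by (simp add: ennreal_mult'')
  then show ?thesis using \<phi>_pos[of x] by (subst (asm) ennreal_le_iff) (auto simp: K_def)
qed

text \<open>A jump from \<open>ball x 1\<close> into \<open>ball 0 r\<close> has length at most
  \<open>norm x + r + 1\<close>; replacing this by \<open>norm x\<close> takes
  \<open>nat \<lceil>r\<rceil> + 1\<close> unit shifts, each at the cost of a factor
  \<open>C6\<close>.\<close>

lemma lower_bound_center:
  assumes V: "\<And>z. r - 1 / 2 < norm z \<Longrightarrow> V z \<le> \<delta>" and \<delta>: "0 < \<delta>" and r: "1 \<le> r" and x: "r + 1 < norm x"
    and a: "shift_cond TYPE('n) g C6"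
    and T: "0 < T" and P0: "0 \<le> P0"
      "\<And>n. P0 \<le> prob {\<omega> \<in> space M. \<forall>k\<le>n. x + X (real k * (T / Suc n)) \<omega> \<in> ball x 1}"
  shows "P0 * ((1 - exp (- (\<bar>lam\<bar> + \<delta>) * T)) / (\<bar>lam\<bar> + \<delta>)) *
    (inverse C5 * (g (norm x) / C6 ^ (nat \<lceil>r\<rceil> + 1)) * (LINT z:ball 0 r|lborel. \<phi> z)) \<le> \<phi> x"
proof -
  let ?k = "nat \<lceil>r\<rceil> + 1"
  have C6: "1 \<le> C6" using a g_pos g_antimono by (rule shift_cond_ge_1)
  have "g (norm x) \<le> C6 ^ ?k * g (norm x + real ?k)"
    using r x by (intro shift_cond_iterate[OF a C6]) auto
  also have "\<dots> \<le> C6 ^ ?k * g (norm x + r + 1)"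
  proof (intro mult_left_mono g_le)
    have "r \<le> real (nat \<lceil>r\<rceil>)" by (rule real_nat_ceiling_ge)
    then show "norm x + r + 1 \<le> norm x + real ?k" by simp
  qed (use r x C6 in auto)
  finally have "g (norm x) / C6 ^ ?k \<le> g (norm x + r + 1)"
    using C6 by (simp add: divide_le_eq mult.commute del: power_Suc power_add)
  moreover have "0 \<le> 1 - exp (- (\<bar>lam\<bar> + \<delta>) * T)"
  proof -
    have "0 \<le> 1 - exp (- c * T)" if "0 < c" for c using that T by simp
    from this[of "\<bar>lam\<bar> + \<delta>"] show ?thesis using \<delta> by simp
  qed
  ultimately have "P0 * ((1 - exp (- (\<bar>lam\<bar> + \<delta>) * T)) / (\<bar>lam\<bar> + \<delta>)) *
     (inverse C5 * (g (norm x) / C6 ^ ?k) * (LINT z:ball 0 r|lborel. \<phi> z))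
   \<le> P0 * ((1 - exp (- (\<bar>lam\<bar> + \<delta>) * T)) / (\<bar>lam\<bar> + \<delta>)) *
     (inverse C5 * g (norm x + r + 1) * (LINT z:ball 0 r|lborel. \<phi> z))"
    using P0(1) \<delta> C5 integral_ball_pos[of r 0] r
    by (intro mult_left_mono mult_right_mono mult_nonneg_nonneg divide_nonneg_nonneg) auto
  also have "\<dots> \<le> \<phi> x"
  proof (rule lower_bound_ball[OF V \<delta> x _ _ _ T P0])
    have *: "norm (x - y) < 1 \<Longrightarrow> norm z < r \<Longrightarrow> norm (z - y) \<le> norm x + r + 1 \<and> z \<noteq> y" for y z
      using norm_triangle_ineq4[of z y] norm_triangle_ineq2[of x y] norm_triangle_ineq2[of y x] x
      by (auto simp: norm_minus_commute)
    show "norm (z - y) \<le> norm x + r + 1" if "y \<in> ball x 1" "z \<in> ball 0 r" for y z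
      using *[of y z] that by (auto simp: dist_norm)
    show "ball x 1 \<inter> ball 0 r = {}"
    proof -
      have False if "y \<in> ball x 1" "y \<in> ball 0 r" for y using *[of y y] that by (auto simp: dist_norm)
      then show ?thesis by blast
    qed
  qed (use r x in auto)
  finally show ?thesis .
qed

end

context levy_eigenfunction
begin

text \<open>The case \<open>T = 1\<close> of \<open>lower_bound_center\<close>. One
  \<open>C5\<close> comes from bounding the jump density below by \<open>g\<close>, the second from
  bounding \<open>\<nu> x\<close> above by \<open>C5 * g (norm x)\<close>.\<close>

lemma lower_bound_survival:
  assumes V: "\<And>z. r - 1 / 2 < norm z \<Longrightarrow> V z \<le> \<delta>" and \<delta>: "0 < \<delta>" and r: "1 \<le> r" and x: "r + 1 < norm x"
    and a: "shift_cond TYPE('n) g C6"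
  shows "(1 - exp (- (\<bar>lam\<bar> + \<delta>))) / (C5\<^sup>2 * C6 ^ (nat \<lceil>r\<rceil> + 1) * (\<bar>lam\<bar> + \<delta>))
     * survival_prob M X (ball 0 1) 1 * (LINT z:ball 0 r|lborel. \<phi> z) * \<nu> x \<le> \<phi> x"
proof -
  define p I c k where "p = survival_prob M X (ball 0 1) 1" and "I = (LINT z:ball 0 r|lborel. \<phi> z)"
    and "c = \<bar>lam\<bar> + \<delta>" and "k = C6 ^ (nat \<lceil>r\<rceil> + 1)"
  have c: "0 < c" using \<delta> by (simp add: c_def)
  have k: "0 < k" using shift_cond_ge_1[OF a g_pos g_antimono] by (simp add: k_def)
  have p: "0 \<le> p" by (simp add: p_def survival_prob_def)
  have I: "0 < I" unfolding I_def using r by (intro integral_ball_pos) simp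
  have E: "0 \<le> 1 - exp (- c)" using c by simp
  have "(1 - exp (- c)) / (C5\<^sup>2 * k * c) * p * I * \<nu> x \<le> (1 - exp (- c)) / (C5\<^sup>2 * k * c) * p * I * (C5 * g (norm x))"
    using c k p I E C5 x r by (intro mult_left_mono \<nu>_upper) auto
  also have "\<dots> = p * ((1 - exp (- c * 1)) / c) * (inverse C5 * (g (norm x) / k) * I)"
    using C5 by (simp add: power2_eq_square divide_inverse)
  also have "\<dots> \<le> \<phi> x"
    unfolding p_def I_def c_def k_def
    by (rule lower_bound_center[OF V \<delta> r x a _ _ survival_prob_le_grid]) (auto simp: survival_prob_def)
  finally show ?thesis unfolding p_def I_def c_def k_def .
qed

text \<open>With \<open>norm x = s + 1\<close> and the target shifted towards \<open>x\<close>, all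
  jumps have length at most \<open>s\<close>. So \<open>\<phi> x\<close> is at least a multiple of
  \<open>g s\<close>, while \<open>\<nu> x\<close> is at most a multiple of
  \<open>g (s + 1)\<close>, and failure of the shift condition makes the quotient unbounded.\<close>

lemma limsup_without_shift_cond:
  assumes V0: "(V \<longlongrightarrow> 0) at_infinity" and na: "\<nexists>C6. shift_cond TYPE('n) g C6"
  shows "Limsup at_infinity (\<lambda>x. ereal (\<phi> x / \<nu> x)) = \<infinity>"
proof (rule Limsup_at_infinity_eq_PInfty)
  fix B \<rho> :: real
  obtain T where T: "0 < T" "\<And>n x. 1 / 2 \<le> prob {\<omega> \<in> space M. \<forall>k\<le>n. x + X (real k * (T / Suc n)) \<omega> \<in> ball x 1}"
    by (rule grid_stay_small_time) (rule that)
  have "\<forall>\<^sub>F z in at_infinity. V z < 1" using V0 by (rule order_tendstoD(2)) simp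
  then obtain r0 where r0: "\<And>z. r0 \<le> norm z \<Longrightarrow> V z < 1"
    unfolding eventually_at_infinity by blast
  \<comment> \<open>At least 5, so that \<open>s > 6\<close> below keeps \<open>ball x 1\<close> and
    \<open>ball p 1\<close> apart and makes \<open>s - 3\<close> positive.\<close>
  define r where "r = max 5 (r0 + 1 / 2)"
  have r: "5 \<le> r" "\<And>z. r - 1 / 2 < norm z \<Longrightarrow> V z \<le> 1"
    using r0 by (auto simp: r_def intro: less_imp_le)
  obtain e :: "real ^ 'n" where e: "norm e = 1" using vector_choose_size[of 1] by auto
  \<comment> \<open>A shift by 4 outweighs the two unit radii together with the excess 1 of
    \<open>norm x\<close> over \<open>s\<close>.\<close>
  define p where "p = 4 *\<^sub>R e"
  define I where "I = (LINT z:ball p 1|lborel. \<phi> z)"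
  have I: "0 < I" unfolding I_def by (rule integral_ball_pos) simp
  define K where "K = 1 / 2 * ((1 - exp (- (\<bar>lam\<bar> + 1) * T)) / (\<bar>lam\<bar> + 1)) * (inverse C5 * inverse C5 * I)"
  have "0 < 1 - exp (- c * T)" if "0 < c" for c using that T(1) by simp
  from this[of "\<bar>lam\<bar> + 1"] have K: "0 < K" using I C5 by (simp add: K_def)
  define \<rho>' where "\<rho>' = max (max \<rho> (r + 1)) 1"
  have "1 \<le> \<rho>'" by (simp add: \<rho>'_def)
  then have g\<rho>: "0 < g (\<rho>' + 1)" by (intro g_pos) linarith
  have g1: "0 < g 1" by (rule g_pos) simp
  \<comment> \<open>The first entry produces the factor \<open>B\<close>; the second forces every
    counterexample \<open>s\<close> to the shift condition beyond \<open>\<rho>'\<close>, since up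
    to there monotonicity bounds the quotient.\<close>
  define C where "C = max (B / K) (g 1 / g (\<rho>' + 1))"
  have "\<not> shift_cond TYPE('n) g C" using na by blast
  then obtain s where s: "1 \<le> s" "C * g (s + 1) < g s" by (rule not_shift_condD)
  have s\<rho>: "\<rho>' < s"
  proof (rule ccontr)
    assume n: "\<not> \<rho>' < s"
    have "g s \<le> g 1" using s(1) by (intro g_le) auto
    also have "\<dots> = g 1 / g (\<rho>' + 1) * g (\<rho>' + 1)" using g\<rho> by simp
    also have "\<dots> \<le> C * g (s + 1)"
    proof (rule mult_mono)
      show "g (\<rho>' + 1) \<le> g (s + 1)" using n s by (intro g_le) auto
      show "0 \<le> C" "0 \<le> g (\<rho>' + 1)" using g1 g\<rho> by (auto simp: C_def le_max_iff_disj)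
    qed (simp add: C_def)
    finally show False using s(2) by simp
  qed
  define x where "x = (s + 1) *\<^sub>R e"
  have x: "norm x = s + 1" using e s by (simp add: x_def)
  have xp: "norm (x - p) = s - 3"
  proof -
    have "x - p = ((s + 1) - 4) *\<^sub>R e" unfolding x_def p_def by (rule scaleR_diff_left[symmetric])
    then show ?thesis using e s\<rho> r(1) by (simp add: \<rho>'_def)
  qed
  have far: "norm (z - y) \<le> s \<and> z \<noteq> y" if "y \<in> ball x 1" "z \<in> ball p 1" for y z
  proof -
    have yz: "norm (x - y) < 1" "norm (z - p) < 1"
      using that by (auto simp: dist_norm norm_minus_commute)
    have eq: "z - y = ((z - p) + (x - y)) - (x - p)" by simp
    have "norm (z - y) \<le> norm (z - p) + norm (x - y) + norm (x - p)"
      unfolding eq using norm_triangle_ineq4[of "(z - p) + (x - y)" "x - p"] norm_triangle_ineq[of "z - p" "x - y"] by linarith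
    moreover have "norm (x - p) - (norm (z - p) + norm (x - y)) \<le> norm (z - y)"
      unfolding eq using norm_triangle_ineq3[of "(z - p) + (x - y)" "x - p"] norm_triangle_ineq[of "z - p" "x - y"] by linarith
    ultimately show ?thesis using yz xp s\<rho> r(1) by (auto simp: \<rho>'_def)
  qed
  have disj: "ball x 1 \<inter> ball p 1 = {}" using far by blast
  have "1 / 2 * ((1 - exp (- (\<bar>lam\<bar> + 1) * T)) / (\<bar>lam\<bar> + 1)) * (inverse C5 * g s * I) \<le> \<phi> x"
    unfolding I_def
    by (rule lower_bound_ball[OF r(2) _ _ disj _ _ T(1) _ T(2)]) (use far x s\<rho> s in \<open>auto simp: \<rho>'_def\<close>)
  also have "inverse C5 * g s * I = inverse C5 * inverse C5 * I * (C5 * g s)" using C5 by (simp add: field_simps)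
  finally have lb: "K * (C5 * g s) \<le> \<phi> x" unfolding K_def by (simp only: mult.assoc)
  have gs: "0 < g (s + 1)" using s by (intro g_pos) simp
  have x0: "x \<noteq> 0" using x s by auto
  have \<nu>x: "0 < \<nu> x" "\<nu> x \<le> C5 * g (s + 1)"
  proof -
    have "0 < inverse C5 * g (norm x)" using C5 x s gs by simp
    then show "0 < \<nu> x" using \<nu>_lower[OF x0] by linarith
    show "\<nu> x \<le> C5 * g (s + 1)" using \<nu>_upper[OF x0] x by simp
  qed
  have "0 \<le> C" using g1 g\<rho> by (auto simp: C_def le_max_iff_disj)
  have "B * \<nu> x \<le> K * C * \<nu> x"
  proof (rule mult_right_mono)
    have "B / K \<le> C" by (simp add: C_def)
    then show "B \<le> K * C" using K by (simp add: pos_divide_le_eq mult.commute)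
  qed (use \<nu>x in simp)
  also have "\<dots> \<le> K * C * (C5 * g (s + 1))" using \<nu>x(2) K \<open>0 \<le> C\<close> by (intro mult_left_mono) auto
  also have "\<dots> = K * C5 * (C * g (s + 1))" by simp
  also have "\<dots> < K * C5 * g s" using s(2) K C5 by (intro mult_strict_left_mono) auto
  also have "\<dots> \<le> \<phi> x" using lb by (simp add: mult.assoc)
  finally have "B < \<phi> x / \<nu> x" using \<nu>x(1) by (simp add: pos_less_divide_eq)
  moreover have "\<rho> \<le> norm x" using x s\<rho> by (simp add: \<rho>'_def)
  ultimately show "\<exists>x. \<rho> \<le> norm x \<and> B < \<phi> x / \<nu> x" by blast
qed

text \<open>Outside the unit ball \<open>min 1 ((norm y)\<^sup>2)\<close> is 1, so the integrability
  condition on the Levy measure applies to the profile itself.\<close>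

lemma profile_integrable:
  "(\<integral>\<^sup>+y\<in>{y. 1 < norm y}. ennreal (g (norm y)) \<partial>(lborel :: (real ^ 'n) measure)) < \<infinity>"
proof -
  have "(\<integral>\<^sup>+y\<in>{y. 1 < norm y}. ennreal (g (norm y)) \<partial>(lborel :: (real ^ 'n) measure))
     \<le> (\<integral>\<^sup>+y. ennreal C5 * (ennreal (\<nu> y) * ennreal (min 1 ((norm y)\<^sup>2))) \<partial>lborel)"
  proof (rule nn_integral_mono)
    fix y :: "real ^ 'n"
    show "ennreal (g (norm y)) * indicator {y. 1 < norm y} y \<le> ennreal C5 * (ennreal (\<nu> y) * ennreal (min 1 ((norm y)\<^sup>2)))"
    proof (cases "1 < norm y")
      case True
      then have y0: "y \<noteq> 0" by auto
      have "g (norm y) = C5 * (inverse C5 * g (norm y))" using C5 by (simp add: mult.assoc[symmetric])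
      also have "\<dots> \<le> C5 * \<nu> y" using \<nu>_lower[OF y0] C5 by (intro mult_left_mono) auto
      finally have "g (norm y) \<le> C5 * \<nu> y" .
      moreover have "min 1 ((norm y)\<^sup>2) = 1" using True by (simp add: min_def one_le_power)
      ultimately show ?thesis using True C5 by (simp add: ennreal_mult'[symmetric] ennreal_leI)
    qed simp
  qed
  also have "\<dots> = ennreal C5 * (\<integral>\<^sup>+y. ennreal (min 1 ((norm y)\<^sup>2)) \<partial>N)"
    unfolding N_density by (subst nn_integral_density) (auto simp: nn_integral_cmult)
  also have "\<dots> < \<infinity>"
    using process by (auto simp: symmetric_levy_process_def levy_measure_def ennreal_mult_less_top)
  finally show ?thesis .
qed

text \<open>The jump estimate is used twice: jumping to the centre shows that \<phi> is at least
  \<open>K1 * g\<close> outside the unit ball, and inserting this minorant for jumps from near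
  \<open>x\<close> produces the convolution. So \<open>\<phi> x\<close> dominates a multiple of
  \<open>conv x\<close>, which no multiple of \<open>g (norm x)\<close> bounds.\<close>

lemma limsup_without_convolution_cond:
  assumes V0: "(V \<longlongrightarrow> 0) at_infinity" and a: "shift_cond TYPE('n) g C6"
    and nb: "\<nexists>C7. convolution_cond TYPE('n) g C7"
  shows "Limsup at_infinity (\<lambda>x. ereal (\<phi> x / \<nu> x)) = \<infinity>"
proof (rule Limsup_at_infinity_eq_PInfty)
  fix B \<rho> :: real
  have C6: "1 \<le> C6" using a g_pos g_antimono by (rule shift_cond_ge_1)
  obtain T where T: "0 < T" "\<And>n x. 1 / 2 \<le> prob {\<omega> \<in> space M. \<forall>k\<le>n. x + X (real k * (T / Suc n)) \<omega> \<in> ball x 1}"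
    by (rule grid_stay_small_time) (rule that)
  have "\<forall>\<^sub>F z in at_infinity. V z < 1" using V0 by (rule order_tendstoD(2)) simp
  then obtain r0 where r0: "\<And>z. r0 \<le> norm z \<Longrightarrow> V z < 1"
    unfolding eventually_at_infinity by blast
  define r where "r = max 1 (r0 + 1 / 2)"
  have r: "1 \<le> r" "\<And>z. r - 1 / 2 < norm z \<Longrightarrow> V z \<le> 1"
    using r0 by (auto simp: r_def intro: less_imp_le)
  define K0 where "K0 = 1 / 2 * ((1 - exp (- (\<bar>lam\<bar> + 1) * T)) / (\<bar>lam\<bar> + 1))"
  have "0 < 1 - exp (- c * T)" if "0 < c" for c using that T(1) by simp
  from this[of "\<bar>lam\<bar> + 1"] have K0: "0 < K0" by (simp add: K0_def)
  define k where "k = C6 ^ (nat \<lceil>r\<rceil> + 1)"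
  have k: "0 < k" using C6 by (simp add: k_def)
  define I where "I = (LINT z:ball 0 r|lborel. \<phi> z)"
  have I: "0 < I" unfolding I_def using r by (intro integral_ball_pos) simp
  \<comment> \<open>In the compact ball not covered by the jump estimate, the minimum of the
    positive continuous function \<phi> takes over.\<close>
  obtain b where b: "0 < b" "\<And>z. z \<in> cball 0 (r + 1) \<Longrightarrow> b \<le> \<phi> z"
  proof -
    obtain z0 where "z0 \<in> cball 0 (r + 1)" "\<And>z. z \<in> cball 0 (r + 1) \<Longrightarrow> \<phi> z0 \<le> \<phi> z"
      using continuous_attains_inf[OF compact_cball _ continuous_on_subset[OF \<phi>_continuous], of 0 "r + 1"] r by auto
    then show ?thesis using that[of "\<phi> z0"] \<phi>_pos by auto
  qed
  have g1: "0 < g 1" by (rule g_pos) simp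
  define K1 where "K1 = min (K0 * (inverse C5 * inverse k * I)) (b / g 1)"
  have K1: "0 < K1" using K0 k I b C5 g1 by (simp add: K1_def)
  have \<phi>_ge: "K1 * g (norm z) \<le> \<phi> z" if z: "1 < norm z" for z
  proof (cases "r + 1 < norm z")
    case True
    have gz: "0 \<le> g (norm z)" using z by (intro g_nonneg) linarith
    have "K1 * g (norm z) \<le> K0 * (inverse C5 * inverse k * I) * g (norm z)"
      using gz by (intro mult_right_mono) (auto simp: K1_def)
    also have "\<dots> = K0 * (inverse C5 * (g (norm z) / k) * I)" by (simp add: divide_inverse)
    also have "\<dots> \<le> \<phi> z"
      unfolding K0_def k_def I_def
      by (rule lower_bound_center[OF r(2) _ r(1) True a T(1) _ T(2)]) auto
    finally show ?thesis .
  next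
    case False
    have "K1 * g (norm z) \<le> b / g 1 * g 1"
    proof (rule mult_mono)
      show "g (norm z) \<le> g 1" using z by (intro g_le) auto
      show "0 \<le> g (norm z)" using z by (intro g_nonneg) linarith
    qed (use b g1 in \<open>auto simp: K1_def\<close>)
    also have "\<dots> \<le> \<phi> z" using g1 b(2)[of z] False by simp
    finally show ?thesis .
  qed
  define conv where "conv x = (\<integral>\<^sup>+y\<in>{y. 1 < norm (x - y) \<and> 1 < norm y}. ennreal (g (norm (x - y)) * g (norm y)) \<partial>lborel)" for x :: "real ^ 'n"
  define G where "G = (\<integral>\<^sup>+y\<in>{y. 1 < norm y}. ennreal (g (norm y)) \<partial>(lborel :: (real ^ 'n) measure))"
  obtain G' where G': "G = ennreal G'" "0 \<le> G'"
    using profile_integrable unfolding G_def[symmetric] by (cases G) auto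
  have g'm: "(\<lambda>y. ennreal (g (max 1 (norm y)))) \<in> borel_measurable (borel :: (real ^ 'n) measure)"
    using measurable_compose[OF borel_measurable_norm profile_measurable] by simp
  \<comment> \<open>The convolution is bounded, so with a large \<open>C\<close> it can exceed
    \<open>C * g (norm x)\<close> only far from the origin.\<close>
  have conv_le: "conv x \<le> ennreal (g 1 * G')" for x
  proof -
    have "conv x \<le> (\<integral>\<^sup>+y. ennreal (g 1) * (ennreal (g (max 1 (norm y))) * indicator {y. 1 < norm y} y) \<partial>(lborel :: (real ^ 'n) measure))"
      unfolding conv_def
    proof (rule nn_integral_mono)
      fix y
      show "ennreal (g (norm (x - y)) * g (norm y)) * indicator {y. 1 < norm (x - y) \<and> 1 < norm y} y
         \<le> ennreal (g 1) * (ennreal (g (max 1 (norm y))) * indicator {y. 1 < norm y} y)"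
      proof (cases "1 < norm (x - y) \<and> 1 < norm y")
        case True
        then have "g (norm (x - y)) * g (norm y) \<le> g 1 * g (norm y)"
          by (intro mult_right_mono g_le g_nonneg) auto
        then show ?thesis using True g1 by (simp add: ennreal_mult'[symmetric] ennreal_leI)
      qed auto
    qed
    also have "\<dots> = ennreal (g 1) * (\<integral>\<^sup>+y. ennreal (g (max 1 (norm y))) * indicator {y. 1 < norm y} y \<partial>(lborel :: (real ^ 'n) measure))"
      by (rule nn_integral_cmult) (use g'm in measurable)
    also have "(\<integral>\<^sup>+y. ennreal (g (max 1 (norm y))) * indicator {y. 1 < norm y} y \<partial>(lborel :: (real ^ 'n) measure)) = G"
      unfolding G_def by (intro nn_integral_cong) (auto simp: indicator_def)
    finally show ?thesis using G' g1 by (simp add: ennreal_mult')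
  qed
  define K2 where "K2 = K0 * (inverse C5 * inverse C6 * K1)"
  have K2: "0 < K2" using K0 K1 C5 C6 by (simp add: K2_def)
  have \<phi>_conv: "ennreal K2 * conv x \<le> ennreal (\<phi> x)" if x: "r + 1 < norm x" for x
  proof -
    let ?U = "{y. 1 < norm (x - y) \<and> 1 < norm y}"
    \<comment> \<open>Every \<open>y\<close> in \<open>ball x 1\<close> satisfies
      \<open>norm (z - y) \<le> norm (z - x) + 1\<close>, which gives a bound free of
      \<open>y\<close>; the shift condition later removes the added 1 at the cost of
      \<open>C6\<close>. The \<open>max 1\<close> is there for measurability.\<close>
    let ?w = "\<lambda>z. inverse C5 * g (max 1 (norm (z - x) + 1))"
    have U: "open ?U"
      by (intro open_Collect_conj open_Collect_less continuous_intros)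
    have "ennreal K0 * (\<integral>\<^sup>+z\<in>?U. ennreal (?w z * \<phi> z) \<partial>lborel) \<le> ennreal (\<phi> x)"
      unfolding K0_def
    proof (rule lower_bound[OF r(2) _ x U _ _ _ _ T(1) _ T(2)])
      show "ball x 1 \<inter> ?U = {}" by (auto simp: dist_norm)
      show "?w \<in> borel_measurable borel"
        using measurable_compose[OF _ profile_measurable, of "\<lambda>z. norm (z - x) + 1" borel] by measurable
      show "0 \<le> ?w z" for z using C5 by (intro mult_nonneg_nonneg g_nonneg) auto
      show "?w z \<le> inverse C5 * g (norm (z - y))" if y: "y \<in> ball x 1" "z \<in> ?U" for y z
      proof -
        have "norm (z - y) \<le> norm (z - x) + norm (x - y)" using norm_triangle_ineq[of "z - x" "x - y"] by simp
        moreover have "norm (x - y) < 1" "z \<noteq> y" using y by (auto simp: dist_norm)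
        ultimately show ?thesis using C5 by (intro mult_left_mono g_le) auto
      qed
    qed auto
    moreover have "ennreal (inverse C5 * inverse C6 * K1) * conv x \<le> (\<integral>\<^sup>+z\<in>?U. ennreal (?w z * \<phi> z) \<partial>lborel)"
    proof -
      let ?f = "\<lambda>y. ennreal (g (max 1 (norm (x - y))) * g (max 1 (norm y))) * indicator ?U y"
      have fm: "?f \<in> borel_measurable lborel"
      proof -
        have [measurable]: "(\<lambda>y. g (max 1 (norm (x - y)))) \<in> borel_measurable borel" "(\<lambda>y :: real ^ 'n. g (max 1 (norm y))) \<in> borel_measurable borel"
          using measurable_compose[OF _ profile_measurable, of "\<lambda>y. norm (x - y)" borel]
            measurable_compose[OF _ profile_measurable, of "\<lambda>y :: real ^ 'n. norm y" borel] by auto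
        have "?U \<in> sets borel" using U by simp
        then show ?thesis by measurable
      qed
      have "conv x = (\<integral>\<^sup>+y. ?f y \<partial>lborel)"
        unfolding conv_def by (intro nn_integral_cong) (auto simp: indicator_def)
      then have "ennreal (inverse C5 * inverse C6 * K1) * conv x = (\<integral>\<^sup>+y. ennreal (inverse C5 * inverse C6 * K1) * ?f y \<partial>lborel)"
        using nn_integral_cmult[OF fm] by simp
      also have "\<dots> \<le> (\<integral>\<^sup>+z\<in>?U. ennreal (?w z * \<phi> z) \<partial>lborel)"
      proof (rule nn_integral_mono)
        fix y
        show "ennreal (inverse C5 * inverse C6 * K1) * ?f y \<le> ennreal (?w y * \<phi> y) * indicator ?U y"
        proof (cases "y \<in> ?U")
          case True
          then have y: "1 < norm (x - y)" "1 < norm y" by auto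
          have "g (norm (x - y)) \<le> C6 * g (norm (x - y) + 1)"
            using a y by (auto simp: shift_cond_def)
          then have 1: "inverse C6 * g (norm (x - y)) \<le> g (norm (x - y) + 1)"
            using C6 by (simp add: field_simps)
          have "inverse C5 * ((inverse C6 * g (norm (x - y))) * (K1 * g (norm y))) \<le> inverse C5 * (g (norm (x - y) + 1) * \<phi> y)"
            using C5 C6 K1 1 \<phi>_ge[OF y(2)] y
            by (intro mult_left_mono mult_mono mult_nonneg_nonneg g_nonneg) auto
          then have "inverse C5 * inverse C6 * K1 * (g (norm (x - y)) * g (norm y)) \<le> ?w y * \<phi> y"
            using y by (simp add: mult_ac norm_minus_commute max_absorb2)
          then have "ennreal (inverse C5 * inverse C6 * K1 * (g (norm (x - y)) * g (norm y))) \<le> ennreal (?w y * \<phi> y)"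
            by (rule ennreal_leI)
          then show ?thesis using True y C5 C6 K1 by (simp add: ennreal_mult'[symmetric] max_absorb2)
        qed auto
      qed
      finally show ?thesis .
    qed
    ultimately have "ennreal K0 * (ennreal (inverse C5 * inverse C6 * K1) * conv x) \<le> ennreal (\<phi> x)"
      by (meson mult_left_mono order_trans zero_le)
    then show ?thesis using K0 by (simp add: K2_def ennreal_mult' mult.assoc)
  qed
  define \<rho>' where "\<rho>' = max (max \<rho> (r + 1)) 1"
  have g\<rho>: "0 < g \<rho>'" by (rule g_pos) (simp add: \<rho>'_def)
  \<comment> \<open>The first entry yields the factor \<open>B\<close>, with the modulus because
    \<open>B\<close> may be negative; the second, by \<open>conv_le\<close>, excludes
    \<open>norm x \<le> \<rho>'\<close>.\<close>
  define C where "C = max (\<bar>B\<bar> * C5 / K2) (g 1 * G' / g \<rho>')"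
  have C0: "0 \<le> C" using K2 C5 by (simp add: C_def le_max_iff_disj)
  have "\<not> convolution_cond TYPE('n) g C" using nb by blast
  then obtain x :: "real ^ 'n" where x: "1 \<le> norm x" "ennreal (C * g (norm x)) < conv x"
    by (auto simp: convolution_cond_def conv_def not_le)
  have x\<rho>: "\<rho>' < norm x"
  proof (rule ccontr)
    assume n: "\<not> \<rho>' < norm x"
    have "g 1 * G' = g 1 * G' / g \<rho>' * g \<rho>'" using g\<rho> by simp
    also have "\<dots> \<le> C * g (norm x)"
      using n x(1) g\<rho> C0 by (intro mult_mono g_le) (auto simp: C_def)
    finally have "ennreal (g 1 * G') \<le> ennreal (C * g (norm x))" by (rule ennreal_leI)
    then show False using x(2) conv_le[of x] by (meson leD order_trans)
  qed
  have x0: "x \<noteq> 0" using x(1) by auto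
  have gx: "0 < g (norm x)" using x(1) by (intro g_pos) linarith
  have \<nu>x: "0 < \<nu> x"
  proof -
    have "0 < inverse C5 * g (norm x)" using C5 gx by simp
    then show "0 < \<nu> x" using \<nu>_lower[OF x0] by linarith
  qed
  have "ennreal (K2 * (C * g (norm x))) < ennreal K2 * conv x"
  proof -
    have "ennreal (K2 * (C * g (norm x))) = ennreal K2 * ennreal (C * g (norm x))" using K2 by (simp add: ennreal_mult')
    also have "\<dots> < ennreal K2 * conv x" using x(2) K2 by (intro ennreal_mult_strict_left_mono) auto
    finally show ?thesis .
  qed
  also have "\<dots> \<le> ennreal (\<phi> x)" by (rule \<phi>_conv) (use x\<rho> in \<open>simp add: \<rho>'_def\<close>)
  finally have lt: "K2 * (C * g (norm x)) < \<phi> x"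
    using K2 C0 gx by (subst (asm) ennreal_less_iff) auto
  have "B * \<nu> x \<le> \<bar>B\<bar> * (C5 * g (norm x))"
    using \<nu>_upper[OF x0] \<nu>x by (intro mult_mono) auto
  also have "\<dots> = K2 * (\<bar>B\<bar> * C5 / K2 * g (norm x))" using K2 by simp
  also have "\<dots> \<le> K2 * (C * g (norm x))"
    using K2 gx by (intro mult_left_mono mult_right_mono) (auto simp: C_def)
  also note lt
  finally have "B < \<phi> x / \<nu> x" using \<nu>x by (simp add: pos_less_divide_eq)
  moreover have "\<rho> \<le> norm x" using x\<rho> by (simp add: \<rho>'_def)
  ultimately show "\<exists>x. \<rho> \<le> norm x \<and> B < \<phi> x / \<nu> x" by blast
qed

end

lemma levy_eigenfunctionI:
  assumes "symmetric_levy_process M X A (density lborel (\<lambda>x. ennreal (\<nu> x)))" "\<nu> \<in> borel_measurable borel"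
    "kato_decomposable M X V" "eigenfunction M X V lam \<phi>" "\<And>x. 0 < \<phi> x" "\<And>s. 0 < s \<Longrightarrow> 0 < g s"
    "antimono_on {0<..} g" "1 \<le> C5"
    "\<And>x. x \<noteq> 0 \<Longrightarrow> inverse C5 * g (norm x) \<le> \<nu> x \<and> \<nu> x \<le> C5 * g (norm x)"
  shows "levy_eigenfunction M X A (density lborel (\<lambda>x. ennreal (\<nu> x))) V \<phi> \<nu> g lam C5"
proof -
  have "prob_space M" using assms(1) by (simp add: symmetric_levy_process_def levy_process_def)
  moreover have "sigma_finite_measure (density lborel (\<lambda>x. ennreal (\<nu> x)))"
    using assms(2)
    by (subst sigma_finite_measure.sigma_finite_iff_density_finite[OF lborel.sigma_finite_measure_axioms]) auto
  ultimately show ?thesis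
    using assms by (intro levy_eigenfunction.intro sym_levy.intro sym_levy_axioms.intro levy_eigenfunction_axioms.intro) auto
qed

theorem theorem4p1:
  fixes V :: "real ^ 'n \<Rightarrow> real"
  assumes "(V \<longlongrightarrow> 0) at_infinity"
  shows "\<exists>r :: real \<Rightarrow> real. (\<forall>\<delta>>0. 1 \<le> r \<delta>) \<and>
    (\<forall>(M :: 'w measure) (X :: real \<Rightarrow> 'w \<Rightarrow> real ^ 'n) (A :: real ^ 'n ^ 'n)
       (\<nu> :: real ^ 'n \<Rightarrow> real) (\<phi> :: real ^ 'n \<Rightarrow> real) (lam :: real) (g :: real \<Rightarrow> real) (C5 :: real).
      \<nu> \<in> borel_measurable borel \<and> (\<forall>x. x \<noteq> 0 \<longrightarrow> 0 < \<nu> x) \<and>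
      symmetric_levy_process M X A (density lborel (\<lambda>x. ennreal (\<nu> x))) \<and>
      emeasure (density lborel (\<lambda>x. ennreal (\<nu> x))) (UNIV - {0}) = \<infinity> \<and>
      kato_decomposable M X V \<and>
      eigenfunction M X V lam \<phi> \<and> (\<forall>x. 0 < \<phi> x) \<and>
      (\<forall>s>0. 0 < g s) \<and> antimono_on {0<..} g \<and> 1 \<le> C5 \<and>
      (\<forall>x. x \<noteq> 0 \<longrightarrow> inverse C5 * g (norm x) \<le> \<nu> x \<and> \<nu> x \<le> C5 * g (norm x))
      \<longrightarrow>
      (\<forall>C6. shift_cond TYPE('n) g C6 \<longrightarrow>
         (\<forall>\<delta>>0. \<forall>x. r \<delta> + 1 < norm x \<longrightarrow>
            \<phi> x \<ge> ((1 - exp (- (\<bar>lam\<bar> + \<delta>))) / (C5\<^sup>2 * C6 ^ (nat \<lceil>r \<delta>\<rceil> + 1) * (\<bar>lam\<bar> + \<delta>))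
                     * survival_prob M X (ball 0 1) 1 * (LINT z:ball 0 (r \<delta>)|lborel. \<phi> z)) * \<nu> x)) \<and>
      ((\<nexists>C6. shift_cond TYPE('n) g C6) \<longrightarrow> (\<nexists>C7. convolution_cond TYPE('n) g C7)) \<and>
      (((\<exists>C6. shift_cond TYPE('n) g C6) \<and> (\<nexists>C7. convolution_cond TYPE('n) g C7))
         \<or> (\<nexists>C6. shift_cond TYPE('n) g C6) \<longrightarrow>
         Limsup at_infinity (\<lambda>x. ereal (\<phi> x / \<nu> x)) = \<infinity>))"
proof -
  \<comment> \<open>\<open>r\<close> is chosen from \<open>V\<close> and \<delta> alone, before any
    process enters; the added 1/2 is the gap used in \<open>lower_bound\<close>.\<close>
  have "\<exists>r\<ge>1. \<forall>z. r - 1 / 2 < norm z \<longrightarrow> V z \<le> \<delta>" if "0 < \<delta>" for \<delta>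
  proof -
    have "\<forall>\<^sub>F z in at_infinity. V z < \<delta>" using assms that by (rule order_tendstoD(2))
    then obtain b where "\<And>z. b \<le> norm z \<Longrightarrow> V z < \<delta>" unfolding eventually_at_infinity by blast
    then show ?thesis by (intro exI[of _ "max 1 (b + 1 / 2)"]) (auto intro: less_imp_le)
  qed
  then obtain r where r: "\<And>\<delta>. 0 < \<delta> \<Longrightarrow> 1 \<le> r \<delta>" "\<And>\<delta> z. 0 < \<delta> \<Longrightarrow> r \<delta> - 1 / 2 < norm z \<Longrightarrow> V z \<le> \<delta>"
    by metis
  show ?thesis
  proof (intro exI[of _ r] conjI allI impI, goal_cases)
    case (1 \<delta>)
    then show ?case by (rule r(1))
  next
    case (2 M X A \<nu> \<phi> lam g C5 C6 \<delta> x)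
    interpret levy_eigenfunction M X A "density lborel (\<lambda>x. ennreal (\<nu> x))" V \<phi> \<nu> g lam C5
      using 2 by (intro levy_eigenfunctionI) auto
    show ?case using 2 r by (intro lower_bound_survival) auto
  next
    case (3 M X A \<nu> \<phi> lam g C5)
    then show ?case using convolution_cond_imp_shift_cond[of g] by blast
  next
    case (4 M X A \<nu> \<phi> lam g C5)
    interpret levy_eigenfunction M X A "density lborel (\<lambda>x. ennreal (\<nu> x))" V \<phi> \<nu> g lam C5
      using 4 by (intro levy_eigenfunctionI) auto
    show ?case
      using 4(2) limsup_without_shift_cond[OF assms] limsup_without_convolution_cond[OF assms] by blast
  qed
qed

end
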